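(* Let $f\colon S^1\to S^1$ be an orientation reversing homeomorphism of the circle. Then $f$ admits a kinematic expansive suspension if and only if $f$ has wandering points, the fixed points of $f$ are not accumulated by periodic points, and the wandering set of $f$ has a finite number of connected components.
   Context: The wandering set of $f$ is the complement of its non-wandering set. Given a homeomorphism $f\colon l\to l$ of a compact metric space and a continuous return time function $T\colon l\to\mathbb{R}^+=(0,\infty)$, the suspension of $f$ with return time $T$ is the flow on the quotient of $\{(x,t):x\in l,\ 0\le t\le T(x)\}$ by $(x,T(x))\sim(f(x),0)$ that moves points along the second coordinate at unit speed. A homeomorphism admits a kinematic expansive suspension if for some such $T$ its suspension is kinematic expansive. A continuous flow $\phi$ on a compact metric space is kinematic expansive if for all $\epsilon>0$ there exists $\delta>0$ such that if $\operatorname{dist}(\phi_t(x),\phi_t(y))<\delta$ for all $t\in\mathbb{R}$ then there exists $s\in\mathbb{R}$ with $|s|<\epsilon$ and $y=\phi_s(x)$ (this does not depend on the metric inducing the topology). *)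

theory Defs
  imports "HOL-Analysis.Analysis"
begin

section \<open>Non-wandering points and periodic points\<close>

text \<open>A self-map of a space \<open>l\<close> is given by a function on the ambient type; only its values on \<open>l\<close>
  matter.\<close>

definition nonwandering_set :: "'a::topological_space set \<Rightarrow> ('a \<Rightarrow> 'a) \<Rightarrow> 'a set" where
  "nonwandering_set l f =
     {x \<in> l. \<forall>U. openin (top_of_set l) U \<and> x \<in> U \<longrightarrow> (\<exists>n\<ge>1. (f ^^ n) ` U \<inter> U \<noteq> {})}"

definition wandering_set :: "'a::topological_space set \<Rightarrow> ('a \<Rightarrow> 'a) \<Rightarrow> 'a set" where
  "wandering_set l f = l - nonwandering_set l f"

definition fixed_points :: "'a set \<Rightarrow> ('a \<Rightarrow> 'a) \<Rightarrow> 'a set" where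
  "fixed_points l f = {x \<in> l. f x = x}"

definition periodic_points :: "'a set \<Rightarrow> ('a \<Rightarrow> 'a) \<Rightarrow> 'a set" where
  "periodic_points l f = {x \<in> l. \<exists>n\<ge>1. (f ^^ n) x = x}"


section \<open>Homeomorphisms of the circle\<close>

abbreviation unit_circle :: "complex set" where
  "unit_circle \<equiv> sphere 0 1"

text \<open>A circle homeomorphism reverses orientation when it has a strictly decreasing continuous lift
  to the universal cover \<open>cis\<close> of the circle.\<close>

definition orientation_reversing_homeo :: "(complex \<Rightarrow> complex) \<Rightarrow> bool" where
  "orientation_reversing_homeo f \<longleftrightarrow>
     (\<exists>g. homeomorphism unit_circle unit_circle f g) \<and>
     (\<exists>F :: real \<Rightarrow> real. continuous_on UNIV F \<and> strict_antimono_on UNIV F \<and>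
        (\<forall>t. f (cis t) = cis (F t)))"


section \<open>Kinematic expansive flows\<close>

definition continuous_flow :: "'b topology \<Rightarrow> (real \<Rightarrow> 'b \<Rightarrow> 'b) \<Rightarrow> bool" where
  "continuous_flow X \<phi> \<longleftrightarrow>
     continuous_map (prod_topology euclideanreal X) X (\<lambda>(t, x). \<phi> t x) \<and>
     (\<forall>x \<in> topspace X. \<phi> 0 x = x) \<and>
     (\<forall>x \<in> topspace X. \<forall>s t. \<phi> (s + t) x = \<phi> s (\<phi> t x))"

definition kinematic_expansive_wrt ::
    "'b set \<Rightarrow> ('b \<Rightarrow> 'b \<Rightarrow> real) \<Rightarrow> (real \<Rightarrow> 'b \<Rightarrow> 'b) \<Rightarrow> bool" where
  "kinematic_expansive_wrt M d \<phi> \<longleftrightarrow>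
     (\<forall>\<epsilon>>0. \<exists>\<delta>>0. \<forall>x\<in>M. \<forall>y\<in>M.
        (\<forall>t. d (\<phi> t x) (\<phi> t y) < \<delta>) \<longrightarrow> (\<exists>s. \<bar>s\<bar> < \<epsilon> \<and> y = \<phi> s x))"

text \<open>On a compact metrizable space all compatible metrics are uniformly equivalent, so it does not
  matter which of them is used.\<close>

definition kinematic_expansive :: "'b topology \<Rightarrow> (real \<Rightarrow> 'b \<Rightarrow> 'b) \<Rightarrow> bool" where
  "kinematic_expansive X \<phi> \<longleftrightarrow>
     compact_space X \<and> continuous_flow X \<phi> \<and>
     (\<exists>d. Metric_space (topspace X) d \<and> Metric_space.mtopology (topspace X) d = X \<and>
          kinematic_expansive_wrt (topspace X) d \<phi>)"


section \<open>Suspensions\<close>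

definition suspension_domain :: "'a set \<Rightarrow> ('a \<Rightarrow> real) \<Rightarrow> ('a \<times> real) set" where
  "suspension_domain l T = {(x, t). x \<in> l \<and> 0 \<le> t \<and> t \<le> T x}"

text \<open>The equivalence relation generated by \<open>(x, T x) \<sim> (f x, 0)\<close>.\<close>

definition suspension_rel ::
    "'a set \<Rightarrow> ('a \<Rightarrow> 'a) \<Rightarrow> ('a \<Rightarrow> real) \<Rightarrow> (('a \<times> real) \<times> ('a \<times> real)) set" where
  "suspension_rel l f T =
     {(p, q). p \<in> suspension_domain l T \<and> q \<in> suspension_domain l T \<and>
              equivclp (\<lambda>p q. \<exists>x\<in>l. p = (x, T x) \<and> q = (f x, 0)) p q}"

definition suspension_class ::
    "'a set \<Rightarrow> ('a \<Rightarrow> 'a) \<Rightarrow> ('a \<Rightarrow> real) \<Rightarrow> 'a \<times> real \<Rightarrow> ('a \<times> real) set" where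
  "suspension_class l f T p = suspension_rel l f T `` {p}"

definition suspension_space ::
    "'a::topological_space set \<Rightarrow> ('a \<Rightarrow> 'a) \<Rightarrow> ('a \<Rightarrow> real) \<Rightarrow> ('a \<times> real) set topology" where
  "suspension_space l f T =
     topology (\<lambda>V. V \<subseteq> suspension_domain l T // suspension_rel l f T \<and>
                   openin (top_of_set (suspension_domain l T)) (\<Union>V))"

lemma equiv_suspension_rel: "equiv (suspension_domain l T) (suspension_rel l f T)"
proof (intro equivI)
  show "suspension_rel l f T \<subseteq> suspension_domain l T \<times> suspension_domain l T"
    by (auto simp only: suspension_rel_def)
  show "refl_on (suspension_domain l T) (suspension_rel l f T)"
    by (simp add: refl_on_def suspension_rel_def)
  show "sym (suspension_rel l f T)"
    unfolding sym_def suspension_rel_def by (blast dest: equivclp_sym)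
  show "trans (suspension_rel l f T)"
    unfolding trans_def suspension_rel_def by (blast dest: equivclp_trans)
qed

lemma openin_suspension_space:
  "openin (suspension_space l f T) V \<longleftrightarrow>
     V \<subseteq> suspension_domain l T // suspension_rel l f T \<and>
     openin (top_of_set (suspension_domain l T)) (\<Union>V)"
proof -
  let ?D = "suspension_domain l T" and ?R = "suspension_rel l f T"
  have int: "\<Union>(V \<inter> W) = \<Union>V \<inter> \<Union>W" if "V \<subseteq> ?D // ?R" "W \<subseteq> ?D // ?R" for V W
  proof (intro equalityI subsetI)
    fix p assume "p \<in> \<Union>V \<inter> \<Union>W"
    then obtain C D where CD: "C \<in> V" "D \<in> W" "p \<in> C" "p \<in> D" by blast
    then have "C = D"
      using that quotient_disj[OF equiv_suspension_rel, of C l T f D] by blast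
    with CD show "p \<in> \<Union>(V \<inter> W)" by blast
  qed blast
  have un: "\<Union>(\<Union>K) = \<Union>(Union ` K)" for K :: "('a \<times> real) set set set"
    by blast
  have "istopology (\<lambda>V. V \<subseteq> ?D // ?R \<and> openin (top_of_set ?D) (\<Union>V))"
    unfolding istopology_def
  proof (intro conjI allI impI; (elim conjE)?)
    fix V W assume "V \<subseteq> ?D // ?R" "W \<subseteq> ?D // ?R"
      "openin (top_of_set ?D) (\<Union>V)" "openin (top_of_set ?D) (\<Union>W)"
    then show "openin (top_of_set ?D) (\<Union>(V \<inter> W))"
      by (simp add: int openin_Int)
  next
    fix K assume "\<forall>V\<in>K. V \<subseteq> ?D // ?R \<and> openin (top_of_set ?D) (\<Union>V)"
    then show "openin (top_of_set ?D) (\<Union>(\<Union>K))"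
      unfolding un by (intro openin_Union) auto
  qed auto
  then show ?thesis
    by (simp add: suspension_space_def topology_inverse')
qed

lemma topspace_suspension_space:
  "topspace (suspension_space l f T) = suspension_domain l T // suspension_rel l f T"
proof -
  have "openin (suspension_space l f T) (suspension_domain l T // suspension_rel l f T)"
    by (simp add: openin_suspension_space Union_quotient[OF equiv_suspension_rel])
  then show ?thesis
    by (meson openin_subset openin_suspension_space openin_topspace subset_antisym)
qed

lemma quotient_map_suspension_class:
  "quotient_map (top_of_set (suspension_domain l T)) (suspension_space l f T)
     (suspension_class l f T)"
proof -
  let ?D = "suspension_domain l T" and ?R = "suspension_rel l f T"
  have im: "suspension_class l f T ` ?D = ?D // ?R"
    by (auto simp: suspension_class_def quotient_def)
  have "{p \<in> ?D. suspension_class l f T p \<in> V} = \<Union>V" if "V \<subseteq> ?D // ?R" for V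
  proof (intro equalityI subsetI)
    fix p assume p: "p \<in> {p \<in> ?D. suspension_class l f T p \<in> V}"
    then have "p \<in> suspension_class l f T p"
      unfolding suspension_class_def by (intro equiv_class_self[OF equiv_suspension_rel]) simp
    with p show "p \<in> \<Union>V" by blast
  next
    fix p assume "p \<in> \<Union>V"
    then obtain C where C: "C \<in> V" "p \<in> C" by blast
    then obtain q where q: "q \<in> ?D" "C = ?R `` {q}"
      using \<open>V \<subseteq> _\<close> by (auto elim!: quotientE)
    then have "(q, p) \<in> ?R" using C by simp
    then have "?R `` {p} = C"
      using equiv_class_eq[OF equiv_suspension_rel] q by metis
    moreover have "p \<in> ?D"
      using \<open>(q, p) \<in> ?R\<close> by (simp add: suspension_rel_def)
    ultimately show "p \<in> {p \<in> ?D. suspension_class l f T p \<in> V}"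
      using C by (simp add: suspension_class_def)
  qed
  then show ?thesis
    by (simp add: quotient_map_def topspace_suspension_space im openin_suspension_space)
qed

text \<open>The suspension flow is characterised by unit speed motion along the second coordinate, as long
  as this stays inside the domain. When \<open>l\<close> is compact and \<open>T\<close> is continuous and positive, this
  determines \<open>\<phi>\<close> on the whole quotient by the flow property, because \<open>T\<close> is bounded away
  from \<open>0\<close>.\<close>

definition suspension_flow ::
    "'a::topological_space set \<Rightarrow> ('a \<Rightarrow> 'a) \<Rightarrow> ('a \<Rightarrow> real) \<Rightarrow>
     (real \<Rightarrow> ('a \<times> real) set \<Rightarrow> ('a \<times> real) set) \<Rightarrow> bool" where
  "suspension_flow l f T \<phi> \<longleftrightarrow>
     continuous_flow (suspension_space l f T) \<phi> \<and>
     (\<forall>x\<in>l. \<forall>t s. 0 \<le> t \<and> 0 \<le> s \<and> t + s \<le> T x \<longrightarrow>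
        \<phi> s (suspension_class l f T (x, t)) = suspension_class l f T (x, t + s))"

definition admits_kinematic_expansive_suspension ::
    "'a::topological_space set \<Rightarrow> ('a \<Rightarrow> 'a) \<Rightarrow> bool" where
  "admits_kinematic_expansive_suspension l f \<longleftrightarrow>
     (\<exists>T \<phi>. continuous_on l T \<and> (\<forall>x\<in>l. 0 < T x) \<and> suspension_flow l f T \<phi> \<and>
            kinematic_expansive (suspension_space l f T) \<phi>)"

end

theory Submission
  imports Defs
begin

text \<open>For a suspension, orbits stay close for all time exactly when the base orbits stay close and the
  crossing times (Birkhoff sums of the return time \<open>T\<close>) differ by little, so kinematic expansivity
  becomes a condition on \<open>f\<close> and \<open>T\<close>. A lift \<open>F\<close> of \<open>f\<close> fixes some \<open>p\<close> and sends some
  \<open>q \<in> {p<..<p + 2 * pi}\<close> to \<open>q - 2 * pi\<close>; the increasing map \<open>G = F \<circ> F\<close> preserves the arc from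
  \<open>p\<close> to \<open>q\<close>, its fixed points give the periodic points of \<open>f\<close>, and all other points wander.

  If points \<open>x\<close> of period 2 accumulate at a fixed point, then \<open>x\<close> and \<open>f x\<close> lie on one orbit, half a
  period apart, and stay close for ever. If there are infinitely many wandering components, some are
  so small that \<open>T\<close> is almost constant on them and on their images, and then \<open>x\<close> and \<open>f (f x)\<close> stay
  close for ever. Both contradict expansivity.

  Conversely, put \<open>\<Theta> z = M + z\<close> on the arc plus, in each of the finitely many wandering components,
  oscillations of amplitude \<open>1 / n\<close> on the \<open>n\<close>-th iterate of a fundamental domain, with one profile
  in forward and another in backward time. The monotone part separates fixed points, while the
  divergence of the harmonic series separates any two points of a fundamental domain whose pairs of
  profile values differ. Composing \<open>\<Theta>\<close> with the folding of the circle onto the arc yields \<open>T\<close>.\<close>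

section \<open>Suspensions of homeomorphisms of compact sets\<close>

text \<open>Birkhoff sums of \<open>x\<close> and \<open>G x\<close> differ by a telescoping, hence
  bounded, amount. Comparing sums up to a bounded error therefore identifies points only up to their
  orbit, and the rest has to be done by distances; this shapes the converse direction. Finitely many
  wandering components make the union of the closed fundamental domains compact, so that
  \<open>G\<close> moves its points by a definite amount. If the fixed points of \<open>f\<close>
  are not accumulated, the points of period 2 stay in a compact part of the open arc, and
  \<open>f\<close> moves them by a definite amount.

  The amplitudes must tend to 0, because the potential has to be continuous at the fixed points to
  which iterated domains converge, yet they must not be summable. Two profiles are used because a
  fundamental domain with its ends identified is a circle: no continuous real function is injective
  on it, but a pair of functions can be. One is read off in forward and the other in backward
  time.\<close>

text \<open>Forward time only. Backward time is covered by the same condition for the inverse \<open>g\<close> with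
  return time \<open>T \<circ> g\<close>.\<close>

definition shadows :: "('a::metric_space \<Rightarrow> 'a) \<Rightarrow> ('a \<Rightarrow> real) \<Rightarrow> real \<Rightarrow> 'a \<Rightarrow> 'a \<Rightarrow> bool" where
  "shadows f T \<eta> x y \<longleftrightarrow>
     (\<forall>n. dist ((f ^^ n) x) ((f ^^ n) y) < \<eta> \<and> \<bar>\<Sum>i<n. T ((f ^^ i) x) - T ((f ^^ i) y)\<bar> < \<eta>)"

lemma shadows_sym: "shadows h T \<eta> x y \<Longrightarrow> shadows h T \<eta> y x"
  by (simp add: shadows_def dist_commute sum_subtractf abs_minus_commute)

section \<open>Quotient space of the suspension\<close>

locale suspended_homeo =
  fixes l :: "'a::real_normed_vector set" and f g :: "'a \<Rightarrow> 'a" and T :: "'a \<Rightarrow> real"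
  assumes compact_l: "compact l" and homeo: "homeomorphism l l f g"
    and cont_T: "continuous_on l T" and T_pos: "x \<in> l \<Longrightarrow> 0 < T x"
begin

abbreviation "D \<equiv> suspension_domain l T"
abbreviation "cls \<equiv> suspension_class l f T"
abbreviation "X \<equiv> suspension_space l f T"

lemma f_in [simp]: "x \<in> l \<Longrightarrow> f x \<in> l"
  and g_in [simp]: "x \<in> l \<Longrightarrow> g x \<in> l"
  and gf [simp]: "x \<in> l \<Longrightarrow> g (f x) = x"
  and fg [simp]: "x \<in> l \<Longrightarrow> f (g x) = x"
  and cont_f: "continuous_on l f"
  and cont_g: "continuous_on l g"
  using homeo by (auto simp: homeomorphism_def)

lemma D_iff [simp]: "(x, t) \<in> D \<longleftrightarrow> x \<in> l \<and> 0 \<le> t \<and> t \<le> T x"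
  by (simp add: suspension_domain_def)

lemma T_lower: obtains m where "m > 0" "\<And>x. x \<in> l \<Longrightarrow> m \<le> T x"
proof (cases "l = {}")
  case False
  then obtain z where "z \<in> l" "\<And>y. y \<in> l \<Longrightarrow> T z \<le> T y"
    using continuous_attains_inf[OF compact_l _ cont_T] by blast
  then show ?thesis using T_pos that by blast
qed (use that[of 1] in auto)

lemma T_upper: obtains M where "\<And>x. x \<in> l \<Longrightarrow> T x \<le> M"
proof (cases "l = {}")
  case False
  then obtain z where "z \<in> l" "\<And>y. y \<in> l \<Longrightarrow> T y \<le> T z"
    using continuous_attains_sup[OF compact_l _ cont_T] by blast
  then show ?thesis using that by blast
qed (use that[of 1] in auto)

lemma compact_D: "compact D"
proof -
  obtain M where M: "\<And>x. x \<in> l \<Longrightarrow> T x \<le> M" using T_upper by blast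
  have D: "D = {p \<in> l \<times> {0..M}. snd p - T (fst p) \<in> {..0}}"
    using M by (force simp: suspension_domain_def)
  have "continuous_on (l \<times> {0..M}) (\<lambda>p. snd p - T (fst p))"
    by (intro continuous_intros continuous_on_compose2[OF cont_T]) auto
  then have "closedin (top_of_set (l \<times> {0..M})) D"
    unfolding D using continuous_closedin_preimage[of "l \<times> {0..M}" "\<lambda>p. snd p - T (fst p)" "{..0::real}"]
    by (simp add: vimage_def Int_def)
  then show ?thesis
    using closedin_compact compact_l compact_Times by blast
qed

text \<open>Representative of a class at height strictly below the return time.\<close>

definition nf :: "'a \<times> real \<Rightarrow> 'a \<times> real" where
  "nf p = (if snd p = T (fst p) then (f (fst p), 0) else p)"

text \<open>A gluing step preserves \<open>nf\<close>: the point \<open>(f x, 0)\<close> lies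
  strictly below its positive return time and is already normal. This turns the generated
  equivalence into an explicit equality.\<close>

lemma cls_eq_iff:
  assumes "p \<in> D" "q \<in> D"
  shows "cls p = cls q \<longleftrightarrow> nf p = nf q"
proof -
  let ?r = "\<lambda>p q. \<exists>x\<in>l. p = (x, T x) \<and> q = (f x, 0)"
  have one: "nf a = nf b" if "?r a b" for a b
    using that T_pos[OF f_in] by (force simp: nf_def)
  have 1: "nf a = nf b" if "equivclp ?r a b" for a b
    using that
  proof (induction rule: equivclp_induct)
    case (step y z)
    then show ?case using one[of y z] one[of z y] by presburger
  qed simp
  have 2: "equivclp ?r a (nf a)" if "a \<in> D" for a
  proof (cases "snd a = T (fst a)")
    case True
    then have "?r a (nf a)" using that by (cases a) (auto simp: nf_def)
    then show ?thesis by (rule r_into_equivclp)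
  qed (simp add: nf_def)
  have "cls p = cls q \<longleftrightarrow> (p, q) \<in> suspension_rel l f T"
    unfolding suspension_class_def
    using assms eq_equiv_class_iff[OF equiv_suspension_rel] by blast
  also have "\<dots> \<longleftrightarrow> equivclp ?r p q"
    using assms by (simp add: suspension_rel_def)
  also have "\<dots> \<longleftrightarrow> nf p = nf q"
  proof
    assume "nf p = nf q"
    then have "equivclp ?r (nf p) q" using equivclp_sym[OF 2[OF assms(2)]] by simp
    then show "equivclp ?r p q" using equivclp_trans[OF 2[OF assms(1)]] by blast
  qed (rule 1)
  finally show ?thesis .
qed

lemma cls_glue: "x \<in> l \<Longrightarrow> cls (x, T x) = cls (f x, 0)"
  using T_pos[of x] T_pos[of "f x"] by (subst cls_eq_iff) (auto simp: nf_def)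

lemma topspace_X: "topspace X = cls ` D"
  using quotient_imp_surjective_map[OF quotient_map_suspension_class, of l f T] by simp

lemma continuous_cls: "continuous_map (top_of_set D) X cls"
  using quotient_imp_continuous_map[OF quotient_map_suspension_class] .

lemma compact_X: "compact_space X"
proof -
  have "compactin X (cls ` D)"
    using image_compactin[OF _ continuous_cls, of D] compact_D
    by (simp add: compactin_subtopology)
  then show ?thesis by (simp add: compact_space_def topspace_X)
qed

text \<open>A continuous injection of a compact space into a Hausdorff space is an embedding, so it
  suffices to find a continuous map \<open>E\<close> on \<open>D\<close> into a metric space whose
  fibres are exactly the classes.\<close>

lemma metrizable_X: "metrizable_space X"
proof -
  \<comment> \<open>The last component of \<open>E\<close> shows the base point next to both ends of a fibre; its weight
    vanishes halfway, where the case distinction switches from \<open>x\<close> to \<open>f x\<close>.\<close>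
  define r where "r p = snd p / T (fst p)" for p :: "'a \<times> real"
  define E where "E p = (cis (2 * pi * r p), sin (pi * r p) *\<^sub>R fst p,
      if r p \<le> 1/2 then (cos (pi * r p))\<^sup>2 *\<^sub>R fst p else (cos (pi * r p))\<^sup>2 *\<^sub>R f (fst p))"
    for p :: "'a \<times> real"
  have fstD: "fst p \<in> l" if "p \<in> D" for p using that by (cases p) auto
  have Tnz: "T (fst p) \<noteq> 0" if "p \<in> D" for p using T_pos[OF fstD[OF that]] by simp
  have cT: "continuous_on D (\<lambda>p. T (fst p))"
    by (intro continuous_on_compose2[OF cont_T] continuous_intros) (use fstD in auto)
  have cr: "continuous_on D r"
    unfolding r_def by (intro continuous_intros cT) (use Tnz in auto)
  have cf: "continuous_on D (\<lambda>p. f (fst p))"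
    by (intro continuous_on_compose2[OF cont_f] continuous_intros) (use fstD in auto)
  have "cos (pi * r p) = 0" if "r p = 1/2" for p
    using that by (metis cos_pi_half times_divide_eq_right mult.right_neutral)
  then have "continuous_on D (\<lambda>p. if r p \<le> 1/2 then (cos (pi * r p))\<^sup>2 *\<^sub>R fst p
           else (cos (pi * r p))\<^sup>2 *\<^sub>R f (fst p))"
    by (intro continuous_on_cases_le continuous_intros cr continuous_on_subset[OF cr] continuous_on_subset[OF cf])
       auto
  then have cE: "continuous_on D E"
    unfolding E_def by (intro continuous_intros cr)
  have r01: "0 \<le> r p \<and> r p \<le> 1" if "p \<in> D" for p
    using that T_pos[OF fstD[OF that]] by (cases p) (auto simp: r_def)
  have r1: "r p = 1 \<longleftrightarrow> snd p = T (fst p)" if "p \<in> D" for p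
    using Tnz[OF that] by (auto simp: r_def)
  have r0: "r p = 0 \<longleftrightarrow> snd p = 0" if "p \<in> D" for p
    using Tnz[OF that] by (auto simp: r_def)
  have nfD: "nf p \<in> D \<and> r (nf p) < 1 \<and> E (nf p) = E p" if "p \<in> D" for p
  proof (cases "snd p = T (fst p)")
    case True
    have "nf p = (f (fst p), 0)" using True by (simp add: nf_def)
    moreover have "r p = 1" using r1[OF that] True by simp
    moreover have "r (f (fst p), 0) = 0" by (simp add: r_def)
    ultimately show ?thesis using fstD[OF that] T_pos[of "f (fst p)"] by (simp add: E_def)
  next
    case False
    then have "r p < 1" "nf p = p" using r01[OF that] r1[OF that] by (auto simp: nf_def)
    then show ?thesis using that by simp
  qed
  \<comment> \<open>The first component recovers the relative height, which lies in [0, 1) here. The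
    second then recovers the base point, except at height 0, where its weight vanishes and the third
    takes over.\<close>
  have injE: "p = q" if "p \<in> D" "q \<in> D" "r p < 1" "r q < 1" "E p = E q" for p q
  proof -
    have "cis (2 * pi * r p) = cis (2 * pi * r q)" using that by (simp add: E_def)
    then have "sin (2 * pi * r p) = sin (2 * pi * r q) \<and> cos (2 * pi * r p) = cos (2 * pi * r q)"
      by (simp add: complex_eq_iff)
    then obtain n :: int where "2 * pi * r p = 2 * pi * r q + 2 * pi * n"
      using sin_cos_eq_iff by blast
    then have "2 * pi * r p = 2 * pi * (r q + n)" by (simp add: algebra_simps)
    then have "r p = r q + n" by simp
    moreover have "-1 < real_of_int n \<and> real_of_int n < 1"
      using calculation r01[of p] r01[of q] that by linarith
    then have "n = 0" by linarith
    ultimately have rr: "r p = r q" by simp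
    have "fst p = fst q"
    proof (cases "r p = 0")
      case True
      then show ?thesis using that rr by (simp add: E_def)
    next
      case False
      then have "0 < pi * r p" "pi * r p < pi" using r01[OF that(1)] that by auto
      then have "sin (pi * r p) > 0" by (intro sin_gt_zero) auto
      then show ?thesis using that rr by (simp add: E_def)
    qed
    moreover have "snd p = snd q"
      using rr Tnz[OF that(1)] calculation by (simp add: r_def)
    ultimately show ?thesis by (simp add: prod_eq_iff)
  qed
  have E_iff: "cls p = cls q \<longleftrightarrow> E p = E q" if "p \<in> D" "q \<in> D" for p q
  proof -
    have "nf p = nf q \<longleftrightarrow> E (nf p) = E (nf q)"
      using nfD[OF that(1)] nfD[OF that(2)] injE[of "nf p" "nf q"] by metis
    then show ?thesis using cls_eq_iff[OF that] nfD[OF that(1)] nfD[OF that(2)] by simp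
  qed
  have "continuous_map (top_of_set D) euclidean E" using cE by simp
  then obtain h where h: "continuous_map X euclidean h" "\<And>p. p \<in> D \<Longrightarrow> h (cls p) = E p"
    by (rule quotient_map_lift_exists[OF quotient_map_suspension_class]) (use E_iff in auto)
  have "inj_on h (topspace X)"
    unfolding topspace_X using h E_iff by (auto simp: inj_on_def)
  then have "embedding_map X euclidean h"
    using continuous_imp_embedding_map[OF h(1) compact_X] by simp
  then have "X homeomorphic_space subtopology euclidean (h ` topspace X)"
    by (meson embedding_map_def homeomorphic_map_imp_homeomorphic_space)
  then show ?thesis
    using homeomorphic_metrizable_space metrizable_space_subtopology[OF metrizable_space_euclidean] by blast
qed

section \<open>Iterates and crossing times in both time directions\<close>

definition iter :: "int \<Rightarrow> 'a \<Rightarrow> 'a" where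
  "iter n = (if 0 \<le> n then f ^^ nat n else g ^^ nat (- n))"

text \<open>The additive cocycle of \<open>T\<close> over \<open>iter\<close>: the flow time from
  \<open>(x, 0)\<close> to \<open>(iter n x, 0)\<close>. For negative \<open>n\<close> the fibres
  crossed are those over the preimages, hence the extra \<open>g\<close>.\<close>

definition hit :: "int \<Rightarrow> 'a \<Rightarrow> real" where
  "hit n x = (if 0 \<le> n then \<Sum>i<nat n. T ((f ^^ i) x) else - (\<Sum>i<nat (- n). T (g ((g ^^ i) x))))"

lemma iter_0 [simp]: "iter 0 x = x" and hit_0 [simp]: "hit 0 x = 0"
  by (auto simp: iter_def hit_def)

lemma iter_of_nat: "iter (int n) x = (f ^^ n) x" and iter_minus_of_nat: "iter (- int n) x = (g ^^ n) x"
  by (auto simp: iter_def)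

lemma hit_of_nat: "hit (int n) x = (\<Sum>i<n. T ((f ^^ i) x))"
  and hit_minus_of_nat: "hit (- int n) x = - (\<Sum>i<n. T (g ((g ^^ i) x)))"
  by (auto simp: hit_def)

lemma fpow_in [simp]: "x \<in> l \<Longrightarrow> (f ^^ n) x \<in> l" and gpow_in [simp]: "x \<in> l \<Longrightarrow> (g ^^ n) x \<in> l"
  by (induction n) auto

lemma iter_in [simp]: "x \<in> l \<Longrightarrow> iter n x \<in> l"
  by (auto simp: iter_def)

lemma iter_succ: "x \<in> l \<Longrightarrow> iter (n + 1) x = f (iter n x)"
  and hit_succ: "x \<in> l \<Longrightarrow> hit (n + 1) x = hit n x + T (iter n x)"
proof -
  assume x: "x \<in> l"
  show "iter (n + 1) x = f (iter n x)" "hit (n + 1) x = hit n x + T (iter n x)"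
  proof (atomize (full), cases "0 \<le> n")
    case True
    then have "nat (n + 1) = Suc (nat n)" by simp
    then show "iter (n + 1) x = f (iter n x) \<and> hit (n + 1) x = hit n x + T (iter n x)"
      using True by (simp add: iter_def hit_def)
  next
    case False
    define k where "k = nat (- (n + 1))"
    have n: "n + 1 = - int k" "n = - int (Suc k)" using False by (auto simp: k_def)
    show "iter (n + 1) x = f (iter n x) \<and> hit (n + 1) x = hit n x + T (iter n x)"
      unfolding n(1) unfolding n(2) iter_minus_of_nat hit_minus_of_nat using x by simp
  qed
qed

lemma iter_pred: "x \<in> l \<Longrightarrow> iter (n - 1) x = g (iter n x)"
  using iter_succ[of x "n - 1"] by simp

lemma hit_pred: "x \<in> l \<Longrightarrow> hit (n - 1) x = hit n x - T (iter (n - 1) x)"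
  using hit_succ[of x "n - 1"] by simp

lemma iter_add: "x \<in> l \<Longrightarrow> iter (k + n) x = iter n (iter k x)"
proof (induction n rule: int_induct[where k = 0])
  case (step1 i)
  then show ?case using iter_succ[of x "k + i"] iter_succ[of "iter k x" i] by (simp add: add.assoc)
next
  case (step2 i)
  then show ?case using iter_pred[of x "k + i"] iter_pred[of "iter k x" i] by (simp add: algebra_simps)
qed simp

lemma hit_add: "x \<in> l \<Longrightarrow> hit (k + n) x = hit k x + hit n (iter k x)"
proof (induction n rule: int_induct[where k = 0])
  case (step1 i)
  then show ?case using hit_succ[of x "k + i"] hit_succ[of "iter k x" i] iter_add[of x k i]
    by (simp add: add.assoc)
next
  case (step2 i)
  then show ?case using hit_pred[of x "k + i"] hit_pred[of "iter k x" i] iter_add[of x k "i - 1"]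
    by (simp add: algebra_simps)
qed simp

lemma hit_ge: "x \<in> l \<Longrightarrow> (\<And>y. y \<in> l \<Longrightarrow> m \<le> T y) \<Longrightarrow> real n * m \<le> hit (k + int n) x - hit k x"
proof (induction n)
  case (Suc n)
  then have "m \<le> T (iter (k + int n) x)" by simp
  moreover have "real n * m \<le> hit (k + int n) x - hit k x" using Suc by simp
  moreover have "hit (k + int (Suc n)) x = hit (k + int n) x + T (iter (k + int n) x)"
    using hit_succ[of x "k + int n"] Suc.prems by (simp add: add.commute add.left_commute)
  moreover have "real (Suc n) * m = real n * m + m" by (simp add: algebra_simps)
  ultimately show ?case by linarith
qed simp

lemma hit_less: "x \<in> l \<Longrightarrow> i < j \<Longrightarrow> hit i x < hit j x"
proof -
  assume x: "x \<in> l" and "i < j"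
  obtain m where m: "m > 0" "\<And>x. x \<in> l \<Longrightarrow> m \<le> T x" using T_lower by blast
  have "0 < real (nat (j - i)) * m" using m \<open>i < j\<close> by simp
  also have "\<dots> \<le> hit j x - hit i x" using hit_ge[OF x m(2), of "nat (j - i)" i] \<open>i < j\<close> by simp
  finally show ?thesis by simp
qed

lemma hit_less_iff: "x \<in> l \<Longrightarrow> hit i x < hit j x \<longleftrightarrow> i < j"
  using hit_less by (metis less_asym linorder_neqE order_less_irrefl)

lemma hit_le_iff: "x \<in> l \<Longrightarrow> hit i x \<le> hit j x \<longleftrightarrow> i \<le> j"
  using hit_less_iff by (metis linorder_not_le)

text \<open>Every fibre takes at least time \<open>m\<close> to cross, so a bounded time interval
  meets boundedly many of them. This provides the local finiteness in
  \<open>continuous_orb\<close>.\<close>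

lemma hit_bound:
  assumes "x \<in> l" "m > 0" "\<And>y. y \<in> l \<Longrightarrow> m \<le> T y" "hit n x \<le> t" "t \<le> hit (n + 1) x"
  shows "\<bar>real_of_int n\<bar> * m \<le> \<bar>t\<bar> + m"
proof (cases "0 \<le> n")
  case True
  then have "real (nat n) * m \<le> hit n x" using hit_ge[OF assms(1,3), of "nat n" 0] by simp
  then show ?thesis using assms True by simp
next
  case False
  then have "real (nat (- n - 1)) * m \<le> hit 0 x - hit (n + 1) x"
    using hit_ge[OF assms(1,3), of "nat (- n - 1)" "n + 1"] by simp
  moreover have "real (nat (- n - 1)) = \<bar>real_of_int n\<bar> - 1" using False by simp
  ultimately have "(\<bar>real_of_int n\<bar> - 1) * m \<le> - hit (n + 1) x" by simp
  then show ?thesis using assms by (simp add: algebra_simps)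
qed

lemma ex_index: assumes x: "x \<in> l" shows "\<exists>n. hit n x \<le> t \<and> t < hit (n + 1) x"
proof -
  obtain m where m: "m > 0" "\<And>x. x \<in> l \<Longrightarrow> m \<le> T x" using T_lower by blast
  obtain N :: nat where N: "\<bar>t\<bar> < real N * m"
    using reals_Archimedean3[OF m(1)] by blast
  have lo: "hit (- int N) x \<le> t"
    using hit_ge[OF x m(2), of N "- int N"] N by simp
  have up: "t < hit (int n) x" if "N \<le> n" for n
  proof -
    have "real N * m \<le> real n * m" using that m by simp
    then show ?thesis using hit_ge[OF x m(2), of n 0] N by simp
  qed
  \<comment> \<open>Searching upwards from \<open>- int N\<close>, where the crossing time is still
    at most \<open>t\<close>, makes the predecessor of the first success the index sought.\<close>
  define k where "k = (LEAST k. t < hit (- int N + int k) x)"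
  have ex: "t < hit (- int N + int (2 * N)) x" using up[of N] by simp
  have k: "t < hit (- int N + int k) x" unfolding k_def by (rule LeastI) (rule ex)
  have k0: "k \<noteq> 0" using k lo by (intro notI) simp
  then have "\<not> t < hit (- int N + int (k - 1)) x"
    unfolding k_def by (intro not_less_Least) simp
  then show ?thesis using k k0 by (intro exI[of _ "- int N + int (k - 1)"]) (simp add: of_nat_diff)
qed

section \<open>Orbits of the suspension flow\<close>

definition orb :: "'a \<Rightarrow> real \<Rightarrow> ('a \<times> real) set" where
  "orb x t = (let n = SOME n. hit n x \<le> t \<and> t < hit (n + 1) x in cls (iter n x, t - hit n x))"

text \<open>Both end times are allowed: at \<open>t = hit (n + 1) x\<close> the top of one fibre is
  glued to the bottom of the next. The closed pieces used to paste \<open>orb\<close> together rely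
  on this.\<close>

lemma orb_eq:
  assumes x: "x \<in> l" and t: "hit n x \<le> t" "t \<le> hit (n + 1) x"
  shows "orb x t = cls (iter n x, t - hit n x)"
proof -
  define k where "k = (SOME n. hit n x \<le> t \<and> t < hit (n + 1) x)"
  have k: "hit k x \<le> t" "t < hit (k + 1) x"
    using someI_ex[OF ex_index[OF x, of t]] by (auto simp: k_def)
  have orb: "orb x t = cls (iter k x, t - hit k x)" by (simp add: orb_def k_def Let_def)
  have "hit n x < hit (k + 1) x" "hit k x \<le> hit (n + 1) x" using k t by linarith+
  then have "n < k + 1" "k \<le> n + 1" using x hit_less_iff hit_le_iff by blast+
  then consider "k = n" | "k = n + 1" by linarith
  then show ?thesis
  proof cases
    case 2
    then have "t = hit (n + 1) x" using k t by simp
    then show ?thesis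
      using orb 2 cls_glue[of "iter n x"] x by (simp add: iter_succ hit_succ)
  qed (use orb in simp)
qed

lemma orb_cls: "x \<in> l \<Longrightarrow> 0 \<le> t \<Longrightarrow> t \<le> T x \<Longrightarrow> orb x t = cls (x, t)"
  using orb_eq[of x 0 t] hit_succ[of x 0] by simp

lemma orb_it: assumes x: "x \<in> l" shows "orb (iter n x) t = orb x (t + hit n x)"
proof -
  obtain k where k: "hit k (iter n x) \<le> t" "t < hit (k + 1) (iter n x)"
    using ex_index[of "iter n x" t] x by auto
  then have "orb (iter n x) t = cls (iter k (iter n x), t - hit k (iter n x))"
    using x by (intro orb_eq) auto
  moreover have "orb x (t + hit n x) = cls (iter (n + k) x, t + hit n x - hit (n + k) x)"
    using k x hit_add[OF x, of n k] hit_add[OF x, of n "k + 1"]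
    by (intro orb_eq) (auto simp: algebra_simps)
  ultimately show ?thesis using x hit_add[OF x, of n k] iter_add[OF x, of n k] by simp
qed

lemma ex_rep:
  assumes x: "x \<in> l" 
  obtains n where "hit n x \<le> t" "t < hit (n + 1) x" "orb x t = cls (iter n x, t - hit n x)"
     "(iter n x, t - hit n x) \<in> D" "t - hit n x < T (iter n x)"
proof -
  obtain n where n: "hit n x \<le> t" "t < hit (n + 1) x" using ex_index[OF x] by blast
  then show ?thesis using that[of n] orb_eq[OF x, of n t] x hit_succ[OF x, of n] by auto
qed

lemma orb_in: "x \<in> l \<Longrightarrow> orb x t \<in> topspace X"
  by (metis ex_rep image_eqI topspace_X)

lemma topspace_orb: assumes "C \<in> topspace X" obtains x t where "x \<in> l" "0 \<le> t" "t \<le> T x" "C = orb x t"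
  using assms that by (force simp: topspace_X suspension_domain_def orb_cls)

text \<open>Equal classes have equal normal forms, that is, the same base point and height, and by
  \<open>orb_it\<close> these determine the whole orbit.\<close>

lemma orb_cong_shift:
  assumes x: "x \<in> l" and y: "y \<in> l" and "orb x b = orb y a"
  shows "orb x (b + u) = orb y (a + u)"
proof -
  obtain n where n: "orb x b = cls (iter n x, b - hit n x)" "(iter n x, b - hit n x) \<in> D" "b - hit n x < T (iter n x)" using ex_rep[OF x] by blast
  obtain k where k: "orb y a = cls (iter k y, a - hit k y)" "(iter k y, a - hit k y) \<in> D" "a - hit k y < T (iter k y)" using ex_rep[OF y] by blast
  have "iter n x = iter k y \<and> b - hit n x = a - hit k y"
    using assms n k cls_eq_iff[OF n(2) k(2)] by (simp add: nf_def)
  moreover have "orb (iter n x) (b - hit n x + u) = orb x (b + u)" "orb (iter k y) (a - hit k y + u) = orb y (a + u)"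
    using orb_it x y by simp_all
  ultimately show ?thesis by simp
qed

text \<open>Shift both times so that one of them becomes 0. The other point then sits at a height
  below \<open>m\<close>, hence below the top of its own fibre, so both representatives are normal
  and must coincide.\<close>

lemma orb_eq_imp:
  assumes "x \<in> l" "y \<in> l" "\<And>z. z \<in> l \<Longrightarrow> m \<le> T z" "\<bar>s - t\<bar> < m" "orb x s = orb y t"
  shows "x = y \<and> s = t"
proof -
  have key: "x = y \<and> u = 0" if "x \<in> l" "y \<in> l" "0 \<le> u" "u < m" "orb x u = orb y 0" for x y u
  proof -
    have "u < T x" "0 < T y" using assms(3)[of x] T_pos[of y] that by auto
    then have "nf (x, u) = nf (y, 0)"
      using that cls_eq_iff[of "(x, u)" "(y, 0)"] by (simp add: orb_cls)
    then show ?thesis using \<open>u < T x\<close> \<open>0 < T y\<close> by (simp add: nf_def)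
  qed
  show ?thesis
  proof (cases "t \<le> s")
    case True
    have "orb x (s + (- t)) = orb y (t + (- t))" by (rule orb_cong_shift) (use assms in auto)
    then show ?thesis using key[OF assms(1,2), of "s - t"] assms True by simp
  next
    case False
    have "orb x (s + (- s)) = orb y (t + (- s))" by (rule orb_cong_shift) (use assms in auto)
    then show ?thesis using key[OF assms(2,1), of "t - s"] assms False by simp
  qed
qed

lemma continuous_it: "continuous_on l (iter n)"
proof -
  have "continuous_on l (\<lambda>x. (f ^^ n) x)" for n
  proof (induction n)
    case (Suc n)
    have "continuous_on l (\<lambda>x. f ((f ^^ n) x))"
      by (rule continuous_on_compose2[OF cont_f Suc]) auto
    then show ?case by simp
  qed simp
  moreover have "continuous_on l (\<lambda>x. (g ^^ n) x)" for n
  proof (induction n)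
    case (Suc n)
    have "continuous_on l (\<lambda>x. g ((g ^^ n) x))"
      by (rule continuous_on_compose2[OF cont_g Suc]) auto
    then show ?case by simp
  qed simp
  ultimately show ?thesis by (simp add: iter_def)
qed

lemma continuous_S: "continuous_on l (hit n)"
proof (induction n rule: int_induct[where k = 0])
  case base
  then show ?case by (simp add: hit_def)
next
  case (step1 i)
  have "continuous_on l (\<lambda>x. hit i x + T (iter i x))"
    by (intro continuous_intros step1 continuous_on_compose2[OF cont_T continuous_it]) auto
  then show ?case by (rule continuous_on_eq) (simp add: hit_succ)
next
  case (step2 i)
  have "continuous_on l (\<lambda>x. hit i x - T (iter (i - 1) x))"
    by (intro continuous_intros step2 continuous_on_compose2[OF cont_T continuous_it]) auto
  then show ?case by (rule continuous_on_eq) (simp add: hit_pred)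
qed

text \<open>Between consecutive crossing times \<open>orb\<close> is \<open>cls\<close> of a
  continuous function. These closed strips are locally finite, and neighbouring formulas agree on
  the overlaps by \<open>orb_eq\<close>.\<close>

lemma continuous_orb: "continuous_map (top_of_set (l \<times> UNIV)) X (\<lambda>(x, t). orb x t)"
proof -
  define E where "E n = {p \<in> l \<times> UNIV. hit n (fst p) \<le> snd p \<and> snd p \<le> hit (n + 1) (fst p)}" for n
  obtain m where m: "m > 0" "\<And>x. x \<in> l \<Longrightarrow> m \<le> T x" using T_lower by blast
  have cS: "continuous_on (l \<times> UNIV) (\<lambda>p. hit n (fst p))" for n
    by (intro continuous_on_compose2[OF continuous_S] continuous_intros) auto
  show ?thesis
  proof (rule pasting_lemma_locally_finite[where I = UNIV and T = E
        and f = "\<lambda>n p. cls (iter n (fst p), snd p - hit n (fst p))"])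
    fix p assume p: "p \<in> topspace (top_of_set (l \<times> (UNIV :: real set)))"
    define V where "V = l \<times> {snd p - 1<..<snd p + 1}"
    define K where "K = \<lceil>(\<bar>snd p\<bar> + 1 + m) / m\<rceil>"
    have "\<bar>n\<bar> \<le> K" if ne: "E n \<inter> V \<noteq> {}" for n
    proof -
      obtain q where "q \<in> E n" "q \<in> V" using ne by blast
      then obtain x t where "x \<in> l" "hit n x \<le> t" "t \<le> hit (n + 1) x" "\<bar>t - snd p\<bar> < 1"
        by (cases q) (auto simp: E_def V_def abs_less_iff)
      then have "\<bar>real_of_int n\<bar> * m \<le> \<bar>snd p\<bar> + 1 + m"
        using hit_bound[OF \<open>x \<in> l\<close> m] by fastforce
      then have "\<bar>real_of_int n\<bar> \<le> (\<bar>snd p\<bar> + 1 + m) / m" using m by (simp add: pos_le_divide_eq)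
      then show ?thesis unfolding K_def by linarith
    qed
    then have "{n. E n \<inter> V \<noteq> {}} \<subseteq> {- K..K}" by force
    then have "finite {i \<in> UNIV. E i \<inter> V \<noteq> {}}" using finite_subset by auto
    moreover have "openin (top_of_set (l \<times> UNIV)) V"
      unfolding V_def by (intro openin_Times) auto
    moreover have "p \<in> V" using p by (auto simp: V_def mem_Times_iff)
    ultimately show "\<exists>V. openin (top_of_set (l \<times> UNIV)) V \<and> p \<in> V \<and> finite {i \<in> UNIV. E i \<inter> V \<noteq> {}}"
      by blast
  next
    fix n
    have "continuous_on (l \<times> UNIV) (\<lambda>p. hit n (fst p) - snd p)"
         "continuous_on (l \<times> UNIV) (\<lambda>p. snd p - hit (n + 1) (fst p))"
      by (intro continuous_intros cS)+
    from this[THEN continuous_closedin_preimage[OF _ closed_atMost[of 0]]]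
    have "closedin (top_of_set (l \<times> UNIV)) {p \<in> l \<times> UNIV. hit n (fst p) - snd p \<in> {..0}}"
         "closedin (top_of_set (l \<times> UNIV)) {p \<in> l \<times> UNIV. snd p - hit (n + 1) (fst p) \<in> {..0}}"
      by (simp_all add: vimage_def Int_def)
    then have "closedin (top_of_set (l \<times> UNIV)) ({p \<in> l \<times> UNIV. hit n (fst p) - snd p \<in> {..0}} \<inter>
         {p \<in> l \<times> UNIV. snd p - hit (n + 1) (fst p) \<in> {..0}})"
      by (rule closedin_Int)
    also have "{p \<in> l \<times> UNIV. hit n (fst p) - snd p \<in> {..0}} \<inter>
         {p \<in> l \<times> UNIV. snd p - hit (n + 1) (fst p) \<in> {..0}} = E n"
      by (auto simp: E_def)
    finally show "closedin (top_of_set (l \<times> UNIV)) (E n)" .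
  next
    fix n
    have "E n \<subseteq> l \<times> UNIV" by (auto simp: E_def)
    then have sub: "subtopology (top_of_set (l \<times> UNIV)) (E n) = top_of_set (E n)"
      by (simp add: subtopology_subtopology inf_absorb2)
    have "continuous_on (E n) (\<lambda>p. (iter n (fst p), snd p - hit n (fst p)))"
      using \<open>E n \<subseteq> l \<times> UNIV\<close>
      by (intro continuous_intros continuous_on_compose2[OF continuous_it] continuous_on_compose2[OF continuous_S]) auto
    moreover have "(\<lambda>p. (iter n (fst p), snd p - hit n (fst p))) ` E n \<subseteq> D"
      by (auto simp: E_def hit_succ)
    ultimately have "continuous_map (top_of_set (E n)) (top_of_set D) (\<lambda>p. (iter n (fst p), snd p - hit n (fst p)))"
      by (simp add: image_subset_iff_funcset)
    from continuous_map_compose[OF this continuous_cls]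
    show "continuous_map (subtopology (top_of_set (l \<times> UNIV)) (E n)) X
       (\<lambda>p. cls (iter n (fst p), snd p - hit n (fst p)))"
      unfolding sub by (simp add: o_def)
  next
    fix i j p assume "p \<in> topspace (top_of_set (l \<times> UNIV)) \<inter> E i \<inter> E j"
    then show "cls (iter i (fst p), snd p - hit i (fst p)) = cls (iter j (fst p), snd p - hit j (fst p))"
      using orb_eq[of "fst p" i "snd p"] orb_eq[of "fst p" j "snd p"] by (auto simp: E_def)
  next
    fix p assume p: "p \<in> topspace (top_of_set (l \<times> (UNIV :: real set)))"
    then have "fst p \<in> l" by (auto simp: mem_Times_iff)
    then obtain n where "hit n (fst p) \<le> snd p" "snd p < hit (n + 1) (fst p)"
        "orb (fst p) (snd p) = cls (iter n (fst p), snd p - hit n (fst p))"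
      using ex_rep by blast
    then show "\<exists>j. j \<in> UNIV \<and> p \<in> E j \<and> (case p of (x, t) \<Rightarrow> orb x t) = cls (iter j (fst p), snd p - hit j (fst p))"
      using p by (intro exI[of _ n]) (auto simp: E_def split_beta)
  qed
qed

lemma shadows_iff:
  "shadows f T \<eta> x y \<and> shadows g (T \<circ> g) \<eta> x y \<longleftrightarrow>
     (\<forall>n. dist (iter n x) (iter n y) < \<eta> \<and> \<bar>hit n x - hit n y\<bar> < \<eta>)"
proof
  assume a: "shadows f T \<eta> x y \<and> shadows g (T \<circ> g) \<eta> x y"
  show "\<forall>n. dist (iter n x) (iter n y) < \<eta> \<and> \<bar>hit n x - hit n y\<bar> < \<eta>"
  proof
    fix n :: int
    consider k where "n = int k" | k where "n = - int k" by (metis int_cases2)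
    then show "dist (iter n x) (iter n y) < \<eta> \<and> \<bar>hit n x - hit n y\<bar> < \<eta>"
    proof cases
      case 1
      then show ?thesis using a by (simp add: shadows_def iter_of_nat hit_of_nat sum_subtractf)
    next
      case 2
      then show ?thesis
        using a by (simp add: shadows_def iter_minus_of_nat hit_minus_of_nat sum_subtractf abs_minus_commute)
    qed
  qed
next
  assume a: "\<forall>n. dist (iter n x) (iter n y) < \<eta> \<and> \<bar>hit n x - hit n y\<bar> < \<eta>"
  show "shadows f T \<eta> x y \<and> shadows g (T \<circ> g) \<eta> x y"
    unfolding shadows_def sum_subtractf o_def
    using a[rule_format, of "int _"] a[rule_format, of "- int _"]
    by (simp add: iter_of_nat hit_of_nat iter_minus_of_nat hit_minus_of_nat abs_minus_commute)
qed

text \<open>The axioms prescribe the flow only while it stays in one fibre. A full fibre ends at the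
  next base point, so the flow law extends the prescription to all crossing times in both
  directions, and from there to every time.\<close>

lemma suspension_flow_orb:
  assumes "suspension_flow l f T \<phi>" and x: "x \<in> l"
  shows "\<phi> t (orb x s) = orb x (s + t)"
proof -
  have add: "\<phi> (a + b) C = \<phi> a (\<phi> b C)" and zero: "\<phi> 0 C = C" if "C \<in> topspace X" for a b C
    using assms that by (auto simp: suspension_flow_def continuous_flow_def)
  have unit: "\<phi> a (cls (y, b)) = cls (y, b + a)" if "y \<in> l" "0 \<le> b" "0 \<le> a" "b + a \<le> T y" for y a b
    using assms that by (auto simp: suspension_flow_def)
  have in_X: "cls (y, 0) \<in> topspace X" if "y \<in> l" for y
    using that T_pos[OF that] by (auto simp: topspace_X)
  have up: "\<phi> (T y) (cls (y, 0)) = cls (f y, 0)" if "y \<in> l" for y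
    using unit[of y 0 "T y"] that T_pos[OF that] cls_glue[OF that] by simp
  have down: "\<phi> (- T y) (cls (f y, 0)) = cls (y, 0)" if "y \<in> l" for y
    using add[OF in_X[OF that], of "- T y" "T y"] up[OF that] zero[OF in_X[OF that]] by simp
  have hit: "\<phi> (hit n x) (cls (x, 0)) = cls (iter n x, 0)" for n
  proof (induction n rule: int_induct[where k = 0])
    case base
    then show ?case using zero in_X[OF x] by simp
  next
    case (step1 i)
    then have "\<phi> (T (iter i x) + hit i x) (cls (x, 0)) = cls (f (iter i x), 0)"
      using add[OF in_X[OF x], of "T (iter i x)" "hit i x"] up[of "iter i x"] x by simp
    then show ?case unfolding hit_succ[OF x] iter_succ[OF x] by (simp add: add.commute)
  next
    case (step2 i)
    have "f (iter (i - 1) x) = iter i x" using x by (simp add: iter_pred)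
    then show ?case
      using step2 add[OF in_X[OF x], of "- T (iter (i - 1) x)" "hit i x"] down[of "iter (i - 1) x"] x
      by (simp add: hit_pred)
  qed
  have "\<phi> t (cls (x, 0)) = orb x t" for t
  proof -
    obtain n where n: "orb x t = cls (iter n x, t - hit n x)" "(iter n x, t - hit n x) \<in> D"
      using ex_rep[OF x] by blast
    then have "orb x t = \<phi> (t - hit n x) (cls (iter n x, 0))"
      using unit[of "iter n x" 0 "t - hit n x"] by simp
    then show ?thesis using hit[of n] add[OF in_X[OF x], of "t - hit n x" "hit n x"] by simp
  qed
  then show ?thesis using add[OF in_X[OF x], of t s] by (simp add: add.commute)
qed

lemma ex_suspension_flow: "\<exists>\<phi>. suspension_flow l f T \<phi>"
proof -
  define \<phi> where "\<phi> t C = (let p = SOME p. p \<in> D \<and> C = cls p in orb (fst p) (snd p + t))" for t C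
  have \<phi>: "\<phi> t (orb x s) = orb x (s + t)" if x: "x \<in> l" for x s t
  proof -
    define p where "p = (SOME p. p \<in> D \<and> orb x s = cls p)"
    have "\<exists>p. p \<in> D \<and> orb x s = cls p" using ex_rep[OF x] by metis
    then have p: "p \<in> D" "orb x s = cls p" using someI_ex[of "\<lambda>p. p \<in> D \<and> orb x s = cls p"] by (simp_all add: p_def)
    then have "orb x s = orb (fst p) (snd p)" "fst p \<in> l"
      by (cases p; simp add: orb_cls)+
    then have "orb (fst p) (snd p + t) = orb x (s + t)" using orb_cong_shift[of "fst p" x "snd p" s t] x by simp
    then show ?thesis by (simp add: \<phi>_def p_def Let_def)
  qed
  \<comment> \<open>The product of a quotient map with the identity of the locally compact line is
    again a quotient map, so continuity can be tested on representatives, where the flow is a time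
    shift of \<open>orb\<close>.\<close>
  have "quotient_map (prod_topology euclideanreal (top_of_set D)) (prod_topology euclideanreal X) (\<lambda>(t, p). (t, cls p))"
    by (intro quotient_map_prod_right locally_compact_space_euclidean quotient_map_suspension_class) auto
  moreover have "continuous_map (prod_topology euclideanreal (top_of_set D)) X
      ((\<lambda>(t, C). \<phi> t C) \<circ> (\<lambda>(t, p). (t, cls p)))"
  proof (rule continuous_map_eq)
    have "prod_topology euclideanreal (top_of_set D) = top_of_set (UNIV \<times> D)"
      using subtopology_Times[of euclidean euclidean "UNIV :: real set" D] by simp
    moreover have "continuous_on (UNIV \<times> D) (\<lambda>(t, p). (fst p, snd p + t))"
      by (auto simp: split_beta intro!: continuous_intros)
    moreover have "(\<lambda>(t, p). (fst p, snd p + t)) ` (UNIV \<times> D) \<subseteq> l \<times> (UNIV :: real set)"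
      by auto
    ultimately have "continuous_map (prod_topology euclideanreal (top_of_set D)) (top_of_set (l \<times> UNIV))
       (\<lambda>(t, p). (fst p, snd p + t))"
      by (simp add: image_subset_iff_funcset)
    from continuous_map_compose[OF this continuous_orb]
    show "continuous_map (prod_topology euclideanreal (top_of_set D)) X
       ((\<lambda>(x, t). orb x t) \<circ> (\<lambda>(t, p). (fst p, snd p + t)))" .
    fix q assume "q \<in> topspace (prod_topology euclideanreal (top_of_set D))"
    then obtain t x u where "q = (t, x, u)" "x \<in> l" "0 \<le> u" "u \<le> T x"
      by (cases q) (auto simp: suspension_domain_def)
    then show "((\<lambda>(x, t). orb x t) \<circ> (\<lambda>(t, p). (fst p, snd p + t))) q = ((\<lambda>(t, C). \<phi> t C) \<circ> (\<lambda>(t, p). (t, cls p))) q"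
      using \<phi>[of x t u] orb_cls[of x u] by simp
  qed
  ultimately have "continuous_map (prod_topology euclideanreal X) X (\<lambda>(t, C). \<phi> t C)"
    using continuous_compose_quotient_map by blast
  then have "continuous_flow X \<phi>"
    unfolding continuous_flow_def
  proof (intro conjI ballI allI)
    fix C s t assume "C \<in> topspace X"
    then obtain x u where "x \<in> l" "C = orb x u" using topspace_orb by metis
    then show "\<phi> 0 C = C" "\<phi> (s + t) C = \<phi> s (\<phi> t C)"
      by (simp_all add: \<phi> add.commute add.left_commute)
  qed
  moreover have "\<phi> s (cls (x, t)) = cls (x, t + s)" if "x \<in> l" "0 \<le> t" "0 \<le> s" "t + s \<le> T x" for x s t
    using \<phi>[OF that(1), of s t] orb_cls[of x t] orb_cls[of x "t + s"] that by simp
  ultimately show ?thesis unfolding suspension_flow_def by blast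
qed

section \<open>Kinematic expansivity in terms of base orbits\<close>

context
  fixes d
  assumes metric: "Metric_space (topspace X) d" and top: "Metric_space.mtopology (topspace X) d = X"
begin

lemma continuous_dist_orb:
  "continuous_on ((l \<times> UNIV) \<times> (l \<times> UNIV)) (\<lambda>(p, q). d (orb (fst p) (snd p)) (orb (fst q) (snd q)))"
proof -
  interpret Metric_space "topspace X" d by (rule metric)
  let ?m = "metric (topspace X, d)"
  let ?A = "top_of_set ((l \<times> UNIV) \<times> (l \<times> (UNIV :: real set)))"
  have m: "mtopology_of ?m = X" using top by simp
  have "continuous_map ?A (top_of_set (l \<times> UNIV)) fst" "continuous_map ?A (top_of_set (l \<times> UNIV)) snd"
    by (auto intro!: continuous_intros simp: image_subset_iff_funcset[symmetric])
  then have "continuous_map ?A X ((\<lambda>(x, t). orb x t) \<circ> fst)" "continuous_map ?A X ((\<lambda>(x, t). orb x t) \<circ> snd)"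
    using continuous_map_compose[OF _ continuous_orb] by blast+
  then have "continuous_map ?A euclidean (\<lambda>p. mdist ?m (((\<lambda>(x, t). orb x t) \<circ> fst) p) (((\<lambda>(x, t). orb x t) \<circ> snd) p))"
    using continuous_map_mdist[of ?A ?m] unfolding m by blast
  then have "continuous_on ((l \<times> UNIV) \<times> (l \<times> UNIV)) (\<lambda>p. d (((\<lambda>(x, t). orb x t) \<circ> fst) p) (((\<lambda>(x, t). orb x t) \<circ> snd) p))"
    by simp
  then show ?thesis by (simp add: split_beta o_def)
qed

lemma d_orb_self: "x \<in> l \<Longrightarrow> d (orb x t) (orb x t) = 0"
  using Metric_space.mdist_zero[OF metric orb_in] .

lemma uniform_dist_orb:
  assumes "0 < \<delta>"
  obtains \<eta> where "\<eta> > 0" "\<And>x y u v. x \<in> l \<Longrightarrow> y \<in> l \<Longrightarrow> u \<in> {a..b} \<Longrightarrow> v \<in> {a..b} \<Longrightarrow>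
     dist x y < \<eta> \<Longrightarrow> \<bar>u - v\<bar> < \<eta> \<Longrightarrow> d (orb x u) (orb y v) < \<delta>"
proof -
  let ?K = "l \<times> {a..b}"
  let ?h = "\<lambda>(p, q). d (orb (fst p) (snd p)) (orb (fst q) (snd q))"
  have "continuous_on (?K \<times> ?K) ?h"
    by (rule continuous_on_subset[OF continuous_dist_orb]) auto
  moreover have "compact (?K \<times> ?K)" by (intro compact_Times compact_l) auto
  ultimately have "uniformly_continuous_on (?K \<times> ?K) ?h" by (rule compact_uniformly_continuous)
  then obtain \<eta> where \<eta>: "\<eta> > 0" "\<And>p q. p \<in> ?K \<times> ?K \<Longrightarrow> q \<in> ?K \<times> ?K \<Longrightarrow> dist q p < \<eta> \<Longrightarrow> dist (?h q) (?h p) < \<delta>"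
    unfolding uniformly_continuous_on_def using assms by blast
  show ?thesis
  proof (rule that[of "\<eta> / 2"])
    fix x y u v assume *: "x \<in> l" "y \<in> l" "u \<in> {a..b}" "v \<in> {a..b}" "dist x y < \<eta> / 2" "\<bar>u - v\<bar> < \<eta> / 2"
    have "dist ((x, u), (y, v)) ((x, u), (x, u)) = dist (y, v) (x, u)" by (simp add: dist_Pair_Pair)
    also have "\<dots> \<le> dist y x + dist v u"
      by (simp add: dist_Pair_Pair sqrt_sum_squares_le_sum)
    also have "\<dots> < \<eta>" using * by (simp add: dist_commute dist_real_def abs_minus_commute)
    finally show "d (orb x u) (orb y v) < \<delta>"
      using \<eta>(2)[of "((x, u), (x, u))" "((x, u), (y, v))"] * by (simp add: d_orb_self)
  qed (use \<eta> in auto)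
qed

text \<open>A class near the base is either low in a fibre over a nearby point or close to the top
  of a fibre whose next base point is nearby; in the second case \<open>s\<close> is negative. The
  pairs violating both form the compact set \<open>B1 \<inter> B2\<close>, on which the distance is
  positive and so bounded below.\<close>

lemma near_base:
  assumes "0 < \<epsilon>"
  obtains \<delta> where "\<delta> > 0" "\<And>x C. x \<in> l \<Longrightarrow> C \<in> topspace X \<Longrightarrow> d (orb x 0) C < \<delta> \<Longrightarrow>
      \<exists>y s. y \<in> l \<and> \<bar>s\<bar> < \<epsilon> \<and> dist x y < \<epsilon> \<and> C = orb y s"
proof -
  define P where "P = l \<times> D"
  define B1 where "B1 = {p \<in> P. max (snd (snd p)) (dist (fst p) (fst (snd p))) \<in> {\<epsilon>..}}"
  define B2 where "B2 = {p \<in> P. max (T (fst (snd p)) - snd (snd p)) (dist (fst p) (f (fst (snd p)))) \<in> {\<epsilon>..}}"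
  define h where "h p = d (orb (fst p) 0) (orb (fst (snd p)) (snd (snd p)))" for p
  have P: "fst p \<in> l" "fst (snd p) \<in> l" "0 \<le> snd (snd p)" "snd (snd p) \<le> T (fst (snd p))" if "p \<in> P" for p
    using that by (auto simp: P_def suspension_domain_def)
  have "closedin (top_of_set P) B1"
  proof -
    have "continuous_on P (\<lambda>p. max (snd (snd p)) (dist (fst p) (fst (snd p))))"
      by (intro continuous_intros)
    from continuous_closedin_preimage[OF this closed_atLeast]
    show ?thesis unfolding B1_def by (simp add: vimage_def Int_def)
  qed
  moreover have "closedin (top_of_set P) B2"
  proof -
    have "continuous_on P (\<lambda>p. max (T (fst (snd p)) - snd (snd p)) (dist (fst p) (f (fst (snd p)))))"
      by (intro continuous_intros continuous_on_compose2[OF cont_T] continuous_on_compose2[OF cont_f]) (use P in auto)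
    from continuous_closedin_preimage[OF this closed_atLeast]
    show ?thesis unfolding B2_def by (simp add: vimage_def Int_def)
  qed
  moreover have "compact P" unfolding P_def by (intro compact_Times compact_l compact_D)
  ultimately have "compact (B1 \<inter> B2)" using closedin_compact closedin_Int by blast
  have "continuous_on (B1 \<inter> B2) h"
  proof -
    have "continuous_on (B1 \<inter> B2) (\<lambda>p. ((fst p, 0::real), snd p))" by (intro continuous_intros)
    moreover have "(\<lambda>p. ((fst p, 0::real), snd p)) ` (B1 \<inter> B2) \<subseteq> (l \<times> UNIV) \<times> (l \<times> UNIV)"
      using P by (auto simp: B1_def mem_Times_iff)
    ultimately have "continuous_on (B1 \<inter> B2) (\<lambda>p. (\<lambda>(p, q). d (orb (fst p) (snd p)) (orb (fst q) (snd q))) ((fst p, 0::real), snd p))"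
      using continuous_on_compose2[OF continuous_dist_orb] by blast
    then show ?thesis by (simp add: h_def)
  qed
  have pos: "h p > 0" if "p \<in> B1 \<inter> B2" for p
  proof -
    obtain x y v where p: "p = (x, y, v)" by (metis prod_cases3)
    have xy: "x \<in> l" "y \<in> l" "0 \<le> v" "v \<le> T y" using that P[of p] by (auto simp: B1_def p)
    have "orb x 0 \<noteq> orb y v"
    proof
      assume "orb x 0 = orb y v"
      then have "nf (x, 0) = nf (y, v)"
        using xy T_pos[of x] cls_eq_iff[of "(x, 0)" "(y, v)"] by (simp add: orb_cls)
      then show False
        using that assms T_pos[OF xy(1)] by (auto simp: nf_def p B1_def B2_def split: if_splits)
    qed
    then have "d (orb x 0) (orb y v) > 0"
      using Metric_space.mdist_pos_less[OF metric] orb_in xy by blast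
    then show ?thesis by (simp add: h_def p)
  qed
  obtain \<delta> where \<delta>: "\<delta> > 0" "\<And>p. p \<in> B1 \<inter> B2 \<Longrightarrow> \<delta> \<le> h p"
  proof (cases "B1 \<inter> B2 = {}")
    case False
    then obtain q where "q \<in> B1 \<inter> B2" "\<And>p. p \<in> B1 \<inter> B2 \<Longrightarrow> h q \<le> h p"
      using continuous_attains_inf[OF \<open>compact (B1 \<inter> B2)\<close> False \<open>continuous_on (B1 \<inter> B2) h\<close>] by blast
    then show ?thesis using that pos by blast
  qed (use that[of 1] in auto)
  show ?thesis
  proof (rule that[OF \<delta>(1)])
    fix x C assume x: "x \<in> l" and C: "C \<in> topspace X" and less: "d (orb x 0) C < \<delta>"
    obtain y v where y: "y \<in> l" "0 \<le> v" "v \<le> T y" "C = orb y v" using topspace_orb[OF C] by metis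
    have "(x, y, v) \<in> P" using x y by (simp add: P_def)
    moreover have "(x, y, v) \<notin> B1 \<inter> B2" using \<delta>(2)[of "(x, y, v)"] less y by (auto simp: h_def)
    ultimately consider "v < \<epsilon>" "dist x y < \<epsilon>" | "T y - v < \<epsilon>" "dist x (f y) < \<epsilon>"
      by (auto simp: B1_def B2_def)
    then show "\<exists>y s. y \<in> l \<and> \<bar>s\<bar> < \<epsilon> \<and> dist x y < \<epsilon> \<and> C = orb y s"
    proof cases
      case 1
      then show ?thesis using y by (intro exI[of _ y] exI[of _ v]) auto
    next
      case 2
      have "orb (f y) (v - T y) = orb y v"
        using orb_it[OF y(1), of 1 "v - T y"] iter_succ[OF y(1), of 0] hit_succ[OF y(1), of 0] by simp
      then show ?thesis using y 2 by (intro exI[of _ "f y"] exI[of _ "v - T y"]) auto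
    qed
  qed
qed

text \<open>Expansivity is used with tolerance \<open>m\<close>, the lower bound of
  \<open>T\<close>: an orbit leaving the base cannot return to it in a shorter time, so the time
  shift between two base points must be 0.\<close>

lemma kinematic_expansive_imp_separated:
  assumes flow: "suspension_flow l f T \<phi>" and ke: "kinematic_expansive_wrt (topspace X) d \<phi>"
  obtains \<eta> where "\<eta> > 0"
    "\<And>x y. x \<in> l \<Longrightarrow> y \<in> l \<Longrightarrow> shadows f T \<eta> x y \<Longrightarrow> shadows g (T \<circ> g) \<eta> x y \<Longrightarrow> x = y"
proof -
  obtain m where m: "m > 0" "\<And>x. x \<in> l \<Longrightarrow> m \<le> T x" using T_lower by blast
  obtain M where M: "\<And>x. x \<in> l \<Longrightarrow> T x \<le> M" using T_upper by blast
  obtain \<delta> where \<delta>: "\<delta> > 0" and sep: "\<And>p q. p \<in> topspace X \<Longrightarrow> q \<in> topspace X \<Longrightarrow>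
       (\<And>t. d (\<phi> t p) (\<phi> t q) < \<delta>) \<Longrightarrow> \<exists>s. \<bar>s\<bar> < m \<and> q = \<phi> s p"
  proof -
    obtain \<delta> where "\<delta> > 0" "\<forall>p\<in>topspace X. \<forall>q\<in>topspace X.
        (\<forall>t. d (\<phi> t p) (\<phi> t q) < \<delta>) \<longrightarrow> (\<exists>s. \<bar>s\<bar> < m \<and> q = \<phi> s p)"
      using ke m(1) unfolding kinematic_expansive_wrt_def by blast
    then show thesis using that[of \<delta>] by simp
  qed
  \<comment> \<open>Heights along \<open>x\<close> lie between 0 and \<open>M\<close>. Those along
    \<open>y\<close> at the same time differ by less than 1, since crossing times do; hence the
    margin of the interval.\<close>
  obtain \<eta> where \<eta>: "\<eta> > 0" "\<And>x y u v. x \<in> l \<Longrightarrow> y \<in> l \<Longrightarrow> u \<in> {- 1..M + 1} \<Longrightarrow> v \<in> {- 1..M + 1} \<Longrightarrow>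
     dist x y < \<eta> \<Longrightarrow> \<bar>u - v\<bar> < \<eta> \<Longrightarrow> d (orb x u) (orb y v) < \<delta>"
    using uniform_dist_orb[OF \<delta>, where a = "- 1" and b = "M + 1"] by blast
  show ?thesis
  proof (rule that[of "min \<eta> 1"])
    fix x y assume x: "x \<in> l" and y: "y \<in> l"
      and sh: "shadows f T (min \<eta> 1) x y" "shadows g (T \<circ> g) (min \<eta> 1) x y"
    have near: "dist (iter n x) (iter n y) < min \<eta> 1 \<and> \<bar>hit n x - hit n y\<bar> < min \<eta> 1" for n
      using sh shadows_iff by blast
    have "d (\<phi> t (orb x 0)) (\<phi> t (orb y 0)) < \<delta>" for t
    proof -
      obtain n where n: "hit n x \<le> t" "t < hit (n + 1) x" using ex_index[OF x] by blast
      then have u: "0 \<le> t - hit n x" "t - hit n x \<le> M" using hit_succ[OF x, of n] M[of "iter n x"] x by auto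
      have "d (orb (iter n x) (t - hit n x)) (orb (iter n y) (t - hit n y)) < \<delta>"
        using near[of n] u x y by (intro \<eta>(2)) auto
      then show ?thesis using orb_it x y by (simp add: suspension_flow_orb[OF flow])
    qed
    then have "\<exists>s. \<bar>s\<bar> < m \<and> orb y 0 = \<phi> s (orb x 0)"
      by (rule sep[OF orb_in[OF x] orb_in[OF y]])
    then obtain s where "\<bar>s\<bar> < m" "orb y 0 = orb x s"
      using suspension_flow_orb[OF flow x, of _ 0] by auto
    then show "x = y" using orb_eq_imp[OF y x m(2), of 0 s] by simp
  qed (use \<eta> in auto)
qed

text \<open>Closeness of classes determines the drift \<open>\<sigma> n\<close> between crossing
  times only up to returns to the base. Induction on \<open>n\<close> rules these out: one step
  changes the drift by less than \<open>m / 4\<close>, so it stays below \<open>m / 2\<close>, and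
  there \<open>orb_eq_imp\<close> forces it back below \<open>e\<close>.\<close>

lemma separated_imp_kinematic_expansive:
  assumes flow: "suspension_flow l f T \<phi>" and "\<eta> > 0"
    and sep: "\<And>x y. x \<in> l \<Longrightarrow> y \<in> l \<Longrightarrow> shadows f T \<eta> x y \<Longrightarrow> shadows g (T \<circ> g) \<eta> x y \<Longrightarrow> x = y"
  shows "kinematic_expansive_wrt (topspace X) d \<phi>"
  unfolding kinematic_expansive_wrt_def
proof (intro allI impI)
  fix \<epsilon> :: real assume "0 < \<epsilon>"
  obtain m where m: "m > 0" "\<And>x. x \<in> l \<Longrightarrow> m \<le> T x" using T_lower by blast
  have "uniformly_continuous_on l T" using compact_uniformly_continuous[OF cont_T compact_l] .
  then obtain a where a: "a > 0" "\<And>x y. x \<in> l \<Longrightarrow> y \<in> l \<Longrightarrow> dist x y < a \<Longrightarrow> \<bar>T x - T y\<bar> < m / 4"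
  proof -
    have "m / 4 > 0" using m by simp
    with \<open>uniformly_continuous_on l T\<close> obtain a where "a > 0"
        "\<forall>x\<in>l. \<forall>y\<in>l. dist y x < a \<longrightarrow> dist (T y) (T x) < m / 4"
      unfolding uniformly_continuous_on_def by blast
    then show thesis using that[of a] by (simp add: dist_real_def)
  qed
  have "uniformly_continuous_on l g" using compact_uniformly_continuous[OF cont_g compact_l] .
  then obtain b where b: "b > 0" "\<And>x y. x \<in> l \<Longrightarrow> y \<in> l \<Longrightarrow> dist x y < b \<Longrightarrow> dist (g x) (g y) < a"
    unfolding uniformly_continuous_on_def using a(1) by blast
  \<comment> \<open>\<open>a\<close> controls \<open>T\<close> one step ahead and \<open>b\<close>
    one step back, \<open>m / 4\<close> leaves room for one step of drift, and
    \<open>\<eta> / 2\<close> is needed because a difference of crossing times is a difference of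
    two drifts.\<close>
  define e where "e = Min {\<epsilon>, m / 4, a, b, \<eta> / 2}"
  have e: "e > 0" "e \<le> \<epsilon>" "e \<le> m / 4" "e \<le> a" "e \<le> b" "e \<le> \<eta> / 2"
    using \<open>0 < \<epsilon>\<close> m a b \<open>\<eta> > 0\<close> by (auto simp: e_def)
  obtain \<delta> where \<delta>: "\<delta> > 0" "\<And>x C. x \<in> l \<Longrightarrow> C \<in> topspace X \<Longrightarrow> d (orb x 0) C < \<delta> \<Longrightarrow>
      \<exists>y s. y \<in> l \<and> \<bar>s\<bar> < e \<and> dist x y < e \<and> C = orb y s"
    using near_base[OF e(1)] by blast
  show "\<exists>\<delta>>0. \<forall>p\<in>topspace X. \<forall>q\<in>topspace X.
        (\<forall>t. d (\<phi> t p) (\<phi> t q) < \<delta>) \<longrightarrow> (\<exists>s. \<bar>s\<bar> < \<epsilon> \<and> q = \<phi> s p)"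
  proof (rule exI[of _ \<delta>], intro conjI ballI impI)
    fix p q assume p: "p \<in> topspace X" and q: "q \<in> topspace X" and close: "\<forall>t. d (\<phi> t p) (\<phi> t q) < \<delta>"
    obtain x c where x: "x \<in> l" "p = orb x c" using topspace_orb[OF p] by metis
    obtain y' c' where y': "y' \<in> l" "q = orb y' c'" using topspace_orb[OF q] by metis
    have cl: "d (orb x t) (orb y' (c' - c + t)) < \<delta>" for t
      using close[rule_format, of "t - c"] x y'
      by (simp add: suspension_flow_orb[OF flow] algebra_simps)
    obtain y s where y: "y \<in> l" "\<bar>s\<bar> < e" "dist x y < e" "orb y' (c' - c) = orb y s"
      using \<delta>(2)[OF x(1) orb_in[OF y'(1)], of "c' - c"] cl[of 0] by auto
    have close2: "d (orb x t) (orb y (s + t)) < \<delta>" for t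
      using cl[of t] orb_cong_shift[OF y'(1) y(1,4), of t] by simp
    define \<sigma> where "\<sigma> n = s + hit n x - hit n y" for n
    have at: "\<exists>z u. z \<in> l \<and> \<bar>u\<bar> < e \<and> dist (iter n x) z < e \<and> orb (iter n y) (\<sigma> n) = orb z u" for n
    proof -
      have "d (orb (iter n x) 0) (orb (iter n y) (\<sigma> n)) < \<delta>"
        using close2[of "hit n x"] orb_it[OF x(1), of n 0] orb_it[OF y(1), of n "\<sigma> n"] by (simp add: \<sigma>_def)
      then show ?thesis using \<delta>(2)[of "iter n x" "orb (iter n y) (\<sigma> n)"] x y orb_in by auto
    qed
    have upd: "\<bar>\<sigma> k\<bar> < e \<and> dist (iter k x) (iter k y) < e" if "\<bar>\<sigma> k\<bar> < m / 2" for k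
    proof -
      obtain z u where z: "z \<in> l" "\<bar>u\<bar> < e" "dist (iter k x) z < e" "orb (iter k y) (\<sigma> k) = orb z u"
        using at by blast
      have "iter k y = z \<and> \<sigma> k = u"
        using z y e that by (intro orb_eq_imp[where m = m] m) auto
      then show ?thesis using z by simp
    qed
    have near: "\<bar>\<sigma> n\<bar> < e \<and> dist (iter n x) (iter n y) < e" for n
    proof (induction n rule: int_induct[where k = 0])
      case base
      then show ?case using y by (simp add: \<sigma>_def)
    next
      case (step1 i)
      then have "\<bar>T (iter i x) - T (iter i y)\<bar> < m / 4" using a(2)[of "iter i x" "iter i y"] x y e by simp
      moreover have "\<sigma> (i + 1) = \<sigma> i + (T (iter i x) - T (iter i y))" using x y by (simp add: \<sigma>_def hit_succ)
      ultimately have "\<bar>\<sigma> (i + 1)\<bar> < m / 2" using step1 e by linarith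
      then show ?case by (rule upd)
    next
      case (step2 i)
      then have "dist (iter (i - 1) x) (iter (i - 1) y) < a"
        using b(2)[of "iter i x" "iter i y"] x y e by (simp add: iter_pred)
      then have "\<bar>T (iter (i - 1) x) - T (iter (i - 1) y)\<bar> < m / 4" using a(2) x y by simp
      moreover have "\<sigma> (i - 1) = \<sigma> i - (T (iter (i - 1) x) - T (iter (i - 1) y))"
        using x y by (simp add: \<sigma>_def hit_pred)
      ultimately have "\<bar>\<sigma> (i - 1)\<bar> < m / 2" using step2 e by linarith
      then show ?case by (rule upd)
    qed
    have "dist (iter n x) (iter n y) < \<eta> \<and> \<bar>hit n x - hit n y\<bar> < \<eta>" for n
      using near[of n] near[of 0] e by (auto simp: \<sigma>_def)
    then have "x = y" using sep[OF x(1) y(1)] shadows_iff by blast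
    have "q = orb y' (c' - c + c)" using y' by simp
    also have "\<dots> = orb y (s + c)" by (rule orb_cong_shift) (use y y' in auto)
    also have "\<dots> = \<phi> s p" using \<open>x = y\<close> x by (simp add: suspension_flow_orb[OF flow] add.commute)
    finally show "\<exists>s. \<bar>s\<bar> < \<epsilon> \<and> q = \<phi> s p" using y(2) e(2) by (intro exI[of _ s]) auto
  qed (rule \<delta>(1))
qed

end

lemma kinematic_expansive_suspension_iff:
  "(\<exists>\<phi>. suspension_flow l f T \<phi> \<and> kinematic_expansive X \<phi>) \<longleftrightarrow>
     (\<exists>\<eta>>0. \<forall>x\<in>l. \<forall>y\<in>l. shadows f T \<eta> x y \<and> shadows g (T \<circ> g) \<eta> x y \<longrightarrow> x = y)"
proof
  assume "\<exists>\<phi>. suspension_flow l f T \<phi> \<and> kinematic_expansive X \<phi>"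
  then obtain \<phi> d where "suspension_flow l f T \<phi>" "Metric_space (topspace X) d"
      "Metric_space.mtopology (topspace X) d = X" "kinematic_expansive_wrt (topspace X) d \<phi>"
    unfolding kinematic_expansive_def by blast
  then obtain \<eta> where "\<eta> > 0"
    "\<And>x y. x \<in> l \<Longrightarrow> y \<in> l \<Longrightarrow> shadows f T \<eta> x y \<Longrightarrow> shadows g (T \<circ> g) \<eta> x y \<Longrightarrow> x = y"
    using kinematic_expansive_imp_separated[of d \<phi> thesis] by blast
  then show "\<exists>\<eta>>0. \<forall>x\<in>l. \<forall>y\<in>l. shadows f T \<eta> x y \<and> shadows g (T \<circ> g) \<eta> x y \<longrightarrow> x = y"
    by blast
next
  assume "\<exists>\<eta>>0. \<forall>x\<in>l. \<forall>y\<in>l. shadows f T \<eta> x y \<and> shadows g (T \<circ> g) \<eta> x y \<longrightarrow> x = y"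
  then obtain \<eta> where \<eta>: "\<eta> > 0"
    "\<And>x y. x \<in> l \<Longrightarrow> y \<in> l \<Longrightarrow> shadows f T \<eta> x y \<Longrightarrow> shadows g (T \<circ> g) \<eta> x y \<Longrightarrow> x = y"
    by blast
  obtain \<phi> where \<phi>: "suspension_flow l f T \<phi>" using ex_suspension_flow by blast
  obtain M d where d: "Metric_space M d" "X = Metric_space.mtopology M d"
    using metrizable_X unfolding metrizable_space_def by blast
  then have "topspace X = M" using Metric_space.topspace_mtopology by metis
  then have "Metric_space (topspace X) d" "Metric_space.mtopology (topspace X) d = X"
    using d by simp_all
  moreover from this have "kinematic_expansive_wrt (topspace X) d \<phi>"
    by (rule separated_imp_kinematic_expansive[OF _ _ \<phi> \<eta>])
  ultimately have "kinematic_expansive X \<phi>"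
    using compact_X \<phi> unfolding kinematic_expansive_def suspension_flow_def by blast
  then show "\<exists>\<phi>. suspension_flow l f T \<phi> \<and> kinematic_expansive X \<phi>" using \<phi> by blast
qed

end

section \<open>Increasing homeomorphisms of an interval\<close>

lemma bounded_sums_limit_0:
  fixes e :: "nat \<Rightarrow> real"
  assumes "e \<longlonglongrightarrow> L" and B: "\<And>n. \<bar>\<Sum>i<n. e i\<bar> \<le> B"
  shows "L = 0"
proof -
  have "\<not> 0 < L" if lim: "e \<longlonglongrightarrow> L" and B: "\<And>n. \<bar>\<Sum>i<n. e i\<bar> \<le> B" for e L
  proof
    assume L: "0 < L"
    then have "\<forall>\<^sub>F n in sequentially. L / 2 < e n" using order_tendstoD(1)[OF lim, of "L / 2"] by simp
    then obtain N where N: "\<And>n. n \<ge> N \<Longrightarrow> L / 2 < e n" unfolding eventually_sequentially by blast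
    have "(\<Sum>i<N + n. e i) \<ge> (\<Sum>i<N. e i) + real n * (L / 2)" for n
    proof (induction n)
      case (Suc n)
      moreover have "real (Suc n) * (L / 2) = real n * (L / 2) + L / 2" by (simp add: algebra_simps)
      moreover have "(\<Sum>i<N + Suc n. e i) = (\<Sum>i<N + n. e i) + e (N + n)" by simp
      ultimately show ?case using N[of "N + n"] by linarith
    qed simp
    then have "real n * (L / 2) \<le> 2 * B" for n
      using B[of "N + n"] B[of N] by (smt (verit))
    moreover obtain n where "2 * B < real n * (L / 2)"
      using reals_Archimedean3[of "L / 2"] L by (meson half_gt_zero)
    ultimately show False by (simp add: not_le[symmetric])
  qed
  from this[OF assms] this[of "\<lambda>i. - e i" "- L"] show ?thesis
    using tendsto_minus[OF assms(1)] B by (simp add: sum_negf)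
qed

lemma continuous_Icc_bounded:
  fixes h :: "real \<Rightarrow> real"
  assumes "continuous_on {a..b} h"
  obtains B where "\<And>x. x \<in> {a..b} \<Longrightarrow> \<bar>h x\<bar> \<le> B"
proof -
  have "bounded (h ` {a..b})"
    using assms by (intro compact_imp_bounded compact_continuous_image) auto
  then obtain B where "\<forall>y\<in>h ` {a..b}. norm y \<le> B" unfolding bounded_iff by blast
  then show ?thesis by (intro that[of B]) simp
qed

text \<open>Harmonic sums grow at least like a logarithm, which a remainder with bounded partial
  sums cannot compensate. This is how a difference of profile values is detected.\<close>

lemma bounded_harmonic_sums_0:
  fixes k :: real
  assumes B: "\<And>n. \<bar>\<Sum>i<n. k / real (Suc i) + r i\<bar> \<le> B" and R: "\<And>n. \<bar>\<Sum>i<n. r i\<bar> \<le> R"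
  shows "k = 0"
proof (rule ccontr)
  assume "k \<noteq> 0"
  have "\<bar>k\<bar> * ln (real n + 1) \<le> B + R" for n
  proof -
    have "(\<Sum>i<n. k / real (Suc i) + r i) = k * harm n + (\<Sum>i<n. r i)"
      by (simp add: sum.distrib harm_altdef sum_distrib_left divide_inverse)
    then have "\<bar>k * harm n\<bar> \<le> B + R" using B[of n] R[of n] by (smt (verit))
    moreover have "\<bar>k\<bar> * ln (real n + 1) \<le> \<bar>k\<bar> * harm n"
      using ln_le_harm[of n] by (intro mult_left_mono) (auto simp: add.commute)
    moreover have "\<bar>k * harm n\<bar> = \<bar>k\<bar> * harm n" by (simp add: abs_mult harm_nonneg)
    ultimately show ?thesis by linarith
  qed
  then have *: "ln (real n + 1) \<le> (B + R) / \<bar>k\<bar>" for n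
    using \<open>k \<noteq> 0\<close> by (simp add: pos_le_divide_eq mult.commute)
  obtain n :: nat where "exp ((B + R) / \<bar>k\<bar>) < real n" using reals_Archimedean2 by blast
  then have "exp ((B + R) / \<bar>k\<bar>) < real n + 1" by simp
  then have "ln (exp ((B + R) / \<bar>k\<bar>)) < ln (real n + 1)"
    by (subst ln_less_cancel_iff) auto
  then show False using *[of n] by simp
qed

text \<open>At every point at most one term is nonzero, so the error of a partial sum is a single
  term. Uniform convergence then needs only \<open>b \<longlonglongrightarrow> 0\<close> and no
  summability, which admits the amplitudes \<open>1 / n\<close>.\<close>

lemma disjoint_series:
  fixes h :: "nat \<Rightarrow> 'a::topological_space \<Rightarrow> real"
  assumes uniq: "\<And>x n m. x \<in> A \<Longrightarrow> h n x \<noteq> 0 \<Longrightarrow> h m x \<noteq> 0 \<Longrightarrow> n = m"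
  shows disjoint_series_eq: "x \<in> A \<Longrightarrow> (\<And>n. n \<noteq> k \<Longrightarrow> h n x = 0) \<Longrightarrow> (\<Sum>n. h n x) = h k x"
    and continuous_on_disjoint_series:
      "(\<And>n. continuous_on A (h n)) \<Longrightarrow> (\<And>n x. x \<in> A \<Longrightarrow> \<bar>h n x\<bar> \<le> b n) \<Longrightarrow> b \<longlonglongrightarrow> 0 \<Longrightarrow>
         continuous_on A (\<lambda>x. \<Sum>n. h n x)"
proof -
  have eq: "(\<Sum>n. h n x) = h k x" if "\<And>n. n \<noteq> k \<Longrightarrow> h n x = 0" for x k
    using suminf_finite[of "{k}" "\<lambda>n. h n x"] that by auto
  then show "x \<in> A \<Longrightarrow> (\<And>n. n \<noteq> k \<Longrightarrow> h n x = 0) \<Longrightarrow> (\<Sum>n. h n x) = h k x" .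
  assume cont: "\<And>n. continuous_on A (h n)" and b: "\<And>n x. x \<in> A \<Longrightarrow> \<bar>h n x\<bar> \<le> b n" "b \<longlonglongrightarrow> 0"
  have "uniform_limit A (\<lambda>n x. \<Sum>i<n. h i x) (\<lambda>x. \<Sum>n. h n x) sequentially"
  proof (rule uniform_limitI)
    fix \<epsilon> :: real assume "\<epsilon> > 0"
    with b(2) have "\<forall>\<^sub>F n in sequentially. b n < \<epsilon>" by (rule order_tendstoD)
    then obtain N where N: "\<And>n. n \<ge> N \<Longrightarrow> b n < \<epsilon>" unfolding eventually_sequentially by blast
    have "dist (\<Sum>i<n. h i x) (\<Sum>n. h n x) < \<epsilon>" if "n \<ge> N" "x \<in> A" for n x
    proof (cases "\<exists>k. h k x \<noteq> 0")
      case True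
      then obtain k where k: "h k x \<noteq> 0" by blast
      have z: "h m x = 0" if "m \<noteq> k" for m using uniq[OF \<open>x \<in> A\<close> k, of m] that by blast
      have s: "(\<Sum>n. h n x) = h k x" by (rule eq) (rule z)
      show ?thesis
      proof (cases "k < n")
        case True
        have "(\<Sum>i<n. h i x) = (\<Sum>i\<in>{k}. h i x)"
          by (rule sum.mono_neutral_right) (use True z in auto)
        then show ?thesis using s \<open>\<epsilon> > 0\<close> by simp
      next
        case False
        then have "(\<Sum>i<n. h i x) = 0" by (intro sum.neutral) (use z in auto)
        moreover have "\<bar>h k x\<bar> < \<epsilon>" using b(1)[OF \<open>x \<in> A\<close>, of k] N[of k] False \<open>n \<ge> N\<close> by linarith
        ultimately show ?thesis using s by (simp add: dist_real_def)
      qed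
    next
      case False
      then show ?thesis using \<open>\<epsilon> > 0\<close> by simp
    qed
    then show "\<forall>\<^sub>F n in sequentially. \<forall>x\<in>A. dist (\<Sum>i<n. h i x) (\<Sum>n. h n x) < \<epsilon>"
      unfolding eventually_sequentially by blast
  qed
  then show "continuous_on A (\<lambda>x. \<Sum>n. h n x)"
    by (rule uniform_limit_theorem[rotated]) (auto intro!: always_eventually continuous_intros cont)
qed

lemma funpow_funpow: "(f ^^ m) ((f ^^ n) x) = (f ^^ (m + n)) x"
  by (simp add: funpow_add)

lemma funpow_diff_apply: "n \<le> m \<Longrightarrow> (f ^^ (m - n)) ((f ^^ n) x) = (f ^^ m) x"
  using funpow_funpow[of "m - n" f n x] by simp

text \<open>Much weaker than shadowing, but an equivalence relation and, for bounded
  \<open>\<Theta>\<close>, invariant under moving either point along its orbit. Points may therefore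
  be brought into a common fundamental domain before they are compared.\<close>

definition bdd_diff :: "('a \<Rightarrow> 'a) \<Rightarrow> ('a \<Rightarrow> real) \<Rightarrow> 'a \<Rightarrow> 'a \<Rightarrow> bool" where
  "bdd_diff H \<Theta> x y \<longleftrightarrow> (\<exists>B. \<forall>n. \<bar>\<Sum>i<n. \<Theta> ((H ^^ i) x) - \<Theta> ((H ^^ i) y)\<bar> \<le> B)"

lemma bdd_diff_sym: "bdd_diff H \<Theta> x y \<Longrightarrow> bdd_diff H \<Theta> y x"
proof -
  assume "bdd_diff H \<Theta> x y"
  moreover have "(\<Sum>i<n. \<Theta> ((H ^^ i) y) - \<Theta> ((H ^^ i) x)) = - (\<Sum>i<n. \<Theta> ((H ^^ i) x) - \<Theta> ((H ^^ i) y))" for n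
    by (simp add: sum_subtractf)
  ultimately show ?thesis by (simp add: bdd_diff_def)
qed

lemma bdd_diff_trans:
  assumes "bdd_diff H \<Theta> x y" "bdd_diff H \<Theta> y z" shows "bdd_diff H \<Theta> x z"
proof -
  obtain B B' where B: "\<And>n. \<bar>\<Sum>i<n. \<Theta> ((H ^^ i) x) - \<Theta> ((H ^^ i) y)\<bar> \<le> B"
      "\<And>n. \<bar>\<Sum>i<n. \<Theta> ((H ^^ i) y) - \<Theta> ((H ^^ i) z)\<bar> \<le> B'"
    using assms unfolding bdd_diff_def by blast
  have "\<bar>\<Sum>i<n. \<Theta> ((H ^^ i) x) - \<Theta> ((H ^^ i) z)\<bar> \<le> B + B'" for n
    using B(1)[of n] B(2)[of n] by (simp add: sum_subtractf)
  then show ?thesis unfolding bdd_diff_def by blast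
qed

lemma bdd_diff_step:
  assumes "\<And>n. \<bar>\<Theta> ((H ^^ n) x)\<bar> \<le> B"
  shows "bdd_diff H \<Theta> x (H x)"
proof -
  have "(\<Sum>i<n. \<Theta> ((H ^^ i) x) - \<Theta> ((H ^^ i) (H x))) = \<Theta> x - \<Theta> ((H ^^ n) x)" for n
    by (induction n) (simp_all add: funpow_swap1)
  then have "\<bar>\<Sum>i<n. \<Theta> ((H ^^ i) x) - \<Theta> ((H ^^ i) (H x))\<bar> \<le> 2 * B" for n
    using assms[of 0] assms[of n] by (smt (verit) funpow_0)
  then show ?thesis unfolding bdd_diff_def by blast
qed

section \<open>Orbits and fundamental domains\<close>

locale interval_homeo =
  fixes G Gi :: "real \<Rightarrow> real" and p q :: real
  assumes strict_mono_G: "strict_mono G" and cont_G: "continuous_on UNIV G" and cont_Gi: "continuous_on UNIV Gi"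
    and GGi [simp]: "\<And>x. G (Gi x) = x" and GiG [simp]: "\<And>x. Gi (G x) = x"
    and Gp [simp]: "G p = p" and Gq [simp]: "G q = q"
begin

lemma G_less [simp]: "G x < G y \<longleftrightarrow> x < y" and G_le [simp]: "G x \<le> G y \<longleftrightarrow> x \<le> y"
  using strict_mono_G by (auto simp: strict_mono_less strict_mono_less_eq)

lemma Gi_less [simp]: "Gi x < Gi y \<longleftrightarrow> x < y"
  by (metis GGi G_less)

lemma inverse_interval_homeo: "interval_homeo Gi G p q"
proof
  show "Gi p = p" "Gi q = q" using GiG[of p] GiG[of q] by simp_all
qed (auto simp: strict_mono_def cont_G cont_Gi)

lemma Gi_fixed_iff: "Gi x = x \<longleftrightarrow> G x = x"
  by (metis GGi GiG)

lemma Gpow_less [simp]: "(G ^^ n) x < (G ^^ n) y \<longleftrightarrow> x < y"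
  by (induction n) auto

lemma Gpow_le [simp]: "(G ^^ n) x \<le> (G ^^ n) y \<longleftrightarrow> x \<le> y"
  by (induction n) auto

lemma Gpow_eq [simp]: "(G ^^ n) x = (G ^^ n) y \<longleftrightarrow> x = y"
  by (metis Gpow_le order_antisym order_refl)

lemma Gpow_fixed: "G e = e \<Longrightarrow> (G ^^ n) e = e"
  by (induction n) auto

lemma Gpow_fixed_less: "G e = e \<Longrightarrow> (G ^^ n) x < e \<longleftrightarrow> x < e" "G e = e \<Longrightarrow> e < (G ^^ n) x \<longleftrightarrow> e < x"
  "G e = e \<Longrightarrow> (G ^^ n) x \<le> e \<longleftrightarrow> x \<le> e" "G e = e \<Longrightarrow> e \<le> (G ^^ n) x \<longleftrightarrow> e \<le> x"
  by (metis Gpow_fixed Gpow_less, metis Gpow_fixed Gpow_less, metis Gpow_fixed Gpow_le, metis Gpow_fixed Gpow_le)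

lemma Gpow_in: "x \<in> {p..q} \<Longrightarrow> (G ^^ n) x \<in> {p..q}"
  by (simp add: Gpow_fixed_less)

lemma Gpow_Gipow [simp]: "(G ^^ n) ((Gi ^^ n) x) = x" and Gipow_Gpow [simp]: "(Gi ^^ n) ((G ^^ n) x) = x"
proof -
  show "(G ^^ n) ((Gi ^^ n) x) = x" for x by (induction n arbitrary: x) (simp_all add: funpow_swap1)
  show "(Gi ^^ n) ((G ^^ n) x) = x" for x by (induction n arbitrary: x) (simp_all add: funpow_swap1)
qed

lemma Gpow_incseq: "x \<le> G x \<Longrightarrow> incseq (\<lambda>n. (G ^^ n) x)"
  by (rule incseq_SucI) (metis Gpow_le funpow_Suc_right o_apply)

lemma Gpow_decseq: "G x \<le> x \<Longrightarrow> decseq (\<lambda>n. (G ^^ n) x)"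
  by (rule decseq_SucI) (metis Gpow_le funpow_Suc_right o_apply)

lemma orbit_limit:
  assumes x: "x \<in> {p..q}"
  obtains b where "b \<in> {p..q}" "G b = b" "(\<lambda>n. (G ^^ n) x) \<longlonglongrightarrow> b" "x \<le> G x \<Longrightarrow> x \<le> b" "G x \<le> x \<Longrightarrow> b \<le> x"
proof -
  have "monoseq (\<lambda>n. (G ^^ n) x)"
    using Gpow_incseq[of x] Gpow_decseq[of x] monoseq_iff linear[of x "G x"] by blast
  moreover have "Bseq (\<lambda>n. (G ^^ n) x)"
  proof (rule BseqI')
    show "norm ((G ^^ n) x) \<le> \<bar>p\<bar> + \<bar>q\<bar>" for n using Gpow_in[OF x, of n] by auto
  qed
  ultimately obtain b where b: "(\<lambda>n. (G ^^ n) x) \<longlonglongrightarrow> b"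
    using Bseq_monoseq_convergent convergent_def by blast
  have "isCont G b" using cont_G by (simp add: continuous_on_eq_continuous_at)
  then have "(\<lambda>n. G ((G ^^ n) x)) \<longlonglongrightarrow> G b" using b by (rule isCont_tendsto_compose)
  moreover have "(\<lambda>n. G ((G ^^ n) x)) \<longlonglongrightarrow> b" using LIMSEQ_Suc[OF b] by simp
  ultimately have "G b = b" by (rule LIMSEQ_unique)
  moreover have "b \<in> {p..q}"
    using Gpow_in[OF x] LIMSEQ_le_const[OF b, of p] LIMSEQ_le_const2[OF b, of q] by auto
  moreover have "x \<le> b" if "x \<le> G x"
    using incseq_le[OF Gpow_incseq[OF that] b, of 0] by simp
  moreover have "b \<le> x" if "G x \<le> x"
    using decseq_ge[OF Gpow_decseq[OF that] b, of 0] by simp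
  ultimately show ?thesis using that b by blast
qed

lemma same_sign:
  assumes "c < G c" "\<And>e. e \<in> closed_segment c x \<Longrightarrow> G e \<noteq> e"
  shows "x < G x"
proof (rule ccontr)
  assume "\<not> x < G x"
  have cont: "continuous_on A (\<lambda>x. G x - x)" for A
    by (intro continuous_intros continuous_on_subset[OF cont_G]) auto
  have "\<exists>e. e \<in> closed_segment c x \<and> G e - e = 0"
  proof (cases "c \<le> x")
    case True
    then show ?thesis using IVT2'[of "\<lambda>x. G x - x" x 0 c] assms \<open>\<not> x < G x\<close> cont
      by (auto simp: closed_segment_eq_real_ivl)
  next
    case False
    then show ?thesis using IVT'[of "\<lambda>x. G x - x" x 0 c] assms \<open>\<not> x < G x\<close> cont
      by (auto simp: closed_segment_eq_real_ivl)
  qed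
  then show False using assms by auto
qed

text \<open>Iterates moving from \<open>x\<close> towards \<open>c\<close> are monotone with a fixed
  limit. If they never passed the target, that limit would lie between \<open>c\<close> and
  \<open>x\<close>. The first iterate to pass lands in the domain, because its predecessor had not
  passed.\<close>

lemma ex_fundamental_up:
  assumes x: "x \<in> {p..q}" and c: "c < G c" and nofix: "\<And>e. e \<in> closed_segment c x \<Longrightarrow> G e \<noteq> e"
  shows "\<exists>n. (c \<le> (G ^^ n) x \<and> (G ^^ n) x < G c) \<or> (c \<le> (Gi ^^ n) x \<and> (Gi ^^ n) x < G c)"
proof (cases "c \<le> x")
  case True
  interpret inv: interval_homeo Gi G p q by (rule inverse_interval_homeo)
  have "Gi x < x" using same_sign[OF c nofix] by (metis GiG Gi_less)
  have "\<exists>n. (Gi ^^ n) x < G c"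
  proof (rule ccontr)
    assume "\<not> ?thesis"
    then have *: "c \<le> (Gi ^^ n) x" for n using c by (meson le_less_trans less_imp_le not_less)
    obtain b where b: "Gi b = b" "(\<lambda>n. (Gi ^^ n) x) \<longlonglongrightarrow> b" "b \<le> x"
      using inv.orbit_limit[OF x] \<open>Gi x < x\<close> by (metis less_imp_le)
    have "c \<le> b" using LIMSEQ_le_const[OF b(2), of c] * by blast
    then show False using nofix[of b] b True by (auto simp: closed_segment_eq_real_ivl Gi_fixed_iff)
  qed
  define n where "n = (LEAST n. (Gi ^^ n) x < G c)"
  have n: "(Gi ^^ n) x < G c" unfolding n_def using \<open>\<exists>n. _\<close> by (rule LeastI_ex)
  have "c \<le> (Gi ^^ n) x"
  proof (cases n)
    case (Suc k)
    then have "\<not> (Gi ^^ k) x < G c" using not_less_Least[of k "\<lambda>n. (Gi ^^ n) x < G c"] by (simp add: n_def)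
    then have "\<not> Gi ((Gi ^^ k) x) < Gi (G c)" unfolding Gi_less .
    then show ?thesis using Suc by simp
  qed (use True in simp)
  then show ?thesis using n by blast
next
  case False
  have "x < G x" using same_sign[OF c nofix] .
  have "\<exists>n. c \<le> (G ^^ n) x"
  proof (rule ccontr)
    assume "\<not> ?thesis"
    then have *: "(G ^^ n) x \<le> c" for n by (meson linear)
    obtain b where b: "G b = b" "(\<lambda>n. (G ^^ n) x) \<longlonglongrightarrow> b" "x \<le> b"
      using orbit_limit[OF x] \<open>x < G x\<close> by (metis less_imp_le)
    have "b \<le> c" using LIMSEQ_le_const2[OF b(2), of c] * by blast
    then show False using nofix[of b] b False by (auto simp: closed_segment_eq_real_ivl)
  qed
  define n where "n = (LEAST n. c \<le> (G ^^ n) x)"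
  have n: "c \<le> (G ^^ n) x" unfolding n_def using \<open>\<exists>n. _\<close> by (rule LeastI_ex)
  then obtain k where Suc: "n = Suc k" using False by (cases n) auto
  then have "\<not> c \<le> (G ^^ k) x" using not_less_Least[of k "\<lambda>n. c \<le> (G ^^ n) x"] by (simp add: n_def)
  then have "(G ^^ n) x < G c" using Suc by simp
  then show ?thesis using n by blast
qed

text \<open>The upper end of the fundamental domain starting at \<open>c\<close>, whichever way
  \<open>G\<close> moves \<open>c\<close>. Taking the maximum gives \<open>G\<close> and
  \<open>Gi\<close> the same domain, so statements about one apply to the other.\<close>

definition nxt :: "real \<Rightarrow> real" where "nxt c = max (G c) (Gi c)"

lemma nxt_inverse: "interval_homeo.nxt Gi G c = nxt c"
  using interval_homeo.nxt_def[OF inverse_interval_homeo] by (simp add: nxt_def max.commute)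

lemma nxt_cases:
  assumes "G c \<noteq> c"
  obtains "c < G c" "nxt c = G c" | "G c < c" "nxt c = Gi c" "c < Gi c"
proof (cases "c < G c")
  case True
  then have "Gi c < c" by (metis GiG Gi_less)
  then show ?thesis using that(1) True by (simp add: nxt_def)
next
  case False
  then have "G c < c" using assms by simp
  then have "c < Gi c" by (metis GiG Gi_less)
  then show ?thesis using that(2) \<open>G c < c\<close> by (simp add: nxt_def)
qed

lemma less_nxt: "G c \<noteq> c \<Longrightarrow> c < nxt c"
  by (cases rule: nxt_cases) auto

lemma ex_fundamental:
  assumes x: "x \<in> {p..q}" and c: "G c \<noteq> c" and nofix: "\<And>e. e \<in> closed_segment c x \<Longrightarrow> G e \<noteq> e"
  shows "\<exists>n. (G ^^ n) x \<in> {c..<nxt c} \<or> (Gi ^^ n) x \<in> {c..<nxt c}"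
  using c
proof (cases rule: nxt_cases)
  case 1
  then show ?thesis using ex_fundamental_up[OF x _ nofix, of c] by auto
next
  case 2
  interpret inv: interval_homeo Gi G p q by (rule inverse_interval_homeo)
  show ?thesis using inv.ex_fundamental_up[OF x, of c] nofix 2 by (auto simp: Gi_fixed_iff)
qed

lemma fixed_not_in_fundamental:
  assumes "G c \<noteq> c" "G e = e" shows "e \<notin> {c..nxt c}"
  using assms(1)
proof (cases rule: nxt_cases)
  case 1
  then show ?thesis using G_less[of c e] G_le[of e c] assms(2) by auto
next
  case 2
  have "Gi e = e" using assms by (simp add: Gi_fixed_iff)
  then show ?thesis using Gi_less[of c e] 2 G_less[of c e] G_less[of e c] assms(2) by (metis GGi G_le atLeastAtMost_iff linorder_not_less order.strict_trans1)
qed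

end

section \<open>Oscillating potentials on fundamental domains\<close>

definition orbit_sum :: "('a \<Rightarrow> 'a) \<Rightarrow> ('a \<Rightarrow> real) \<Rightarrow> 'a \<Rightarrow> real" where
  "orbit_sum H \<psi> x = (\<Sum>n. \<psi> ((H ^^ n) x) / real (Suc n))"

text \<open>\<open>C\<close> marks every gap of the fixed point set in \<open>{p..q}\<close> exactly
  once: \<open>C_sep\<close> says at most once, \<open>C_cover\<close> at least once.\<close>

locale marked_interval_homeo = interval_homeo +
  fixes C :: "real set"
  assumes finite_C: "finite C" and C_in: "c \<in> C \<Longrightarrow> c \<in> {p..q}" and C_nonfixed: "c \<in> C \<Longrightarrow> G c \<noteq> c"
    and C_sep: "c \<in> C \<Longrightarrow> c' \<in> C \<Longrightarrow> c \<noteq> c' \<Longrightarrow> \<exists>e\<in>closed_segment c c'. G e = e"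
    and C_cover: "x \<in> {p..q} \<Longrightarrow> G x \<noteq> x \<Longrightarrow> \<exists>c\<in>C. \<forall>e\<in>closed_segment c x. G e \<noteq> e"
begin

lemma inverse_marked_interval_homeo: "marked_interval_homeo Gi G p q C"
proof -
  interpret inv: interval_homeo Gi G p q by (rule inverse_interval_homeo)
  show ?thesis
    by unfold_locales (use finite_C C_in C_nonfixed C_sep C_cover in \<open>auto simp: Gi_fixed_iff\<close>)
qed

abbreviation "fund c \<equiv> {c..<nxt c}"

text \<open>Orbits never cross a fixed point, so they cannot pass between domains in different gaps.
  Within a gap one step leaves the half-open domain, and monotonicity prevents a return.\<close>

lemma wander:
  assumes c: "c \<in> C" "c' \<in> C" and z: "z \<in> fund c" "(G ^^ n) z \<in> fund c'"
  shows "n = 0 \<and> c = c'"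
proof -
  have "c = c'"
  proof (rule ccontr)
    assume "c \<noteq> c'"
    then obtain e where e: "e \<in> closed_segment c c'" "G e = e" using C_sep c by blast
    have ne: "e \<notin> {c..nxt c}" "e \<notin> {c'..nxt c'}"
      using fixed_not_in_fundamental C_nonfixed c e by auto
    then have "e < c \<or> nxt c < e" "e < c' \<or> nxt c' < e" by auto
    moreover have "c < nxt c" "c' < nxt c'" using less_nxt C_nonfixed c by auto
    ultimately show False
      using e(1) z Gpow_fixed_less[OF e(2), of n z]
      by (auto simp: closed_segment_eq_real_ivl split: if_splits)
  qed
  moreover have "n = 0"
  proof (rule ccontr)
    assume "n \<noteq> 0"
    then obtain k where k: "n = Suc k" using not0_implies_Suc by blast
    show False
      using C_nonfixed[OF c(1)]
    proof (cases rule: nxt_cases)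
      case 1
      have "G c \<le> (G ^^ n) c"
        using incseqD[OF Gpow_incseq[of c], of 1 n] 1 k by simp
      also have "\<dots> \<le> (G ^^ n) z" using z by simp
      finally show False using z 1 \<open>c = c'\<close> by simp
    next
      case 2
      have "(G ^^ n) z < (G ^^ n) (Gi c)" using z 2 by simp
      also have "\<dots> = (G ^^ k) c" unfolding k by (simp add: funpow_swap1)
      also have "\<dots> \<le> c" using decseqD[OF Gpow_decseq[of c], of 0 k] 2 by simp
      finally show False using z \<open>c = c'\<close> by simp
    qed
  qed
  ultimately show ?thesis by blast
qed

definition supported :: "(real \<Rightarrow> real) \<Rightarrow> bool" where
  "supported \<psi> \<longleftrightarrow> continuous_on {p..q} \<psi> \<and> (\<forall>z. \<psi> z \<noteq> 0 \<longrightarrow> (\<exists>c\<in>C. z \<in> fund c))"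

lemma supported_inverse: "marked_interval_homeo.supported Gi G p q C \<psi> \<longleftrightarrow> supported \<psi>"
  using marked_interval_homeo.supported_def[OF inverse_marked_interval_homeo] by (simp add: supported_def nxt_inverse)

lemma orbit_sum_uniq:
  assumes "supported \<psi>" "\<psi> ((G ^^ n) x) / real (Suc n) \<noteq> 0" "\<psi> ((G ^^ m) x) / real (Suc m) \<noteq> 0"
  shows "n = m"
proof -
  have *: False if nm: "n < m" "\<psi> ((G ^^ n) x) \<noteq> 0" "\<psi> ((G ^^ m) x) \<noteq> 0" for n m
  proof -
    obtain c c' where c: "c \<in> C" "(G ^^ n) x \<in> fund c" "c' \<in> C" "(G ^^ m) x \<in> fund c'"
      using assms(1) nm unfolding supported_def by blast
    have "(G ^^ m) x = (G ^^ (m - n)) ((G ^^ n) x)"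
      by (rule funpow_diff_apply[symmetric]) (use nm(1) in linarith)
    then have "(G ^^ (m - n)) ((G ^^ n) x) \<in> fund c'" using c(4) by metis
    then have "m - n = 0" using wander[OF c(1,3,2)] by blast
    then show False using nm(1) by simp
  qed
  show ?thesis using *[of n m] *[of m n] assms by (cases n m rule: linorder_cases) auto
qed

lemma continuous_orbit_sum: assumes "supported \<psi>" shows "continuous_on {p..q} (orbit_sum G \<psi>)"
proof -
  have "continuous_on {p..q} \<psi>" using assms by (simp add: supported_def)
  then obtain B where B: "\<And>x. x \<in> {p..q} \<Longrightarrow> \<bar>\<psi> x\<bar> \<le> B" by (rule continuous_Icc_bounded) blast
  have "continuous_on {p..q} (\<lambda>x. \<Sum>n. \<psi> ((G ^^ n) x) / real (Suc n))"
  proof (rule continuous_on_disjoint_series[where b = "\<lambda>n. B / real (Suc n)"])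
    fix n
    have "continuous_on {p..q} (\<lambda>x. (G ^^ n) x)"
    proof (induction n)
      case (Suc n)
      have "continuous_on {p..q} (\<lambda>x. G ((G ^^ n) x))"
        by (rule continuous_on_compose2[OF cont_G Suc]) auto
      then show ?case by simp
    qed simp
    then have "continuous_on {p..q} (\<lambda>x. \<psi> ((G ^^ n) x))"
      by (rule continuous_on_compose2[OF \<open>continuous_on {p..q} \<psi>\<close>]) (use Gpow_in in blast)
    then show "continuous_on {p..q} (\<lambda>x. \<psi> ((G ^^ n) x) / real (Suc n))" by (intro continuous_intros) auto
  next
    fix n x assume "x \<in> {p..q}"
    then show "\<bar>\<psi> ((G ^^ n) x) / real (Suc n)\<bar> \<le> B / real (Suc n)"
      using B[OF Gpow_in[of x n]] by (simp add: divide_right_mono)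
  next
    show "(\<lambda>n. B / real (Suc n)) \<longlonglongrightarrow> 0"
      using LIMSEQ_Suc[OF lim_const_over_n[of B]] by simp
  qed (use orbit_sum_uniq[OF assms] in blast)
  then show ?thesis unfolding orbit_sum_def .
qed

lemma orbit_sum_eq:
  assumes "supported \<psi>" and "\<And>n. n \<noteq> k \<Longrightarrow> \<psi> ((G ^^ n) x) = 0"
  shows "orbit_sum G \<psi> x = \<psi> ((G ^^ k) x) / real (Suc k)"
  unfolding orbit_sum_def
  by (rule disjoint_series_eq[where A = UNIV and x = x and k = k and h = "\<lambda>n x. \<psi> ((G ^^ n) x) / real (Suc n)"])
    (use orbit_sum_uniq[OF assms(1)] assms(2) in simp_all)

text \<open>By \<open>wander\<close> an orbit visits the fundamental domains at most once, so only
  the term \<open>n = k\<close> can survive. Each of \<open>orbit_sum G\<close> and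
  \<open>orbit_sum Gi\<close> is thus felt in one time direction only, apart from the visit itself,
  and the two profiles are measured independently.\<close>

lemma
  assumes "supported \<psi>" "c \<in> C" "z \<in> fund c"
  shows orbit_sum_backward: "orbit_sum G \<psi> ((Gi ^^ k) z) = \<psi> z / real (Suc k)"
    and orbit_sum_forward: "orbit_sum G \<psi> ((G ^^ Suc k) z) = 0"
proof -
  have *: "\<psi> ((G ^^ n) ((Gi ^^ k) z)) = 0" if "n \<noteq> k" for n
  proof (rule ccontr)
    assume "\<psi> ((G ^^ n) ((Gi ^^ k) z)) \<noteq> 0"
    then obtain c' where c': "c' \<in> C" "(G ^^ n) ((Gi ^^ k) z) \<in> fund c'" using assms unfolding supported_def by blast
    define w where "w = (G ^^ n) ((Gi ^^ k) z)"
    show False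
    proof (cases "k \<le> n")
      case True
      have "w = (G ^^ (n - k)) ((G ^^ k) ((Gi ^^ k) z))"
        unfolding w_def using True by (rule funpow_diff_apply[symmetric])
      then show False using wander[OF assms(2) c'(1) assms(3), of "n - k"] c'(2) that True by (simp add: w_def)
    next
      case False
      have "(G ^^ (k - n)) w = (G ^^ k) ((Gi ^^ k) z)"
        unfolding w_def by (rule funpow_diff_apply) (use False in linarith)
      then show False
        using wander[OF c'(1) assms(2) c'(2), of "k - n"] assms(3) False by (simp add: w_def)
    qed
  qed
  show "orbit_sum G \<psi> ((Gi ^^ k) z) = \<psi> z / real (Suc k)"
    using orbit_sum_eq[OF assms(1) *] by simp
  have "\<psi> ((G ^^ n) ((G ^^ Suc k) z)) = 0" for n
  proof (rule ccontr)
    assume "\<psi> ((G ^^ n) ((G ^^ Suc k) z)) \<noteq> 0"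
    then obtain c' where c': "c' \<in> C" "(G ^^ n) ((G ^^ Suc k) z) \<in> fund c'" using assms unfolding supported_def by blast
    moreover have "(G ^^ (n + Suc k)) z = (G ^^ n) ((G ^^ Suc k) z)" by (metis funpow_add o_apply)
    ultimately have "(G ^^ (n + Suc k)) z \<in> fund c'" by metis
    then show False using wander[OF assms(2) c'(1) assms(3), of "n + Suc k"] by simp
  qed
  then show "orbit_sum G \<psi> ((G ^^ Suc k) z) = 0" using orbit_sum_eq[OF assms(1), of 0 "(G ^^ Suc k) z"] by (metis div_0)
qed

lemma orbit_sum_fixed: assumes "supported \<psi>" "G e = e" shows "orbit_sum G \<psi> e = 0"
proof -
  have "\<psi> e = 0"
  proof (rule ccontr)
    assume "\<psi> e \<noteq> 0"
    then obtain c where "c \<in> C" "e \<in> fund c" using assms unfolding supported_def by blast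
    then show False using fixed_not_in_fundamental[OF C_nonfixed[of c] assms(2)] by auto
  qed
  then show ?thesis using orbit_sum_eq[OF assms(1), of 0 e] by (simp add: Gpow_fixed assms)
qed

text \<open>The iterates of a fundamental domain are consecutive intervals inside
  \<open>{p..q}\<close>, so their lengths telescope to at most \<open>q - p\<close>.\<close>

lemma fundamental_sums_bounded:
  assumes c: "c \<in> C" and z: "z0 \<in> fund c" "z1 \<in> fund c"
  shows "\<bar>\<Sum>i<n. (G ^^ i) z0 - (G ^^ i) z1\<bar> \<le> q - p"
proof -
  have nx: "nxt c \<in> {p..q}"
  proof -
    interpret inv: interval_homeo Gi G p q by (rule inverse_interval_homeo)
    have "G c \<in> {p..q}" "Gi c \<in> {p..q}" using Gpow_in[OF C_in[OF c], of 1] inv.Gpow_in[OF C_in[OF c], of 1] by auto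
    then show ?thesis by (auto simp: nxt_def max_def)
  qed
  have "\<bar>\<Sum>i<n. (G ^^ i) z0 - (G ^^ i) z1\<bar> \<le> (\<Sum>i<n. (G ^^ i) (nxt c) - (G ^^ i) c)"
  proof (rule order_trans[OF sum_abs], rule sum_mono)
    fix i
    have "(G ^^ i) c \<le> (G ^^ i) z0" "(G ^^ i) c \<le> (G ^^ i) z1"
      "(G ^^ i) z0 \<le> (G ^^ i) (nxt c)" "(G ^^ i) z1 \<le> (G ^^ i) (nxt c)"
      using z by auto
    then show "\<bar>(G ^^ i) z0 - (G ^^ i) z1\<bar> \<le> (G ^^ i) (nxt c) - (G ^^ i) c" by linarith
  qed
  also have "\<dots> \<le> q - p"
    using C_nonfixed[OF c]
  proof (cases rule: nxt_cases)
    case 1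
    have "(\<Sum>i<n. (G ^^ i) (nxt c) - (G ^^ i) c) = (G ^^ n) c - c"
      unfolding 1 by (induction n) (simp_all add: funpow_swap1)
    then show ?thesis using Gpow_in[OF C_in[OF c], of n] C_in[OF c] by simp
  next
    case 2
    have "(\<Sum>i<n. (G ^^ i) (nxt c) - (G ^^ i) c) = nxt c - (G ^^ n) (nxt c)"
      unfolding 2 by (induction n) (simp_all add: funpow_swap1)
    then show ?thesis using Gpow_in[OF nx, of n] nx by simp
  qed
  finally show ?thesis .
qed

text \<open>Along the forward orbits the identity part contributes a bounded sum and
  \<open>\<psi>2\<close> only the term at time 0. What remains is
  \<open>\<psi>1 z0 - \<psi>1 z1\<close> times the harmonic series.\<close>

lemma bdd_diff_fundamental:
  assumes \<psi>: "supported \<psi>1" "supported \<psi>2" and c: "c \<in> C" and z: "z0 \<in> fund c" "z1 \<in> fund c"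
    and bd: "bdd_diff G (\<lambda>z. M + z + orbit_sum Gi \<psi>1 z + orbit_sum G \<psi>2 z) z0 z1"
  shows "\<psi>1 z0 = \<psi>1 z1"
proof -
  interpret inv: marked_interval_homeo Gi G p q C by (rule inverse_marked_interval_homeo)
  define \<Theta> where "\<Theta> z = M + z + orbit_sum Gi \<psi>1 z + orbit_sum G \<psi>2 z" for z
  have \<Theta>: "\<Theta> ((G ^^ i) z) = M + (G ^^ i) z + \<psi>1 z / real (Suc i) + (if i = 0 then \<psi>2 z else 0)"
    if "z \<in> fund c" for z i
    using inv.orbit_sum_backward[of \<psi>1 c z i] orbit_sum_backward[OF \<psi>(2) c that, of 0] orbit_sum_forward[OF \<psi>(2) c that, of "i - 1"] \<psi> c that
    by (cases i) (auto simp: \<Theta>_def supported_inverse nxt_inverse)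
  define r where "r i = ((G ^^ i) z0 - (G ^^ i) z1) + (if i = 0 then \<psi>2 z0 - \<psi>2 z1 else 0)" for i
  obtain B where B: "\<And>n. \<bar>\<Sum>i<n. \<Theta> ((G ^^ i) z0) - \<Theta> ((G ^^ i) z1)\<bar> \<le> B"
    using bd unfolding bdd_diff_def \<Theta>_def by blast
  have "\<Theta> ((G ^^ i) z0) - \<Theta> ((G ^^ i) z1) = (\<psi>1 z0 - \<psi>1 z1) / real (Suc i) + r i" for i
    using \<Theta>[OF z(1), of i] \<Theta>[OF z(2), of i] by (simp add: r_def diff_divide_distrib)
  then have 1: "\<bar>\<Sum>i<n. (\<psi>1 z0 - \<psi>1 z1) / real (Suc i) + r i\<bar> \<le> B" for n using B[of n] by simp
  have "\<bar>\<Sum>i<n. r i\<bar> \<le> (q - p) + \<bar>\<psi>2 z0 - \<psi>2 z1\<bar>" for n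
  proof -
    have "\<bar>\<Sum>i<n. if i = 0 then \<psi>2 z0 - \<psi>2 z1 else 0\<bar> \<le> \<bar>\<psi>2 z0 - \<psi>2 z1\<bar>"
      by (simp add: sum.delta')
    then show ?thesis using fundamental_sums_bounded[OF c z, of n] by (simp add: r_def sum.distrib)
  qed
  with 1 have "\<psi>1 z0 - \<psi>1 z1 = 0" by (rule bounded_harmonic_sums_0)
  then show ?thesis by simp
qed

text \<open>The oscillations vanish at fixed points, so the terms of the difference converge to
  \<open>b - b'\<close>. A nonzero limit would make the partial sums grow linearly.\<close>

lemma bdd_diff_limit:
  assumes "supported \<psi>1" "supported \<psi>2" and x: "x \<in> {p..q}" "y \<in> {p..q}"
    and bd: "bdd_diff G (\<lambda>z. M + z + orbit_sum Gi \<psi>1 z + orbit_sum G \<psi>2 z) x y"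
    and lim: "(\<lambda>n. (G ^^ n) x) \<longlonglongrightarrow> b" "(\<lambda>n. (G ^^ n) y) \<longlonglongrightarrow> b'" "G b = b" "G b' = b'" "b \<in> {p..q}" "b' \<in> {p..q}"
  shows "b = b'"
proof -
  interpret inv: marked_interval_homeo Gi G p q C by (rule inverse_marked_interval_homeo)
  define \<Theta> where "\<Theta> z = M + z + orbit_sum Gi \<psi>1 z + orbit_sum G \<psi>2 z" for z
  have cont: "continuous_on {p..q} \<Theta>"
    unfolding \<Theta>_def by (intro continuous_intros continuous_orbit_sum inv.continuous_orbit_sum) (use assms supported_inverse in auto)
  have L: "(\<lambda>n. \<Theta> ((G ^^ n) u)) \<longlonglongrightarrow> \<Theta> a" if "u \<in> {p..q}" "a \<in> {p..q}" "(\<lambda>n. (G ^^ n) u) \<longlonglongrightarrow> a" for u a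
    using continuous_on_tendsto_compose[OF cont that(3,2)] Gpow_in[OF that(1)] by simp
  have "(\<lambda>n. \<Theta> ((G ^^ n) x) - \<Theta> ((G ^^ n) y)) \<longlonglongrightarrow> \<Theta> b - \<Theta> b'"
    by (intro tendsto_diff L x lim)
  moreover obtain B where "\<And>n. \<bar>\<Sum>i<n. \<Theta> ((G ^^ i) x) - \<Theta> ((G ^^ i) y)\<bar> \<le> B"
    using bd unfolding bdd_diff_def \<Theta>_def by blast
  ultimately have "\<Theta> b - \<Theta> b' = 0" by (rule bounded_sums_limit_0)
  moreover have "\<Theta> b = M + b" "\<Theta> b' = M + b'"
    using orbit_sum_fixed inv.orbit_sum_fixed assms supported_inverse by (simp_all add: \<Theta>_def Gi_fixed_iff)
  ultimately show ?thesis by simp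
qed

lemma bdd_diff_iterate:
  assumes "continuous_on {p..q} \<Theta>" "x \<in> {p..q}"
  shows "bdd_diff G \<Theta> x ((G ^^ n) x)" "bdd_diff G \<Theta> x ((Gi ^^ n) x)"
proof -
  interpret inv: interval_homeo Gi G p q by (rule inverse_interval_homeo)
  obtain B where B: "\<And>x. x \<in> {p..q} \<Longrightarrow> \<bar>\<Theta> x\<bar> \<le> B"
    using continuous_Icc_bounded[OF assms(1)] by blast
  have *: "bdd_diff G \<Theta> x ((G ^^ n) x)" if "x \<in> {p..q}" for x
  proof (induction n)
    case 0
    then show ?case by (auto simp: bdd_diff_def)
  next
    case (Suc n)
    have "bdd_diff G \<Theta> ((G ^^ n) x) (G ((G ^^ n) x))"
      by (rule bdd_diff_step[of _ _ _ B]) (use B Gpow_in Gpow_in[OF that] in blast)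
    then show ?case using bdd_diff_trans[OF Suc] by simp
  qed
  then show "bdd_diff G \<Theta> x ((G ^^ n) x)" using assms by blast
  show "bdd_diff G \<Theta> x ((Gi ^^ n) x)"
    using *[OF inv.Gpow_in[OF assms(2), of n]] by (simp add: bdd_diff_sym)
qed

lemma ex_potential:
  "\<exists>\<Theta>. continuous_on {p..q} \<Theta> \<and> (\<forall>x\<in>{p..q}. 0 < \<Theta> x) \<and>
     (\<forall>x\<in>{p..q}. \<forall>y\<in>{p..q}. bdd_diff G \<Theta> x y \<and> bdd_diff Gi \<Theta> x y \<longrightarrow> (\<exists>n. y = (G ^^ n) x \<or> x = (G ^^ n) y))"
proof -
  interpret inv: marked_interval_homeo Gi G p q C by (rule inverse_marked_interval_homeo)
  \<comment> \<open>The profile \<open>\<psi>1\<close> is symmetric and \<open>\<psi>2\<close> antisymmetric about the midpoint of a fundamental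
    domain, so that together they are injective on it.\<close>
  define bump where "bump c z = max 0 ((z - c) * (nxt c - z))" for c z
  define \<psi>1 where "\<psi>1 z = (\<Sum>c\<in>C. bump c z)" for z
  define \<psi>2 where "\<psi>2 z = (\<Sum>c\<in>C. bump c z * (2 * z - c - nxt c))" for z
  have supp: "z \<in> fund c" if "bump c z \<noteq> 0" for c z
  proof -
    have "0 < (z - c) * (nxt c - z)" using that by (simp add: bump_def max_def less_le split: if_splits)
    then have "(c < z \<and> z < nxt c) \<or> (z < c \<and> nxt c < z)" by (auto simp: zero_less_mult_iff)
    moreover have "c \<le> nxt c" using less_nxt[of c] by (cases "G c = c") (auto simp: nxt_def)
    ultimately show ?thesis by auto
  qed
  have supported: "supported \<psi>1" "supported \<psi>2"
  proof -
    have "continuous_on {p..q} \<psi>1" "continuous_on {p..q} \<psi>2"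
      unfolding \<psi>1_def \<psi>2_def bump_def by (intro continuous_intros)+
    moreover have "\<exists>c\<in>C. z \<in> fund c" if nz: "\<psi>1 z \<noteq> 0 \<or> \<psi>2 z \<noteq> 0" for z
    proof -
      have "\<exists>c\<in>C. bump c z \<noteq> 0"
      proof (rule ccontr)
        assume "\<not> ?thesis"
        then have "\<psi>1 z = 0" "\<psi>2 z = 0" by (auto simp: \<psi>1_def \<psi>2_def)
        then show False using nz by simp
      qed
      then show ?thesis using supp by blast
    qed
    ultimately show "supported \<psi>1" "supported \<psi>2" unfolding supported_def by blast+
  qed
  have val: "\<psi>1 z = (z - c) * (nxt c - z)" "\<psi>2 z = (z - c) * (nxt c - z) * (2 * z - c - nxt c)"
    if c: "c \<in> C" and z: "z \<in> fund c" for c z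
  proof -
    have "bump c' z = 0" if "c' \<in> C - {c}" for c'
      using supp[of c' z] wander[of c c' z 0] that c z by auto
    moreover have "bump c z = (z - c) * (nxt c - z)" using z by (simp add: bump_def)
    ultimately show "\<psi>1 z = (z - c) * (nxt c - z)" "\<psi>2 z = (z - c) * (nxt c - z) * (2 * z - c - nxt c)"
      unfolding \<psi>1_def \<psi>2_def using finite_C c by (simp_all add: sum.remove[OF finite_C c])
  qed
  define \<Theta>0 where "\<Theta>0 z = z + orbit_sum Gi \<psi>1 z + orbit_sum G \<psi>2 z" for z
  have "continuous_on {p..q} \<Theta>0"
    unfolding \<Theta>0_def by (intro continuous_intros continuous_orbit_sum inv.continuous_orbit_sum) (use supported supported_inverse in auto)
  then obtain B where B: "\<And>x. x \<in> {p..q} \<Longrightarrow> \<bar>\<Theta>0 x\<bar> \<le> B"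
    by (rule continuous_Icc_bounded) blast
  \<comment> \<open>The additive constant makes the potential positive and cancels in all
    differences.\<close>
  define \<Theta> where "\<Theta> z = (B + 1) + z + orbit_sum Gi \<psi>1 z + orbit_sum G \<psi>2 z" for z
  have \<Theta>_eq: "\<Theta> z = B + 1 + \<Theta>0 z" for z by (simp add: \<Theta>_def \<Theta>0_def)
  have cont: "continuous_on {p..q} \<Theta>"
    unfolding \<Theta>_eq[abs_def] by (intro continuous_intros \<open>continuous_on {p..q} \<Theta>0\<close>)
  have pos: "0 < \<Theta> x" if "x \<in> {p..q}" for x using B[OF that] unfolding \<Theta>_eq by linarith
  have \<Theta>1: "\<Theta> = (\<lambda>z. (B + 1) + z + orbit_sum Gi \<psi>1 z + orbit_sum G \<psi>2 z)" by (simp add: \<Theta>_def[abs_def])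
  \<comment> \<open>Exchanging \<open>G\<close> with \<open>Gi\<close> exchanges the two oscillating
    terms. Written in this order, \<open>\<Theta>\<close> has the form required by the lemmas for
    the inverse map.\<close>
  have \<Theta>2: "\<Theta> = (\<lambda>z. (B + 1) + z + orbit_sum G \<psi>2 z + orbit_sum Gi \<psi>1 z)" by (auto simp: \<Theta>_def)
  have supported': "inv.supported \<psi>1" "inv.supported \<psi>2" using supported supported_inverse by auto
  \<comment> \<open>The orbits of \<open>x\<close> and \<open>y\<close> share their forward limit
    and their backward limit. A fixed point between \<open>x\<close> and \<open>y\<close> squeezes
    all these limits onto itself, and a monotone orbit with the same limit at both ends is
    constant.\<close>
  have nofix: "G e \<noteq> e" if xy: "x \<in> {p..q}" "y \<in> {p..q}" "x < y" and bd: "bdd_diff G \<Theta> x y" "bdd_diff Gi \<Theta> x y"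
     and e: "x \<le> e" "e \<le> y" for x y e
  proof
    assume fe: "G e = e"
    then have fe': "Gi e = e" by (simp add: Gi_fixed_iff)
    obtain b where b: "b \<in> {p..q}" "G b = b" "(\<lambda>n. (G ^^ n) x) \<longlonglongrightarrow> b" "x \<le> G x \<Longrightarrow> x \<le> b" "G x \<le> x \<Longrightarrow> b \<le> x"
      using orbit_limit[OF xy(1)] by blast
    obtain b' where b': "b' \<in> {p..q}" "G b' = b'" "(\<lambda>n. (G ^^ n) y) \<longlonglongrightarrow> b'" "y \<le> G y \<Longrightarrow> y \<le> b'" "G y \<le> y \<Longrightarrow> b' \<le> y"
      using orbit_limit[OF xy(2)] by blast
    obtain a where a: "a \<in> {p..q}" "Gi a = a" "(\<lambda>n. (Gi ^^ n) x) \<longlonglongrightarrow> a" "x \<le> Gi x \<Longrightarrow> x \<le> a" "Gi x \<le> x \<Longrightarrow> a \<le> x"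
      using inv.orbit_limit[OF xy(1)] by blast
    obtain a' where a': "a' \<in> {p..q}" "Gi a' = a'" "(\<lambda>n. (Gi ^^ n) y) \<longlonglongrightarrow> a'" "y \<le> Gi y \<Longrightarrow> y \<le> a'" "Gi y \<le> y \<Longrightarrow> a' \<le> y"
      using inv.orbit_limit[OF xy(2)] by blast
    have "b = b'"
      using bdd_diff_limit[OF supported xy(1,2) bd(1)[unfolded \<Theta>1] b(3) b'(3) b(2) b'(2) b(1) b'(1)] .
    moreover have "a = a'"
      using inv.bdd_diff_limit[OF supported'(2,1) xy(1,2) bd(2)[unfolded \<Theta>2] a(3) a'(3) a(2) a'(2) a(1) a'(1)] .
    moreover have "b \<le> e" using LIMSEQ_le_const2[OF b(3), of e] Gpow_fixed_less[OF fe] e by blast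
    moreover have "a \<le> e" using LIMSEQ_le_const2[OF a(3), of e] inv.Gpow_fixed_less[OF fe'] e by blast
    moreover have "e \<le> b'" using LIMSEQ_le_const[OF b'(3), of e] Gpow_fixed_less[OF fe] e by blast
    moreover have "e \<le> a'" using LIMSEQ_le_const[OF a'(3), of e] inv.Gpow_fixed_less[OF fe'] e by blast
    ultimately have "a = e" "b = e" "a' = e" "b' = e" by auto
    moreover have "Gi u \<le> u \<longleftrightarrow> u \<le> G u" "u \<le> Gi u \<longleftrightarrow> G u \<le> u" for u
      using G_le[of "Gi u" u] G_le[of u "Gi u"] by simp_all
    ultimately have "x = e" "y = e"
      using a(4,5) b(4,5) a'(4,5) b'(4,5) linear[of x "G x"] linear[of y "G y"] by auto
    then show False using xy by simp
  qed
  have main: "\<exists>n. y = (G ^^ n) x \<or> x = (G ^^ n) y"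
    if xy: "x \<in> {p..q}" "y \<in> {p..q}" and bd: "bdd_diff G \<Theta> x y" "bdd_diff Gi \<Theta> x y" for x y
  proof (cases "x = y")
    case True
    then show ?thesis by (intro exI[of _ 0]) simp
  next
    case False
    have nf: "G e \<noteq> e" if "e \<in> closed_segment x y" for e
      using nofix[OF xy _ bd, of e] nofix[OF xy(2,1) _ bd[THEN bdd_diff_sym], of e] that False
      by (auto simp: closed_segment_eq_real_ivl split: if_splits)
    then have "G x \<noteq> x" by auto
    then obtain c where c: "c \<in> C" "\<And>e. e \<in> closed_segment c x \<Longrightarrow> G e \<noteq> e" using C_cover[OF xy(1)] by blast
    have cy: "G e \<noteq> e" if "e \<in> closed_segment c y" for e
    proof -
      have "e \<in> closed_segment c x \<or> e \<in> closed_segment x y"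
        using that by (auto simp: closed_segment_eq_real_ivl split: if_splits)
      then show ?thesis using c(2) nf by blast
    qed
    obtain n where n: "(G ^^ n) x \<in> fund c \<or> (Gi ^^ n) x \<in> fund c"
      using ex_fundamental[OF xy(1) C_nonfixed[OF c(1)] c(2)] by blast
    obtain m where m: "(G ^^ m) y \<in> fund c \<or> (Gi ^^ m) y \<in> fund c"
      using ex_fundamental[OF xy(2) C_nonfixed[OF c(1)] cy] by blast
    have bdit: "bdd_diff H \<Theta> u ((K ^^ n) u)" if "u \<in> {p..q}" "H \<in> {G, Gi}" "K \<in> {G, Gi}" for H K u n
      using that bdd_diff_iterate[OF cont that(1), of n] inv.bdd_diff_iterate[OF cont that(1), of n] by auto
    obtain K where K: "K \<in> {G, Gi}" "(K ^^ n) x \<in> fund c" using n by blast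
    obtain L where L: "L \<in> {G, Gi}" "(L ^^ m) y \<in> fund c" using m by blast
    define z0 where "z0 = (K ^^ n) x"
    define z1 where "z1 = (L ^^ m) y"
    have "bdd_diff H \<Theta> z0 z1" if "H \<in> {G, Gi}" for H
    proof -
      have "bdd_diff H \<Theta> x y" using bd that by auto
        moreover have "bdd_diff H \<Theta> x z0" "bdd_diff H \<Theta> y z1"
        unfolding z0_def z1_def using bdit[OF xy(1) that K(1)] bdit[OF xy(2) that L(1)] by blast+
      ultimately show ?thesis by (blast intro: bdd_diff_trans bdd_diff_sym)
    qed
    then have "bdd_diff G \<Theta> z0 z1" "bdd_diff Gi \<Theta> z0 z1" by auto
    moreover have z: "z0 \<in> fund c" "z1 \<in> fund c" using K L by (simp_all add: z0_def z1_def)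
    ultimately have "\<psi>1 z0 = \<psi>1 z1" "\<psi>2 z0 = \<psi>2 z1"
      using bdd_diff_fundamental[OF supported c(1), of z0 z1 "B + 1"]
        inv.bdd_diff_fundamental[OF supported'(2,1) c(1), of z0 z1 "B + 1"]
      unfolding \<Theta>1[symmetric] \<Theta>2[symmetric] nxt_inverse by blast+
    then have e1: "(z0 - c) * (nxt c - z0) = (z1 - c) * (nxt c - z1)"
      and e2: "(z0 - c) * (nxt c - z0) * (2 * z0 - c - nxt c) = (z1 - c) * (nxt c - z1) * (2 * z1 - c - nxt c)"
      using val[OF c(1)] z by simp_all
    \<comment> \<open>A vanishing bump value leaves only the left end of the half-open domain.
      Otherwise the common factor cancels in \<open>e2\<close>, and the remaining linear factor
      determines the point.\<close>
    have "z0 = z1"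
    proof (cases "(z0 - c) * (nxt c - z0) = 0")
      case True
      then show ?thesis using e1 z by auto
    next
      case False
      then show ?thesis using e1 e2 by auto
    qed
    then have eq: "(K ^^ n) x = (L ^^ m) y" by (simp add: z0_def z1_def)
    have up: "\<exists>k. y = (G ^^ k) x \<or> x = (G ^^ k) y" if "(G ^^ n) x = (G ^^ m) y" for n m x y
    proof (cases "m \<le> n")
      case True
      then have "(G ^^ m) ((G ^^ (n - m)) x) = (G ^^ m) y"
        using that funpow_funpow[of m G "n - m" x] by simp
      then show ?thesis unfolding Gpow_eq by metis
    next
      case False
      then have "(G ^^ n) ((G ^^ (m - n)) y) = (G ^^ n) x"
        using that funpow_funpow[of n G "m - n" y] by simp
      then show ?thesis unfolding Gpow_eq by metis
    qed
    from K(1) L(1) show ?thesis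
    proof (elim insertE emptyE)
      assume "K = G" "L = G"
      then show ?thesis using eq up by blast
    next
      assume "K = G" "L = Gi"
      then have "y = (G ^^ (m + n)) x" using eq by (simp add: funpow_add)
      then show ?thesis by blast
    next
      assume "K = Gi" "L = G"
      then have "(G ^^ n) ((Gi ^^ n) x) = (G ^^ n) ((G ^^ m) y)" using eq by simp
      then have "x = (G ^^ (n + m)) y" by (simp add: funpow_add)
      then show ?thesis by blast
    next
      assume "K = Gi" "L = Gi"
      then have "(G ^^ n) ((Gi ^^ n) x) = (G ^^ n) ((Gi ^^ m) y)" using eq by simp
      then have "(G ^^ m) x = (G ^^ m) ((G ^^ n) ((Gi ^^ m) y))" by simp
      also have "\<dots> = (G ^^ n) ((G ^^ m) ((Gi ^^ m) y))"
        using funpow_funpow[of m G n] funpow_funpow[of n G m] by (metis add.commute)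
      finally show ?thesis using up[of m x n y] by simp
    qed
  qed
  then show ?thesis using cont pos by blast
qed

text \<open>A compact set of nonfixed points that meets every nonfixed orbit in
  \<open>{p..q}\<close>. Compactness needs the domains closed and finite in number; it yields a
  positive minimal displacement.\<close>

definition core :: "real set" where "core = (\<Union>c\<in>C. {c..nxt c})"

lemma compact_core: "compact core"
  unfolding core_def by (intro compact_UN finite_C) auto

lemma core_nonfixed: "z \<in> core \<Longrightarrow> G z \<noteq> z"
  using fixed_not_in_fundamental C_nonfixed unfolding core_def by blast

lemma core_in: "core \<subseteq> {p<..<q}"
proof
  fix z assume "z \<in> core"
  then obtain c where c: "c \<in> C" "z \<in> {c..nxt c}" unfolding core_def by blast
  moreover have "p \<notin> {c..nxt c}" "q \<notin> {c..nxt c}"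
    using fixed_not_in_fundamental[OF C_nonfixed[OF c(1)]] by auto
  ultimately show "z \<in> {p<..<q}" using C_in[OF c(1)] by auto
qed

lemma ex_core:
  assumes "x \<in> {p..q}" "G x \<noteq> x"
  shows "\<exists>n. (G ^^ n) x \<in> core \<or> (Gi ^^ n) x \<in> core"
proof -
  obtain c where c: "c \<in> C" "\<And>e. e \<in> closed_segment c x \<Longrightarrow> G e \<noteq> e" using C_cover[OF assms] by blast
  then obtain n where "(G ^^ n) x \<in> fund c \<or> (Gi ^^ n) x \<in> fund c"
    using ex_fundamental[OF assms(1) C_nonfixed[OF c(1)] c(2)] by blast
  then show ?thesis using c(1) unfolding core_def by fastforce
qed

end

section \<open>Orientation reversing homeomorphisms of the circle\<close>

lemma compact_pos_lower_bound:
  fixes h :: "'a::topological_space \<Rightarrow> real"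
  assumes "compact A" "continuous_on A h" "\<And>x. x \<in> A \<Longrightarrow> 0 < h x"
  obtains m where "m > 0" "\<And>x. x \<in> A \<Longrightarrow> m \<le> h x"
proof (cases "A = {}")
  case False
  then obtain z where "z \<in> A" "\<And>x. x \<in> A \<Longrightarrow> h z \<le> h x"
    using continuous_attains_inf[OF assms(1) _ assms(2)] by blast
  then show ?thesis using that assms(3) by blast
qed (use that[of 1] in auto)

text \<open>An \<open>h\<close>-sum of even length splits into two \<open>H\<close>-sums, over even
  and over odd times. If both starting points are equivalent to \<open>u\<close>, and likewise to
  \<open>v\<close>, then twice the difference of the sums of \<open>u\<close> and \<open>v\<close>
  is bounded.\<close>

lemma bdd_diff_of_shadows:
  assumes sh: "shadows h \<tau> \<eta> x y"
    and x: "\<And>i. \<tau> ((h ^^ (2 * i)) x) = \<Theta> ((H ^^ i) a)" "\<And>i. \<tau> ((h ^^ Suc (2 * i)) x) = \<Theta> ((H ^^ i) b)"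
    and y: "\<And>i. \<tau> ((h ^^ (2 * i)) y) = \<Theta> ((H ^^ i) a')" "\<And>i. \<tau> ((h ^^ Suc (2 * i)) y) = \<Theta> ((H ^^ i) b')"
    and u: "bdd_diff H \<Theta> u a" "bdd_diff H \<Theta> u b" and v: "bdd_diff H \<Theta> v a'" "bdd_diff H \<Theta> v b'"
  shows "bdd_diff H \<Theta> u v"
proof -
  define S where "S w n = (\<Sum>i<n. \<Theta> ((H ^^ i) w))" for w n
  have bd: "bdd_diff H \<Theta> w w' \<longleftrightarrow> (\<exists>B. \<forall>n. \<bar>S w n - S w' n\<bar> \<le> B)" for w w'
    by (simp add: bdd_diff_def S_def sum_subtractf)
  obtain B1 B2 B3 B4 where B: "\<And>n. \<bar>S u n - S a n\<bar> \<le> B1" "\<And>n. \<bar>S u n - S b n\<bar> \<le> B2"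
      "\<And>n. \<bar>S v n - S a' n\<bar> \<le> B3" "\<And>n. \<bar>S v n - S b' n\<bar> \<le> B4"
    using u v unfolding bd by blast
  have "(\<Sum>i<2 * n. \<tau> ((h ^^ i) x) - \<tau> ((h ^^ i) y)) = S a n + S b n - S a' n - S b' n" for n
  proof (induction n)
    case (Suc n)
    have "2 * Suc n = Suc (Suc (2 * n))" by simp
    then have "(\<Sum>i<2 * Suc n. \<tau> ((h ^^ i) x) - \<tau> ((h ^^ i) y)) = (\<Sum>i<2 * n. \<tau> ((h ^^ i) x) - \<tau> ((h ^^ i) y))
        + (\<tau> ((h ^^ (2 * n)) x) - \<tau> ((h ^^ (2 * n)) y)) + (\<tau> ((h ^^ Suc (2 * n)) x) - \<tau> ((h ^^ Suc (2 * n)) y))"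
      by (simp only: sum.lessThan_Suc)
    then show ?case unfolding Suc x y by (simp add: S_def)
  qed (simp add: S_def)
  moreover have "\<bar>\<Sum>i<2 * n. \<tau> ((h ^^ i) x) - \<tau> ((h ^^ i) y)\<bar> < \<eta>" for n
    using sh unfolding shadows_def by blast
  ultimately have eta: "\<bar>S a n + S b n - S a' n - S b' n\<bar> < \<eta>" for n by simp
  have "\<bar>S u n - S v n\<bar> \<le> B1 + B2 + B3 + B4 + \<eta>" for n
    using B(1)[of n] B(2)[of n] B(3)[of n] B(4)[of n] eta[of n] by linarith
  then show ?thesis unfolding bd by blast
qed

lemma cis_eq_imp: "cis a = cis b \<Longrightarrow> \<exists>n::int. a = b + 2 * pi * n"
  using sin_cos_eq_iff[of a b] by (simp add: complex_eq_iff)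

lemma cis_inj: "cis a = cis b \<Longrightarrow> \<bar>a - b\<bar> < 2 * pi \<Longrightarrow> a = b"
proof -
  assume "cis a = cis b" and less: "\<bar>a - b\<bar> < 2 * pi"
  then obtain n :: int where n: "a = b + 2 * pi * n" using cis_eq_imp by blast
  then have "2 * pi * \<bar>real_of_int n\<bar> < 2 * pi * 1" using less by (simp add: abs_mult)
  then have "\<bar>real_of_int n\<bar> < 1" by (subst (asm) mult_less_cancel_left_pos) auto
  then have "n = 0" by linarith
  then show "a = b" using n by simp
qed

lemma cis_shift: "cis (t + 2 * pi) = cis t" "cis (t - 2 * pi) = cis t"
  by (simp_all add: complex_eq_iff cos_diff sin_diff)

text \<open>\<open>F t - t\<close> has opposite signs at 0 and at \<open>F 0\<close>: if
  \<open>0 \<le> F 0\<close>, then \<open>F (F 0) \<le> F 0\<close>, and symmetrically.\<close>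

lemma ex_fixed_point_antimono:
  fixes F :: "real \<Rightarrow> real"
  assumes cont: "continuous_on UNIV F" and anti: "\<And>x y. x \<le> y \<Longrightarrow> F y \<le> F x"
  shows "\<exists>p. F p = p"
proof -
  have c: "continuous_on A (\<lambda>t. F t - t)" for A
    by (intro continuous_intros continuous_on_subset[OF cont]) auto
  have "\<exists>p. F p - p = 0"
  proof (cases "0 \<le> F 0")
    case True
    then have "F (F 0) - F 0 \<le> 0" using anti[of 0 "F 0"] by simp
    then show ?thesis using IVT2'[of "\<lambda>t. F t - t" "F 0" 0 0] True c by auto
  next
    case False
    then have "0 \<le> F (F 0) - F 0" using anti[of "F 0" 0] by simp
    then show ?thesis using IVT2'[of "\<lambda>t. F t - t" 0 0 "F 0"] False c by auto
  qed
  then show ?thesis by auto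
qed

context interval_homeo
begin

text \<open>If \<open>G\<close> moves \<open>t\<close> up, choose \<open>v\<close> between
  \<open>t\<close> and \<open>G t\<close>. One step carries the whole interval from
  \<open>Gi v\<close> to \<open>v\<close> above \<open>v\<close>, and monotone orbits do not come
  back. The other case is symmetric.\<close>

lemma ex_wandering_interval:
  assumes t: "t \<in> {p..q}" "G t \<noteq> t"
  obtains u v where "p \<le> u" "u < t" "t < v" "v \<le> q"
    "\<And>n s. n \<ge> 1 \<Longrightarrow> s \<in> {u<..<v} \<Longrightarrow> (G ^^ n) s \<notin> {u<..<v}"
proof -
  have pq: "p < t" "t < q" using t by (metis Gp Gq atLeastAtMost_iff order_le_less)+
  show ?thesis
  proof (cases "t < G t")
    case True
    obtain v where v: "t < v" "v < min (G t) q" using dense[of t "min (G t) q"] True pq by auto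
    then have u: "Gi v < t" by (metis GiG Gi_less min_less_iff_conj)
    show ?thesis
    proof (rule that[of "max p (Gi v)" v])
      fix n :: nat and s assume n: "n \<ge> 1" and s: "s \<in> {max p (Gi v)<..<v}"
      have "v < G s" using s by (metis GGi G_less greaterThanLessThan_iff max_less_iff_conj)
      then have "s \<le> G s" using s by simp
      then have "G s \<le> (G ^^ n) s" using incseqD[OF Gpow_incseq, of s 1 n] n by simp
      then show "(G ^^ n) s \<notin> {max p (Gi v)<..<v}" using \<open>v < G s\<close> by simp
    qed (use u v pq in auto)
  next
    case False
    then have "G t < t" using t by simp
    obtain u where u: "max (G t) p < u" "u < t" using dense[of "max (G t) p" t] \<open>G t < t\<close> pq by auto
    then have v: "t < Gi u" by (metis GiG Gi_less max_less_iff_conj)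
    show ?thesis
    proof (rule that[of u "min q (Gi u)"])
      fix n :: nat and s assume n: "n \<ge> 1" and s: "s \<in> {u<..<min q (Gi u)}"
      have "G s < u" using s by (metis GGi G_less greaterThanLessThan_iff min_less_iff_conj)
      then have "G s \<le> s" using s by simp
      then have "(G ^^ n) s \<le> G s" using decseqD[OF Gpow_decseq, of s 1 n] n by simp
      then show "(G ^^ n) s \<notin> {u<..<min q (Gi u)}" using \<open>G s < u\<close> by simp
    qed (use u v pq in auto)
  qed
qed

end

section \<open>Lifts of circle reversals, periodic points and wandering components\<close>

locale circle_reversal =
  fixes f g :: "complex \<Rightarrow> complex" and F :: "real \<Rightarrow> real" and p q :: real
  assumes homeo: "homeomorphism unit_circle unit_circle f g"
    and cont_F: "continuous_on UNIV F" and F_less [simp]: "\<And>x y. F x < F y \<longleftrightarrow> y < x"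
    and lift: "\<And>t. f (cis t) = cis (F t)" and F_shift: "\<And>t. F (t + 2 * pi) = F t - 2 * pi"
    and Fp [simp]: "F p = p" and Fq: "F q = q - 2 * pi"

text \<open>The degree is negative since \<open>F\<close> decreases. Degree -2 or less would make
  \<open>F\<close> drop by a full turn strictly inside a period, against injectivity of
  \<open>f\<close>, so it is -1. The points \<open>p\<close> and \<open>q\<close> are fixed points
  of the decreasing maps \<open>F\<close> and \<open>F + 2 * pi\<close>.\<close>

lemma circle_reversalI:
  assumes "orientation_reversing_homeo f"
  obtains g F p q where "circle_reversal f g F p q"
proof -
  obtain g F where homeo: "homeomorphism unit_circle unit_circle f g" and cont: "continuous_on UNIV F"
    and anti: "strict_antimono_on UNIV F" and lift: "\<And>t. f (cis t) = cis (F t)"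
    using assms unfolding orientation_reversing_homeo_def by blast
  have less: "F x < F y" if "y < x" for x y using anti that by (auto simp: monotone_on_def)
  have F_less: "F x < F y \<longleftrightarrow> y < x" for x y using less by (metis linorder_neqE order_less_asym order_less_irrefl)
  have F_le: "F y \<le> F x" if "x \<le> y" for x y using F_less by (metis that linorder_not_le)
  have inj: "cis a = cis b" if "cis (F a) = cis (F b)" for a b
  proof -
    have "f (cis a) = f (cis b)" using that lift by simp
    then have "g (f (cis a)) = g (f (cis b))" by simp
    then show ?thesis using homeo unfolding homeomorphism_def by simp
  qed
  have shift: "F (t + 2 * pi) = F t - 2 * pi" for t
  proof -
    have "cis (F (t + 2 * pi)) = cis (F t)" using lift[of t] lift[of "t + 2 * pi"] by (simp add: cis_shift)
    then obtain n :: int where n: "F (t + 2 * pi) = F t + 2 * pi * n" using cis_eq_imp by blast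
    have "F (t + 2 * pi) < F t" by (simp add: F_less)
    then have "n < 0" using n by (simp add: mult_less_0_iff)
    moreover have "\<not> n \<le> -2"
    proof
      assume "n \<le> -2"
      then have "2 * pi * real_of_int n \<le> 2 * pi * (- 2)" by (intro mult_left_mono) auto
      then have "F (t + 2 * pi) < F t - 2 * pi" using n pi_gt_zero by linarith
      then obtain s where s: "t \<le> s" "s \<le> t + 2 * pi" "F s = F t - 2 * pi"
        using IVT2'[of F "t + 2 * pi" "F t - 2 * pi" t] continuous_on_subset[OF cont] by auto
      have "cis s = cis t" by (rule inj) (simp add: s cis_shift)
      moreover have "s \<noteq> t" "s \<noteq> t + 2 * pi" using s \<open>F (t + 2 * pi) < F t - 2 * pi\<close> by auto
      ultimately show False using cis_inj[of s t] s by auto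
    qed
    ultimately have "n = -1" by linarith
    then show ?thesis using n by simp
  qed
  obtain p where p: "F p = p" using ex_fixed_point_antimono[OF cont F_le] by blast
  have "continuous_on UNIV (\<lambda>t. F t + 2 * pi)" by (intro continuous_intros cont)
  then obtain q where q: "F q + 2 * pi = q" using ex_fixed_point_antimono[of "\<lambda>t. F t + 2 * pi"] F_le by auto
  have "circle_reversal f g F p q"
    by unfold_locales (use homeo cont F_less lift shift p q in auto)
  then show ?thesis by (rule that)
qed

context circle_reversal
begin

text \<open>One turn below \<open>q\<close>: \<open>{r..q}\<close> covers the circle once, and
  \<open>p\<close> cuts it into two arcs that \<open>F\<close> interchanges.\<close>

definition r where "r = q - 2 * pi"
definition G where "G t = F (F t)"
definition Gi where "Gi = inv G"

lemma F_le [simp]: "F x \<le> F y \<longleftrightarrow> y \<le> x"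
  using F_less by (meson linorder_not_le)

lemma F_eq [simp]: "F x = F y \<longleftrightarrow> x = y"
  by (metis F_le order_antisym order_refl)

lemma Fr: "F r = q" and Fq': "F q = r" and cis_r: "cis r = cis q"
  using F_shift[of r] Fq by (simp_all add: r_def cis_shift)

lemma rpq: "r < p" "p < q"
proof -
  have "p < q"
  proof (rule ccontr)
    assume "\<not> p < q"
    then have "F p \<le> F q" by (simp del: Fp)
    then have "p \<le> q - 2 * pi" using Fq by simp
    then show False using \<open>\<not> p < q\<close> pi_gt_zero by linarith
  qed
  moreover have "r < p"
  proof (rule ccontr)
    assume "\<not> r < p"
    then have "F r \<le> F p" by (simp del: Fp)
    then show False using Fr \<open>p < q\<close> by simp
  qed
  ultimately show "r < p" "p < q" by auto
qed

lemma F_Icc: "t \<in> {r..p} \<Longrightarrow> F t \<in> {p..q}" "t \<in> {p..q} \<Longrightarrow> F t \<in> {r..p}"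
    "t \<in> {r..q} \<Longrightarrow> F t \<in> {r..q}"
  using F_le[of p t] F_le[of t r] F_le[of t p] F_le[of q t] by (auto simp: Fr Fq' simp del: F_le)

lemma F_Ioo: "t \<in> {r<..<p} \<Longrightarrow> F t \<in> {p<..<q}" "t \<in> {p<..<q} \<Longrightarrow> F t \<in> {r<..<p}"
  using F_less[of p t] F_less[of t r] F_less[of t p] F_less[of q t] by (auto simp: Fr Fq' simp del: F_less)

lemma G_surj: "surj G"
proof -
  have cont: "continuous_on UNIV G"
    unfolding G_def using continuous_on_compose2[OF cont_F cont_F] by simp
  have shift: "G (t + 2 * pi) = G t + 2 * pi" for t
    using F_shift[of t] F_shift[of "F t - 2 * pi"] by (simp add: G_def)
  have up: "G (2 * pi * real n) = G 0 + 2 * pi * real n" for n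
  proof (induction n)
    case (Suc n)
    have "2 * pi * real (Suc n) = 2 * pi * real n + 2 * pi" by (simp add: algebra_simps)
    then show ?case using shift[of "2 * pi * real n"] Suc by simp
  qed simp
  have down: "G (- (2 * pi * real n)) = G 0 - 2 * pi * real n" for n
  proof (induction n)
    case (Suc n)
    have "- (2 * pi * real n) = - (2 * pi * real (Suc n)) + 2 * pi" by (simp add: algebra_simps)
    then show ?case using shift[of "- (2 * pi * real (Suc n))"] Suc by (simp add: algebra_simps)
  qed simp
  have "\<exists>t. G t = y" for y
  proof -
    obtain n :: nat where "\<bar>y - G 0\<bar> < real n * (2 * pi)" using reals_Archimedean3[of "2 * pi"] by auto
    then have "\<bar>y - G 0\<bar> < 2 * pi * real n" by (simp add: mult.commute)
    then have "G (- (2 * pi * real n)) \<le> y" "y \<le> G (2 * pi * real n)"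
      unfolding up down by linarith+
    then show ?thesis
      using IVT'[of G "- (2 * pi * real n)" y "2 * pi * real n"] continuous_on_subset[OF cont] by auto
  qed
  then show ?thesis by (metis surjI)
qed

lemma G_inj: "inj G"
  by (auto simp: inj_def G_def)

lemma interval_homeo_G:
  assumes "G a = a" "G b = b" shows "interval_homeo G Gi a b"
proof
  show "strict_mono G" by (auto simp: strict_mono_def G_def)
  show "continuous_on UNIV G" unfolding G_def using continuous_on_compose2[OF cont_F cont_F] by simp
  show GGi: "G (Gi x) = x" for x using G_surj by (simp add: Gi_def surj_f_inv_f)
  show GiG: "Gi (G x) = x" for x using G_inj by (simp add: Gi_def)
  have "surj Gi" by (rule surjI[of Gi G]) (rule GiG)
  show "continuous_on UNIV Gi"
  proof (rule continuous_onI_mono)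
    show "open (range Gi)" using \<open>surj Gi\<close> by simp
    fix x y :: real assume "x \<le> y"
    show "Gi x \<le> Gi y"
    proof (rule ccontr)
      assume "\<not> Gi x \<le> Gi y"
      then have "G (Gi y) < G (Gi x)" by (simp add: G_def)
      then show False using \<open>x \<le> y\<close> by (simp add: GGi)
    qed
  qed
qed (use assms in auto)

lemma G_fixed [simp]: "G p = p" "G q = q" "G r = r"
  by (simp_all add: G_def Fr Fq')

sublocale I: interval_homeo G Gi p q
  by (rule interval_homeo_G) auto

sublocale L: interval_homeo G Gi r p
  by (rule interval_homeo_G) auto

sublocale W: interval_homeo G Gi r q
  by (rule interval_homeo_G) auto

sublocale inv: interval_homeo Gi G p q
  by (rule I.inverse_interval_homeo)

lemma circle_cis: "z \<in> unit_circle \<Longrightarrow> \<exists>t\<in>{r..q}. z = cis t"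
proof -
  assume z: "z \<in> unit_circle"
  then have z': "z = cis (Arg z)" by (metis cis_Arg mem_sphere_0 norm_zero sgn_div_norm scaleR_one inverse_1 zero_neq_one)
  define n where "n = \<lfloor>(q - Arg z) / (2 * pi)\<rfloor>"
  define t where "t = Arg z + 2 * pi * real_of_int n"
  have "real_of_int n \<le> (q - Arg z) / (2 * pi)" "(q - Arg z) / (2 * pi) < real_of_int n + 1"
    unfolding n_def by linarith+
  then have "real_of_int n * (2 * pi) \<le> q - Arg z" "q - Arg z < (real_of_int n + 1) * (2 * pi)"
    using pi_gt_zero by (simp_all add: pos_le_divide_eq pos_divide_less_eq)
  then have "t \<in> {r..q}" by (simp add: t_def r_def algebra_simps)
  moreover have "cis t = cis (Arg z)" unfolding t_def by (simp add: cis_mult[symmetric])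
  ultimately show ?thesis using z' by metis
qed

lemma cis_inj_Icc: "s \<in> {r..q} \<Longrightarrow> t \<in> {r..q} \<Longrightarrow> cis s = cis t \<Longrightarrow> s = t \<or> {s, t} = {r, q}"
proof -
  assume *: "s \<in> {r..q}" "t \<in> {r..q}" "cis s = cis t"
  show ?thesis
  proof (cases "\<bar>s - t\<bar> < 2 * pi")
    case True
    then show ?thesis using cis_inj * by blast
  next
    case False
    have "\<bar>s - t\<bar> \<le> 2 * pi" using * by (auto simp: r_def)
    then consider "s - t = 2 * pi" | "t - s = 2 * pi" using False by linarith
    then show ?thesis
    proof cases
      case 1
      then have "s = q" "t = r" using * by (auto simp: r_def)
      then show ?thesis by auto
    next
      case 2
      then have "t = q" "s = r" using * by (auto simp: r_def)
      then show ?thesis by auto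
    qed
  qed
qed

lemma cis_inj_Ioo: "s \<in> {r..q} \<Longrightarrow> t \<in> {r<..<q} \<Longrightarrow> cis s = cis t \<Longrightarrow> s = t"
  using cis_inj_Icc[of s t] by auto

lemma cis_in [simp]: "cis t \<in> unit_circle"
  by simp

lemma fpow_cis: "(f ^^ n) (cis t) = cis ((F ^^ n) t)"
  by (induction n) (simp_all add: lift)

lemma Fpow_double: "(F ^^ (2 * n)) t = (G ^^ n) t" "(F ^^ Suc (2 * n)) t = F ((G ^^ n) t)"
proof -
  show "(F ^^ (2 * n)) t = (G ^^ n) t" by (induction n) (simp_all add: G_def)
  then show "(F ^^ Suc (2 * n)) t = F ((G ^^ n) t)" by simp
qed

lemma fpow_double: "(f ^^ (2 * n)) (cis t) = cis ((G ^^ n) t)" "(f ^^ Suc (2 * n)) (cis t) = cis (F ((G ^^ n) t))"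
  unfolding fpow_cis Fpow_double by simp_all

text \<open>Orbits of an increasing map are monotone, so one that returns is constant. Hence periods
  under \<open>f\<close> divide 2.\<close>

lemma Gpow_eq_imp: "n \<ge> 1 \<Longrightarrow> (G ^^ n) t = t \<Longrightarrow> G t = t"
proof (rule ccontr)
  assume n: "n \<ge> 1" "(G ^^ n) t = t" and "G t \<noteq> t"
  then consider "t < G t" | "G t < t" by linarith
  then show False
  proof cases
    case 1
    then show ?thesis using incseqD[OF I.Gpow_incseq, of t 1 n] n by simp
  next
    case 2
    then show ?thesis using decseqD[OF I.Gpow_decseq, of t 1 n] n by simp
  qed
qed

lemma cis_G_eq_iff: "t \<in> {r..q} \<Longrightarrow> n \<ge> 1 \<Longrightarrow> cis ((G ^^ n) t) = cis t \<longleftrightarrow> G t = t"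
proof
  assume t: "t \<in> {r..q}" "n \<ge> 1" and "cis ((G ^^ n) t) = cis t"
  then have "(G ^^ n) t = t \<or> {(G ^^ n) t, t} = {r, q}" using cis_inj_Icc W.Gpow_in by blast
  then show "G t = t"
  proof
    assume "{(G ^^ n) t, t} = {r, q}"
    then have "t = r \<or> t = q" by blast
    then show ?thesis by auto
  qed (use Gpow_eq_imp t in blast)
qed (simp add: I.Gpow_fixed)

lemma periodic_points_iff:
  assumes t: "t \<in> {r..q}" shows "cis t \<in> periodic_points unit_circle f \<longleftrightarrow> G t = t"
proof
  assume "cis t \<in> periodic_points unit_circle f"
  then obtain n where n: "n \<ge> 1" "(f ^^ n) (cis t) = cis t" unfolding periodic_points_def by blast
  have "(f ^^ (2 * n)) (cis t) = cis t" using n(2) by (simp add: funpow_add mult_2)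
  then have "cis ((G ^^ n) t) = cis t" by (simp add: fpow_double)
  then show "G t = t" using cis_G_eq_iff[OF t n(1)] by blast
next
  assume "G t = t"
  then have "(f ^^ 2) (cis t) = cis t" using fpow_double(1)[of 1 t] by simp
  then show "cis t \<in> periodic_points unit_circle f" unfolding periodic_points_def by (auto intro!: exI[of _ 2])
qed

lemma fixed_points_eq: "fixed_points unit_circle f = {cis p, cis q}"
proof
  show "fixed_points unit_circle f \<subseteq> {cis p, cis q}"
  proof
    fix z assume "z \<in> fixed_points unit_circle f"
    then have "z \<in> unit_circle" "f z = z" by (auto simp: fixed_points_def)
    then obtain t where t: "t \<in> {r..q}" "z = cis t" "cis (F t) = cis t" using circle_cis lift by metis
    have "F t = t \<or> {F t, t} = {r, q}" using cis_inj_Icc F_Icc t by blast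
    then show "z \<in> {cis p, cis q}"
    proof
      assume "F t = t"
      then have "t = p" using F_less[of t p] F_less[of p t] by (metis Fp linorder_neqE order_less_asym)
      then show ?thesis using t by simp
    next
      assume "{F t, t} = {r, q}"
      then have "t = r \<or> t = q" by blast
      then show ?thesis using t cis_r by auto
    qed
  qed
  show "{cis p, cis q} \<subseteq> fixed_points unit_circle f"
    by (auto simp: fixed_points_def lift Fq' cis_r)
qed

text \<open>Odd iterates of \<open>f\<close> carry a neighbourhood inside one open arc into the
  other arc. Even iterates are iterates of \<open>G\<close>, for which
  \<open>ex_wandering_interval\<close> applies.\<close>

lemma wandering_point:
  assumes t: "t \<in> {r..q}" "G t \<noteq> t"
  shows "cis t \<in> wandering_set unit_circle f"
proof -
  have key: "cis t \<in> wandering_set unit_circle f"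
    if ab: "r \<le> a" "b \<le> q" and swap: "\<And>s. s \<in> {a<..<b} \<Longrightarrow> F s \<in> {r..q} - {a<..<b}"
      and I: "interval_homeo G Gi a b" and t: "t \<in> {a..b}" "G t \<noteq> t" for a b t
  proof -
    obtain u v where uv: "a \<le> u" "u < t" "t < v" "v \<le> b"
      and disj: "\<And>n s. n \<ge> 1 \<Longrightarrow> s \<in> {u<..<v} \<Longrightarrow> (G ^^ n) s \<notin> {u<..<v}"
      using interval_homeo.ex_wandering_interval[OF I t] by metis
    define U where "U = cis ` {u<..<v}"
    have sub: "{u<..<v} \<subseteq> {r<..<q}" using uv ab by auto
    have "closed (cis ` ({r..q} - {u<..<v}))"
      by (intro compact_imp_closed compact_continuous_image continuous_intros compact_diff) auto
    moreover have "U = unit_circle - cis ` ({r..q} - {u<..<v})"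
    proof
      show "U \<subseteq> unit_circle - cis ` ({r..q} - {u<..<v})"
        using sub cis_inj_Ioo unfolding U_def by fastforce
      show "unit_circle - cis ` ({r..q} - {u<..<v}) \<subseteq> U"
        using circle_cis unfolding U_def by blast
    qed
    ultimately have "openin (top_of_set unit_circle) U"
      by (metis Diff_Int_distrib2 Diff_eq openin_open_Int open_Compl)
    moreover have "cis t \<in> U" using uv by (auto simp: U_def)
    moreover have "(f ^^ n) ` U \<inter> U = {}" if n: "n \<ge> 1" for n
    proof (rule ccontr)
      assume "\<not> ?thesis"
      then obtain s s' where s: "s \<in> {u<..<v}" "s' \<in> {u<..<v}" "(f ^^ n) (cis s) = cis s'"
        unfolding U_def by blast
      have s': "s' \<in> {r<..<q}" and srq: "s \<in> {r..q}" and sab: "s \<in> {a..b}" "s \<in> {a<..<b}" using s sub uv by auto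
      show False
      proof (cases "even n")
        case True
        then obtain k where k: "n = 2 * k" "k \<ge> 1" using n by (auto elim!: evenE)
        have "(G ^^ k) s = s'"
          using cis_inj_Ioo[OF W.Gpow_in[OF srq] s'] s(3) by (simp add: k fpow_double)
        then show False using disj[OF k(2) s(1)] s(2) by simp
      next
        case False
        then obtain k where k: "n = Suc (2 * k)" using oddE by (metis Suc_eq_plus1)
        define w where "w = (G ^^ k) s"
        have w: "w \<in> {a<..<b}"
          using interval_homeo.Gpow_fixed_less[OF I] interval_homeo.Gp[OF I] interval_homeo.Gq[OF I] sab
          by (simp add: w_def)
        have "F w = s'"
          using cis_inj_Ioo[OF _ s', of "F w"] swap[OF w] s(3) unfolding k fpow_double w_def[symmetric] by blast
        then show False using swap[OF w] s(2) uv by auto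
      qed
    qed
    ultimately have "cis t \<notin> nonwandering_set unit_circle f"
      unfolding nonwandering_set_def by blast
    then show ?thesis by (simp add: wandering_set_def)
  qed
  show ?thesis
  proof (cases "t \<le> p")
    case True
    show ?thesis
      by (rule key[of r p t]) (use True t rpq F_Ioo(1) in \<open>auto intro: L.interval_homeo_axioms\<close>, fastforce+)
  next
    case False
    show ?thesis
      by (rule key[of p q t]) (use False t rpq F_Ioo(2) in \<open>auto intro: I.interval_homeo_axioms\<close>, fastforce+)
  qed
qed

lemma wandering_iff: "t \<in> {r..q} \<Longrightarrow> cis t \<in> wandering_set unit_circle f \<longleftrightarrow> G t \<noteq> t"
proof
  assume t: "t \<in> {r..q}" and w: "cis t \<in> wandering_set unit_circle f"
  show "G t \<noteq> t"
  proof
    assume "G t = t"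
    then obtain n where n: "n \<ge> 1" "(f ^^ n) (cis t) = cis t"
      using periodic_points_iff[OF t] unfolding periodic_points_def by blast
    have "cis t \<in> nonwandering_set unit_circle f"
      unfolding nonwandering_set_def using n by (auto intro!: exI[of _ n])
    then show False using w by (simp add: wandering_set_def)
  qed
qed (rule wandering_point)

lemma same_component:
  assumes "s \<in> {r<..<q}" "t \<in> {r<..<q}" "\<And>e. e \<in> closed_segment s t \<Longrightarrow> G e \<noteq> e"
    and W: "W \<in> components (wandering_set unit_circle f)" "W' \<in> components (wandering_set unit_circle f)"
    and "cis s \<in> W" "cis t \<in> W'"
  shows "W = W'"
proof -
  have "closed_segment s t \<subseteq> {r..q}" using assms(1,2) by (auto simp: closed_segment_eq_real_ivl split: if_splits)
  then have sub: "cis ` closed_segment s t \<subseteq> wandering_set unit_circle f"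
    using wandering_iff assms(3) by blast
  have "connected (cis ` closed_segment s t)"
    by (intro connected_continuous_image continuous_intros) auto
  moreover have "W \<inter> cis ` closed_segment s t \<noteq> {}" using assms by auto
  ultimately have "cis ` closed_segment s t \<subseteq> W" using components_maximal[OF W(1) _ sub] by blast
  then have "cis t \<in> W \<inter> W'" using assms by auto
  then show ?thesis using components_eq[OF W] by blast
qed

text \<open>Cutting the circle at \<open>cis p\<close> and \<open>cis e\<close> gives two closed
  arcs that meet only in nonwandering points. The arc \<open>B\<close> has two pieces in the lift
  because it passes through \<open>cis q = cis r\<close>.\<close>

lemma fixed_separates_components:
  assumes c: "c \<in> {p<..<q}" "x \<in> {p<..<q}" "e \<in> closed_segment c x" "G e = e"
    and W: "W \<in> components (wandering_set unit_circle f)" "cis c \<in> W" "cis x \<in> W"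
  shows False
proof -
  have e: "e \<in> {p<..<q}" using c by (auto simp: closed_segment_eq_real_ivl split: if_splits)
  define A where "A = cis ` {p..e}"
  define B where "B = cis ` ({e..q} \<union> {r..p})"
  have "closed A" "closed B"
    unfolding A_def B_def by (intro compact_imp_closed compact_continuous_image continuous_intros compact_Un; simp)+
  moreover have "connected W" using in_components_connected W by blast
  moreover have sub: "W \<subseteq> wandering_set unit_circle f" using in_components_subset W by blast
  moreover have "W \<subseteq> A \<union> B"
  proof
    fix z assume "z \<in> W"
    then have "z \<in> unit_circle" using sub by (auto simp: wandering_set_def)
    then obtain t where "t \<in> {r..q}" "z = cis t" using circle_cis by blast
    then show "z \<in> A \<union> B" unfolding A_def B_def by (cases "t \<le> p"; cases "t \<le> e") auto
  qed
  moreover have "A \<inter> B \<inter> W = {}"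
  proof (rule ccontr)
    assume "A \<inter> B \<inter> W \<noteq> {}"
    then obtain s t where st: "s \<in> {p..e}" "t \<in> {e..q} \<union> {r..p}" "cis s = cis t" "cis s \<in> W"
      unfolding A_def B_def by fastforce
    have "s \<in> {r<..<q}" "t \<in> {r..q}" using st e rpq by auto
    then have "t = s" using cis_inj_Ioo[of t s] st by simp
    then have "s = e \<or> s = p" using st by auto
    then have "G s = s" using c by auto
    then show False using wandering_iff[of s] sub st \<open>s \<in> {r<..<q}\<close> by auto
  qed
  moreover have "A \<inter> W \<noteq> {} \<and> B \<inter> W \<noteq> {}"
  proof (cases "c \<le> x")
    case True
    then have "c \<le> e" "e \<le> x" using c by (auto simp: closed_segment_eq_real_ivl)
    then have "cis c \<in> A" "cis x \<in> B" unfolding A_def B_def using c by auto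
    then show ?thesis using W by blast
  next
    case False
    then have "x \<le> e" "e \<le> c" using c by (auto simp: closed_segment_eq_real_ivl)
    then have "cis x \<in> A" "cis c \<in> B" unfolding A_def B_def using c by auto
    then show ?thesis using W by blast
  qed
  ultimately show False unfolding connected_closed by blast
qed

lemma g_f: "z \<in> unit_circle \<Longrightarrow> g (f z) = z" and f_g: "z \<in> unit_circle \<Longrightarrow> f (g z) = z"
  and g_in: "z \<in> unit_circle \<Longrightarrow> g z \<in> unit_circle" and f_in: "z \<in> unit_circle \<Longrightarrow> f z \<in> unit_circle"
  and cont_f: "continuous_on unit_circle f" and cont_g: "continuous_on unit_circle g"
  using homeo unfolding homeomorphism_def by blast+

lemma g_lift: "g (cis (F t)) = cis t" "g (cis t) = cis (F (Gi t))"
proof -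
  show *: "g (cis (F t)) = cis t" for t using g_f[of "cis t"] lift[of t] by simp
  have "F (F (Gi t)) = t" using I.GGi[of t] by (simp add: G_def)
  then show "g (cis t) = cis (F (Gi t))" using *[of "F (Gi t)"] by simp
qed

section \<open>Necessity of the three conditions\<close>

lemma fixed_points_isolated:
  assumes cont_T: "continuous_on unit_circle T" and \<eta>: "\<eta> > 0"
    and sep: "\<And>x y. x \<in> unit_circle \<Longrightarrow> y \<in> unit_circle \<Longrightarrow> shadows f T \<eta> x y \<Longrightarrow> shadows g (T \<circ> g) \<eta> x y \<Longrightarrow> x = y"
    and z0: "z0 \<in> fixed_points unit_circle f"
  shows "\<not> z0 islimpt periodic_points unit_circle f"
proof
  assume lim: "z0 islimpt periodic_points unit_circle f"
  have z0': "z0 \<in> unit_circle" "f z0 = z0" using z0 by (auto simp: fixed_points_def)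
  have "uniformly_continuous_on unit_circle T" by (rule compact_uniformly_continuous[OF cont_T]) simp
  then obtain a where a: "a > 0" "\<And>x y. x \<in> unit_circle \<Longrightarrow> y \<in> unit_circle \<Longrightarrow> dist y x < a \<Longrightarrow> dist (T y) (T x) < \<eta>"
    unfolding uniformly_continuous_on_def using \<eta> by blast
  define e where "e = min a \<eta> / 2"
  have e: "e > 0" "2 * e \<le> a" "2 * e \<le> \<eta>" using a \<eta> by (auto simp: e_def)
  obtain b where b: "b > 0" "\<And>x. x \<in> unit_circle \<Longrightarrow> dist x z0 < b \<Longrightarrow> dist (f x) (f z0) < e"
    using cont_f z0' e unfolding continuous_on_iff by blast
  \<comment> \<open>Removing the two fixed points does not destroy accumulation and leaves only
    points of least period 2.\<close>
  have "z0 islimpt ({cis p, cis q} \<union> (periodic_points unit_circle f - {cis p, cis q}))"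
    by (rule islimpt_subset[OF lim]) blast
  then have "z0 islimpt (periodic_points unit_circle f - {cis p, cis q})"
    using islimpt_Un_finite[of "{cis p, cis q}" z0] by blast
  then obtain z where z: "z \<in> periodic_points unit_circle f" "z \<notin> {cis p, cis q}" "dist z z0 < min b e"
    unfolding islimpt_approachable using b e by (metis DiffE min_less_iff_conj)
  have zc: "z \<in> unit_circle" using z by (simp add: periodic_points_def)
  then obtain t where t: "t \<in> {r..q}" "z = cis t" using circle_cis by blast
  then have "G t = t" using z periodic_points_iff by blast
  then have ffz: "f (f z) = z" by (simp add: t lift G_def)
  define w where "w = f z"
  have w: "w \<in> unit_circle" "f w = z" "f z = w" "g z = w" "g w = z"
    using f_in[OF zc] ffz g_f[OF zc] g_f[OF f_in[OF zc]] by (auto simp: w_def)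
  have "dist (f z) z0 < e" using b(2)[OF zc] z z0' by simp
  then have d: "dist z w < 2 * e" unfolding w_def using z dist_triangle2[of z "f z" z0] by simp
  \<comment> \<open>Both orbits alternate between \<open>z\<close> and \<open>w\<close> in opposite
    phase, so the partial sums of differences alternate between 0 and a single term.\<close>
  have main: "shadows h \<tau> \<eta> z w" if h: "h z = w" "h w = z" and \<tau>: "\<bar>\<tau> z - \<tau> w\<bar> < \<eta>" for h \<tau>
  proof -
    have it: "(h ^^ n) z = (if even n then z else w) \<and> (h ^^ n) w = (if even n then w else z)" for n
      by (induction n) (use h in auto)
    have "(\<Sum>i<n. \<tau> ((h ^^ i) z) - \<tau> ((h ^^ i) w)) = (if even n then 0 else \<tau> z - \<tau> w)" for n
      by (induction n) (simp_all add: it)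
    then show ?thesis using it d e \<tau> \<eta> by (auto simp: shadows_def dist_commute)
  qed
  have "\<bar>T z - T w\<bar> < \<eta>" using a(2)[OF w(1) zc] d e by (simp add: dist_real_def)
  then have "shadows f T \<eta> z w" "shadows g (T \<circ> g) \<eta> z w"
    using main[of f T] main[of g "T \<circ> g"] w by (auto simp: abs_minus_commute)
  then have "z = w" using sep[OF zc w(1)] by blast
  then have "z \<in> fixed_points unit_circle f" using zc by (simp add: fixed_points_def w_def)
  then show False using z(2) fixed_points_eq by simp
qed

text \<open>Points that do not wander are periodic here. Were there no others, the fixed point
  \<open>cis p\<close> would be accumulated by periodic points, since the circle has no isolated
  points.\<close>

lemma wandering_nonempty:
  assumes "\<And>z0. z0 \<in> fixed_points unit_circle f \<Longrightarrow> \<not> z0 islimpt periodic_points unit_circle f"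
  shows "wandering_set unit_circle f \<noteq> {}"
proof
  assume empty: "wandering_set unit_circle f = {}"
  have "unit_circle \<subseteq> periodic_points unit_circle f"
    using circle_cis wandering_iff periodic_points_iff empty by (metis empty_iff subsetI)
  moreover have "cis p islimpt unit_circle"
  proof -
    have "connected unit_circle" by (rule connected_sphere) simp
    moreover have "cis p \<noteq> cis q" using cis_inj_Ioo[of q p] rpq by auto
    then have "unit_circle \<noteq> {a}" for a by (metis cis_in singletonD)
    ultimately show ?thesis using connected_imp_perfect[of unit_circle "cis p"] by simp
  qed
  ultimately have "cis p islimpt periodic_points unit_circle f" using islimpt_subset by blast
  then show False using assms fixed_points_eq by simp
qed

text \<open>The sum telescopes with lag 2 and leaves two initial and two final terms. Pairing them
  by parity costs \<open>\<eta> / 2\<close> per pair.\<close>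

lemma even_odd_sums:
  fixes t :: "nat \<Rightarrow> real"
  assumes "\<And>i j. even (i + j) \<Longrightarrow> \<bar>t i - t j\<bar> < \<eta> / 2"
  shows "\<bar>\<Sum>i<n. t i - t (i + 2)\<bar> < \<eta>"
proof -
  have "(\<Sum>i<n. t i - t (i + 2)) = t 0 + t 1 - t n - t (Suc n)"
    by (induction n) simp_all
  moreover have "\<bar>t 0 + t 1 - t n - t (Suc n)\<bar> < \<eta>"
  proof (cases "even n")
    case True
    then have "\<bar>t 0 - t n\<bar> < \<eta> / 2" "\<bar>t 1 - t (Suc n)\<bar> < \<eta> / 2" by (intro assms, simp)+
    then show ?thesis by linarith
  next
    case False
    then have "\<bar>t 1 - t n\<bar> < \<eta> / 2" "\<bar>t 0 - t (Suc n)\<bar> < \<eta> / 2" by (intro assms, simp)+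
    then show ?thesis by linarith
  qed
  ultimately show ?thesis by simp
qed

lemma finite_components_wandering:
  assumes cont_T: "continuous_on unit_circle T" and \<eta>: "\<eta> > 0"
    and sep: "\<And>x y. x \<in> unit_circle \<Longrightarrow> y \<in> unit_circle \<Longrightarrow> shadows f T \<eta> x y \<Longrightarrow> shadows g (T \<circ> g) \<eta> x y \<Longrightarrow> x = y"
  shows "finite (components (wandering_set unit_circle f))"
proof (rule ccontr)
  let ?K = "components (wandering_set unit_circle f)"
  assume inf: "infinite ?K"
  have ex: "\<exists>t. t \<in> {r<..<q} \<and> cis t \<in> W" if W: "W \<in> ?K" for W
  proof -
    obtain z where z: "z \<in> W" "z \<in> wandering_set unit_circle f"
      using in_components_nonempty[OF W] in_components_subset[OF W] by blast
    then have "z \<in> unit_circle" by (simp add: wandering_set_def)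
    then obtain t where t: "t \<in> {r..q}" "z = cis t" using circle_cis by blast
    then have "G t \<noteq> t" using z wandering_iff by blast
    then have "t \<noteq> r" "t \<noteq> q" by auto
    then show ?thesis using t z by (intro exI[of _ t]) auto
  qed
  define pt where "pt W = (SOME t. t \<in> {r<..<q} \<and> cis t \<in> W)" for W
  have pt: "pt W \<in> {r<..<q}" "cis (pt W) \<in> W" if "W \<in> ?K" for W
    using someI_ex[OF ex[OF that]] by (auto simp: pt_def)
  have between: "\<exists>e\<in>closed_segment (pt W) (pt W'). G e = e" if "W \<in> ?K" "W' \<in> ?K" "W \<noteq> W'" for W W'
    using same_component[OF pt(1)[OF that(1)] pt(1)[OF that(2)] _ that(1,2) pt(2)[OF that(1)] pt(2)[OF that(2)]] that(3)
    by blast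
  have nf: "G (pt W) \<noteq> pt W" if "W \<in> ?K" for W
    using pt[OF that] in_components_subset[OF that] wandering_iff[of "pt W"] by auto
  have inj: "inj_on pt ?K"
  proof (rule inj_onI, rule ccontr)
    fix W W' assume W: "W \<in> ?K" "W' \<in> ?K" "pt W = pt W'" "W \<noteq> W'"
    then show False using between[OF W(1,2,4)] nf[OF W(1)] by simp
  qed
  define A where "A = pt ` ?K"
  have A: "infinite A" "A \<subseteq> {r..q}" using inf inj pt unfolding A_def by (auto simp: finite_image_iff) fastforce+
  have sepA: "\<exists>e. s < e \<and> e < t \<and> G e = e" if st: "s \<in> A" "t \<in> A" "s < t" for s t
  proof -
    obtain W W' where W: "W \<in> ?K" "W' \<in> ?K" "s = pt W" "t = pt W'" using st unfolding A_def by blast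
    then obtain e where "e \<in> closed_segment s t" "G e = e" using between[of W W'] st by blast
    moreover have "G s \<noteq> s" "G t \<noteq> t" using W nf by auto
    ultimately show ?thesis using st(3)
      by (intro exI[of _ e]) (auto simp: closed_segment_eq_real_ivl order_less_le)
  qed
  have "uniformly_continuous_on unit_circle T" by (rule compact_uniformly_continuous[OF cont_T]) simp
  then obtain a where a: "a > 0" "\<And>x y. x \<in> unit_circle \<Longrightarrow> y \<in> unit_circle \<Longrightarrow> dist y x < a \<Longrightarrow> dist (T y) (T x) < \<eta> / 2"
    unfolding uniformly_continuous_on_def using half_gt_zero[OF \<eta>] by blast
  define e where "e = min a \<eta>"
  have e: "e > 0" "e \<le> a" "e \<le> \<eta>" using a \<eta> by (auto simp: e_def)
  have "uniformly_continuous_on {r..q} cis" "uniformly_continuous_on {r..q} (\<lambda>t. cis (F t))"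
    by (intro compact_uniformly_continuous continuous_intros continuous_on_subset[OF cont_F]; simp)+
  then have "\<exists>d>0. \<forall>x\<in>{r..q}. \<forall>y\<in>{r..q}. dist y x < d \<longrightarrow> dist (cis y) (cis x) < e"
      "\<exists>d>0. \<forall>x\<in>{r..q}. \<forall>y\<in>{r..q}. dist y x < d \<longrightarrow> dist (cis (F y)) (cis (F x)) < e"
    unfolding uniformly_continuous_on_def using e(1) by blast+
  then obtain b1 b2 where b1: "b1 > 0" "\<And>x y. x \<in> {r..q} \<Longrightarrow> y \<in> {r..q} \<Longrightarrow> dist y x < b1 \<Longrightarrow> dist (cis y) (cis x) < e"
    and b2: "b2 > 0" "\<And>x y. x \<in> {r..q} \<Longrightarrow> y \<in> {r..q} \<Longrightarrow> dist y x < b2 \<Longrightarrow> dist (cis (F y)) (cis (F x)) < e"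
    by blast
  define b where "b = min b1 b2"
  have "b > 0" using b1 b2 by (simp add: b_def)
  have "\<exists>L. L islimpt A" using A compact_eq_Bolzano_Weierstrass[of "{r..q}"] by auto
  then obtain L where "infinite (A \<inter> ball L (b / 2))"
    using \<open>b > 0\<close> unfolding islimpt_eq_infinite_ball by (meson half_gt_zero)
  \<comment> \<open>Three marked points closer than \<open>b\<close> suffice: fixed points
    \<open>e1\<close> and \<open>e2\<close> of \<open>G\<close> lie on either side of the middle
    one, \<open>u\<close>, and trap its \<open>G\<close>-orbit in an interval shorter than
    \<open>b\<close>.\<close>
  then obtain B where B: "finite B" "card B = 3" "B \<subseteq> A \<inter> ball L (b / 2)"
    using infinite_arbitrarily_large by blast
  have "B \<noteq> {}" using B by auto
  define s1 where "s1 = Min B"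
  define s3 where "s3 = Max B"
  have s: "s1 \<in> B" "s3 \<in> B" using B \<open>B \<noteq> {}\<close> by (auto simp: s1_def s3_def)
  have "card {s1, s3} < card B" using B(2) card_insert_le_m1[of 2 "{s3}" s1] by simp
  then have "\<not> B \<subseteq> {s1, s3}" by (meson card_mono finite.intros leD)
  then obtain u where u: "u \<in> B" "u \<noteq> s1" "u \<noteq> s3" by blast
  then have lt: "s1 < u" "u < s3" using B(1) by (auto simp: s1_def s3_def order_less_le)
  obtain e1 where e1: "s1 < e1" "e1 < u" "G e1 = e1" using sepA[of s1 u] s u lt B by blast
  obtain e2 where e2: "u < e2" "e2 < s3" "G e2 = e2" using sepA[of u s3] s u lt B by blast
  have "dist L s1 < b / 2" "dist L s3 < b / 2" using s B(3) by auto
  then have "\<bar>s3 - s1\<bar> < b" unfolding dist_real_def by linarith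
  have s_in: "s1 \<in> {r..q}" "s3 \<in> {r..q}" using s B(3) A(2) by blast+
  have E: "t \<in> {r..q}" if "t \<in> {e1<..<e2}" for t
    using that e1 e2 s_in by auto
  \<comment> \<open>Both \<open>f\<close> and \<open>g\<close> map \<open>P k\<close> into
    \<open>P (Suc k)\<close>: the small interval between \<open>e1\<close> and \<open>e2\<close> is
    \<open>G\<close>-invariant, and its image under \<open>F\<close> is visited at odd times. Points
    at times of equal parity are therefore always closer than \<open>e\<close>.\<close>
  define P where "P k = (if even k then cis ` {e1<..<e2} else (\<lambda>t. cis (F t)) ` {e1<..<e2})" for k :: nat
  have P_circle: "z \<in> unit_circle" if "z \<in> P k" for z k
    using that by (auto simp: P_def split: if_splits)
  have P_close: "dist z w < e" if zw: "z \<in> P i" "w \<in> P j" "even (i + j)" for z w i j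
  proof -
    have ds: "dist s t < b" if "s \<in> {e1<..<e2}" "t \<in> {e1<..<e2}" for s t
      using that e1 e2 \<open>\<bar>s3 - s1\<bar> < b\<close> by (auto simp: dist_real_def)
    show ?thesis
    proof (cases "even i")
      case True
      then obtain s t where "s \<in> {e1<..<e2}" "t \<in> {e1<..<e2}" "z = cis s" "w = cis t"
        using zw by (auto simp: P_def)
      then show ?thesis using b1(2)[of t s] E ds[of s t] by (simp add: b_def)
    next
      case False
      then obtain s t where "s \<in> {e1<..<e2}" "t \<in> {e1<..<e2}" "z = cis (F s)" "w = cis (F t)"
        using zw by (auto simp: P_def)
      then show ?thesis using b2(2)[of t s] E ds[of s t] by (simp add: b_def)
    qed
  qed
  have P_T: "\<bar>T z - T w\<bar> < \<eta> / 2" if "z \<in> P i" "w \<in> P j" "even (i + j)" for z w i j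
    using a(2)[OF P_circle[OF that(2)] P_circle[OF that(1)]] P_close[OF that] e by (simp add: dist_real_def)
  have stepG: "G t \<in> {e1<..<e2}" "Gi t \<in> {e1<..<e2}" if "t \<in> {e1<..<e2}" for t
  proof -
    have "Gi e1 = e1" "Gi e2 = e2" using e1 e2 by (simp_all add: I.Gi_fixed_iff)
    then show "G t \<in> {e1<..<e2}" "Gi t \<in> {e1<..<e2}"
      using that e1 e2 I.G_less[of e1 t] I.G_less[of t e2] I.Gi_less[of e1 t] I.Gi_less[of t e2] by auto
  qed
  have stepf: "f z \<in> P (Suc k)" if "z \<in> P k" for z k
    using that stepG by (auto simp: P_def lift G_def split: if_splits)
  have stepg: "g z \<in> P (Suc k)" if z: "z \<in> P k" for z k
  proof (cases "even k")
    case True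
    then show ?thesis using z stepG by (auto simp: P_def g_lift(2))
  next
    case False
    then show ?thesis using z by (auto simp: P_def g_lift(1))
  qed
  have itf: "(f ^^ n) z \<in> P n" if "z \<in> P 0" for z n
    by (induction n) (use that stepf in auto)
  have itg: "(g ^^ n) z \<in> P n" if "z \<in> P 0" for z n
    by (induction n) (use that stepg in auto)
  define x where "x = cis u"
  define y where "y = f (f x)"
  have x: "x \<in> P 0" using e1 e2 by (auto simp: P_def x_def)
  have y: "y \<in> P 0" using stepf[OF stepf[OF x]] by (simp add: y_def P_def)
  have x': "x = g (g y)" using g_f f_in P_circle[OF x] by (simp add: y_def)
  have "shadows f T \<eta> x y"
  proof -
    have "(f ^^ i) y = (f ^^ (i + 2)) x" for i by (simp add: y_def funpow_add numeral_2_eq_2 funpow_swap1)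
    then have "(\<Sum>i<n. T ((f ^^ i) x) - T ((f ^^ i) y)) = (\<Sum>i<n. T ((f ^^ i) x) - T ((f ^^ (i + 2)) x))" for n
      by simp
    moreover have "\<bar>\<Sum>i<n. T ((f ^^ i) x) - T ((f ^^ (i + 2)) x)\<bar> < \<eta>" for n
      by (rule even_odd_sums) (use P_T itf[OF x] in blast)
    moreover have "dist ((f ^^ n) x) ((f ^^ n) y) < \<eta>" for n
      using P_close[OF itf[OF x, of n] itf[OF y, of n]] e by simp
    ultimately show ?thesis by (simp add: shadows_def)
  qed
  \<comment> \<open>Backwards the roles are exchanged: \<open>y\<close> is the starting point and
    \<open>x = g (g y)\<close>, so the same telescoping with lag 2 applies.\<close>
  moreover have "shadows g (T \<circ> g) \<eta> y x"
  proof -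
    have "(g ^^ i) x = (g ^^ (i + 2)) y" for i by (simp add: x' funpow_add numeral_2_eq_2 funpow_swap1)
    then have "(\<Sum>i<n. (T \<circ> g) ((g ^^ i) y) - (T \<circ> g) ((g ^^ i) x)) =
        (\<Sum>i<n. T ((g ^^ Suc i) y) - T ((g ^^ Suc (i + 2)) y))" for n
      by simp
    moreover have "\<bar>\<Sum>i<n. T ((g ^^ Suc i) y) - T ((g ^^ Suc (i + 2)) y)\<bar> < \<eta>" for n
      by (rule even_odd_sums[where t = "\<lambda>i. T ((g ^^ Suc i) y)"])
        (rule P_T[OF itg[OF y] itg[OF y]], simp)
    moreover have "dist ((g ^^ n) y) ((g ^^ n) x) < \<eta>" for n
      using P_close[OF itg[OF y, of n] itg[OF x, of n]] e by simp
    ultimately show ?thesis unfolding shadows_def by presburger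
  qed
  ultimately have "x = y" using sep[OF P_circle[OF x] P_circle[OF y]] shadows_sym by blast
  then have "cis ((G ^^ 1) u) = cis u" by (simp add: x_def y_def lift G_def)
  then have "G u = u" using cis_G_eq_iff[of u 1] E[of u] e1 e2 by simp
  moreover have "u \<in> A" using u B by blast
  ultimately show False using nf unfolding A_def by blast
qed

lemma kinematic_expansive_imp:
  assumes "admits_kinematic_expansive_suspension unit_circle f"
  shows "wandering_set unit_circle f \<noteq> {}"
    "\<forall>z \<in> fixed_points unit_circle f. \<not> z islimpt periodic_points unit_circle f"
    "finite (components (wandering_set unit_circle f))"
proof -
  obtain T \<phi> where T: "continuous_on unit_circle T" "\<forall>x\<in>unit_circle. 0 < T x"
    and \<phi>: "suspension_flow unit_circle f T \<phi>" "kinematic_expansive (suspension_space unit_circle f T) \<phi>"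
    using assms unfolding admits_kinematic_expansive_suspension_def by blast
  interpret suspended_homeo unit_circle f g T
    by unfold_locales (use homeo T in auto)
  obtain \<eta> where \<eta>: "\<eta> > 0" and sep: "\<And>x y. x \<in> unit_circle \<Longrightarrow> y \<in> unit_circle \<Longrightarrow>
      shadows f T \<eta> x y \<Longrightarrow> shadows g (T \<circ> g) \<eta> x y \<Longrightarrow> x = y"
    using \<phi> kinematic_expansive_suspension_iff by blast
  show *: "\<forall>z \<in> fixed_points unit_circle f. \<not> z islimpt periodic_points unit_circle f"
    using fixed_points_isolated[OF T(1) \<eta> sep] by blast
  then show "wandering_set unit_circle f \<noteq> {}" using wandering_nonempty by blast
  show "finite (components (wandering_set unit_circle f))"
    by (rule finite_components_wandering[OF T(1) \<eta> sep])
qed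

section \<open>Sufficiency: folding the circle and separating its points\<close>

lemma ex_marking:
  assumes "finite (components (wandering_set unit_circle f))"
  shows "\<exists>C. marked_interval_homeo G Gi p q C"
proof -
  \<comment> \<open>Only components meeting the open right arc are marked, since the folding carries
    the left arc onto the right one.\<close>
  let ?K = "{W \<in> components (wandering_set unit_circle f). \<exists>c\<in>{p<..<q}. cis c \<in> W}"
  define pt where "pt W = (SOME c. c \<in> {p<..<q} \<and> cis c \<in> W)" for W
  have pt: "pt W \<in> {p<..<q}" "cis (pt W) \<in> W" if W: "W \<in> ?K" for W
  proof -
    have "\<exists>c. c \<in> {p<..<q} \<and> cis c \<in> W" using W by blast
    from someI_ex[OF this] show "pt W \<in> {p<..<q}" "cis (pt W) \<in> W" by (auto simp: pt_def)
  qed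
  have sub: "t \<in> {r<..<q} \<and> t \<in> {r..q}" if "t \<in> {p<..<q}" for t
    using that rpq by auto
  have "marked_interval_homeo G Gi p q (pt ` ?K)"
  proof
    show "finite (pt ` ?K)" using assms by simp
    fix c assume "c \<in> pt ` ?K"
    then obtain W where W: "W \<in> ?K" "c = pt W" by blast
    then show "c \<in> {p..q}" using pt(1)[OF W(1)] by simp
    have "cis c \<in> wandering_set unit_circle f"
      using pt(2)[OF W(1)] in_components_subset[of W] W by auto
    then show "G c \<noteq> c" using wandering_iff sub pt(1)[OF W(1)] W by blast
  next
    fix c c' assume "c \<in> pt ` ?K" "c' \<in> pt ` ?K" and ne: "c \<noteq> c'"
    then obtain W W' where W: "W \<in> ?K" "c = pt W" "W' \<in> ?K" "c' = pt W'" by blast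
    show "\<exists>e\<in>closed_segment c c'. G e = e"
    proof (rule ccontr)
      assume "\<not> ?thesis"
      then have nf: "\<And>e. e \<in> closed_segment c c' \<Longrightarrow> G e \<noteq> e" by blast
      have "W = W'"
        by (rule same_component[OF _ _ nf]) (use W pt sub in auto)
      then show False using W ne by simp
    qed
  next
    fix x assume x: "x \<in> {p..q}" "G x \<noteq> x"
    then have xi: "x \<in> {p<..<q}" by (metis G_fixed(1,2) atLeastAtMost_iff greaterThanLessThan_iff order_le_less)
    then have "cis x \<in> wandering_set unit_circle f" using wandering_iff x sub by blast
    then obtain W where W: "W \<in> components (wandering_set unit_circle f)" "cis x \<in> W"
      using Union_components[of "wandering_set unit_circle f"] by blast
    then have WK: "W \<in> ?K" using xi by blast
    have "G e \<noteq> e" if "e \<in> closed_segment (pt W) x" for e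
      using fixed_separates_components[OF pt(1)[OF WK] xi that _ W(1) pt(2)[OF WK] W(2)] by blast
    then show "\<exists>c\<in>pt ` ?K. \<forall>e\<in>closed_segment c x. G e \<noteq> e" using WK by blast
  qed
  then show ?thesis by blast
qed

text \<open>Folds the left arc onto the right one; no choice is involved at \<open>cis r = cis q\<close>, since \<open>F r = q\<close>.\<close>

definition \<rho> :: "complex \<Rightarrow> real" where
  "\<rho> z = (let t = SOME t. t \<in> {r..q} \<and> z = cis t in if t \<le> p then F t else t)"

lemma \<rho>_cis: assumes "t \<in> {r..q}" shows "\<rho> (cis t) = (if t \<le> p then F t else t)"
proof -
  define s where "s = (SOME s. s \<in> {r..q} \<and> cis t = cis s)"
  have s: "s \<in> {r..q}" "cis t = cis s"
    using someI[of "\<lambda>s. s \<in> {r..q} \<and> cis t = cis s" t] assms by (auto simp: s_def)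
  have \<rho>: "\<rho> (cis t) = (if s \<le> p then F s else s)" by (simp add: \<rho>_def s_def Let_def)
  have "t = s \<or> {t, s} = {r, q}" using cis_inj_Icc assms s by blast
  then show ?thesis
  proof
    assume "{t, s} = {r, q}"
    then consider "t = r" "s = q" | "t = q" "s = r" by (auto simp: doubleton_eq_iff)
    then show ?thesis by cases (use \<rho> Fr rpq in auto)
  qed (use \<rho> in simp)
qed

lemma \<rho>_right: "t \<in> {p..q} \<Longrightarrow> \<rho> (cis t) = t" and \<rho>_left: "t \<in> {r..p} \<Longrightarrow> \<rho> (cis t) = F t"
proof -
  show "\<rho> (cis t) = t" if "t \<in> {p..q}"
    using that rpq \<rho>_cis[of t] Fp by (cases "t = p") (auto simp del: Fp)
  show "\<rho> (cis t) = F t" if "t \<in> {r..p}"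
    using that rpq \<rho>_cis[of t] by simp
qed

lemma \<rho>_in: assumes "z \<in> unit_circle" shows "\<rho> z \<in> {p..q}"
proof -
  obtain t where "t \<in> {r..q}" "z = cis t" using circle_cis[OF assms] by blast
  then show ?thesis using F_Icc(1)[of t] \<rho>_cis[of t] by (cases "t \<le> p") auto
qed

text \<open>Continuity is checked on angles: \<open>cis\<close> from the compact interval
  \<open>{r..q}\<close> onto the circle is a quotient map, and there \<open>\<rho>\<close> is given
  by two formulas agreeing at \<open>p\<close>.\<close>

lemma continuous_\<rho>: "continuous_on unit_circle \<rho>"
proof -
  have "quotient_map (top_of_set {r..q}) (top_of_set unit_circle) cis"
  proof (rule continuous_imp_quotient_map)
    have "cis ` {r..q} = unit_circle" using circle_cis cis_in by blast
    then show "cis ` topspace (top_of_set {r..q}) = topspace (top_of_set unit_circle)" by simp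
    then show "continuous_map (top_of_set {r..q}) (top_of_set unit_circle) cis"
      by (auto intro!: continuous_intros)
    show "compact_space (top_of_set {r..q})" by (simp add: compact_space_subtopology)
    show "Hausdorff_space (top_of_set unit_circle)" by (simp add: Hausdorff_space_subtopology)
  qed
  moreover have "continuous_map (top_of_set {r..q}) euclideanreal (\<rho> \<circ> cis)"
  proof -
    have "continuous_on {r..q} (\<lambda>t. if t \<le> p then F t else t)"
      by (rule continuous_on_cases_le) (auto intro!: continuous_intros continuous_on_subset[OF cont_F])
    then have "continuous_on {r..q} (\<rho> \<circ> cis)" by (rule continuous_on_eq) (simp add: \<rho>_cis)
    then show ?thesis by simp
  qed
  ultimately have "continuous_map (top_of_set unit_circle) euclideanreal \<rho>"
    using continuous_compose_quotient_map by blast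
  then show ?thesis by simp
qed

text \<open>On the left arc folding is \<open>F\<close>, so applying \<open>f\<close> leaves
  \<open>\<rho>\<close> unchanged; on the right arc \<open>f\<close> followed by folding is
  \<open>F \<circ> F\<close>. Two steps use each arc once, which makes \<open>\<rho>\<close> a
  semiconjugacy from \<open>f \<circ> f\<close> to \<open>G\<close>.\<close>

lemma \<rho>_f: assumes "z \<in> unit_circle"
  shows "\<rho> (f z) = \<rho> z \<or> \<rho> (f z) = G (\<rho> z)" and "\<rho> (f (f z)) = G (\<rho> z)"
proof -
  obtain t where t: "t \<in> {r..q}" "z = cis t" using circle_cis[OF assms] by blast
  have "(\<rho> (f z) = \<rho> z \<or> \<rho> (f z) = G (\<rho> z)) \<and> \<rho> (f (f z)) = G (\<rho> z)"
  proof (cases "t \<le> p")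
    case True
    then have "t \<in> {r..p}" using t by simp
    then have "\<rho> z = F t" "\<rho> (f z) = F t" "\<rho> (f (f z)) = F (F (F t))"
      using \<rho>_left \<rho>_right[of "F t"] \<rho>_left[of "F (F t)"] F_Icc(1)[of t] F_Icc(2)[of "F t"]
      by (simp_all add: t lift)
    then show ?thesis by (simp add: G_def)
  next
    case False
    then have "t \<in> {p..q}" using t by simp
    then have "\<rho> z = t" "\<rho> (f z) = G t" "\<rho> (f (f z)) = G t"
      using \<rho>_right \<rho>_left[of "F t"] \<rho>_right[of "F (F t)"] F_Icc(2)[of t] F_Icc(1)[of "F t"]
      by (simp_all add: t lift G_def)
    then show ?thesis by simp
  qed
  then show "\<rho> (f z) = \<rho> z \<or> \<rho> (f z) = G (\<rho> z)" and "\<rho> (f (f z)) = G (\<rho> z)" by auto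
qed

lemma fpow_in: "z \<in> unit_circle \<Longrightarrow> (f ^^ n) z \<in> unit_circle" and gpow_in: "z \<in> unit_circle \<Longrightarrow> (g ^^ n) z \<in> unit_circle"
  by (induction n) (simp_all add: f_in g_in del: mem_sphere mem_sphere_0)

lemma \<rho>_g: assumes "z \<in> unit_circle"
  shows "\<rho> (g z) = \<rho> z \<or> \<rho> (g z) = Gi (\<rho> z)" and "\<rho> (g (g z)) = Gi (\<rho> z)"
proof -
  show "\<rho> (g z) = \<rho> z \<or> \<rho> (g z) = Gi (\<rho> z)"
    using \<rho>_f(1)[OF g_in[OF assms]] f_g[OF assms] by auto
  show "\<rho> (g (g z)) = Gi (\<rho> z)"
    using \<rho>_f(2)[OF g_in[OF g_in[OF assms]]] f_g[OF g_in[OF assms]] f_g[OF assms] by simp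
qed

lemma \<rho>_iterate:
  assumes "z \<in> unit_circle"
  shows "\<rho> ((f ^^ (2 * n)) z) = (G ^^ n) (\<rho> z)" "\<rho> ((f ^^ Suc (2 * n)) z) = (G ^^ n) (\<rho> (f z))"
    "\<rho> ((g ^^ (2 * n)) z) = (Gi ^^ n) (\<rho> z)" "\<rho> ((g ^^ Suc (2 * n)) z) = (Gi ^^ n) (\<rho> (g z))"
proof -
  have f: "\<rho> ((f ^^ (2 * n)) z) = (G ^^ n) (\<rho> z)" if "z \<in> unit_circle" for z
  proof (induction n)
    case (Suc n)
    then show ?case using \<rho>_f(2)[OF fpow_in[OF that, of "2 * n"]] by simp
  qed simp
  have g: "\<rho> ((g ^^ (2 * n)) z) = (Gi ^^ n) (\<rho> z)" if "z \<in> unit_circle" for z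
  proof (induction n)
    case (Suc n)
    then show ?case using \<rho>_g(2)[OF gpow_in[OF that, of "2 * n"]] by simp
  qed simp
  show "\<rho> ((f ^^ (2 * n)) z) = (G ^^ n) (\<rho> z)" "\<rho> ((g ^^ (2 * n)) z) = (Gi ^^ n) (\<rho> z)"
    using f g assms by blast+
  show "\<rho> ((f ^^ Suc (2 * n)) z) = (G ^^ n) (\<rho> (f z))" "\<rho> ((g ^^ Suc (2 * n)) z) = (Gi ^^ n) (\<rho> (g z))"
    using f[OF f_in[OF assms]] g[OF g_in[OF assms]] by (simp_all only: funpow_Suc_right o_apply)
qed

text \<open>The fixed points of \<open>G\<close> in \<open>{p..q}\<close> form a closed set.
  Removing the ends could spoil this only if an end were accumulated, and then \<open>cis\<close>
  would exhibit a fixed point of \<open>f\<close> accumulated by periodic points.\<close>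

lemma compact_inner_fixed:
  assumes "\<And>z. z \<in> fixed_points unit_circle f \<Longrightarrow> \<not> z islimpt periodic_points unit_circle f"
  shows "compact {t \<in> {p<..<q}. G t = t}" (is "compact ?A")
proof -
  have "closed ({p..q} \<inter> {t. G t = t})"
    by (intro closed_Int closed_atLeastAtMost closed_Collect_eq I.cont_G continuous_on_id)
  then have cl: "closed {t \<in> {p..q}. G t = t}" by (simp add: Int_def)
  have "closed ?A"
    unfolding closed_limpt
  proof (intro allI impI)
    fix x assume lim: "x islimpt ?A"
    then have "x islimpt {t \<in> {p..q}. G t = t}" by (rule islimpt_subset) auto
    then have x: "x \<in> {p..q}" "G x = x" using cl unfolding closed_limpt by blast+
    have "x \<notin> {p, q}"
    proof
      assume xpq: "x \<in> {p, q}"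
      have "cis x islimpt periodic_points unit_circle f"
        unfolding islimpt_approachable
      proof (intro allI impI)
        fix \<epsilon> :: real assume "\<epsilon> > 0"
        have "continuous_on UNIV cis" by (intro continuous_intros)
        then obtain \<delta> where \<delta>: "\<delta> > 0" "\<And>t. dist t x < \<delta> \<Longrightarrow> dist (cis t) (cis x) < \<epsilon>"
          using \<open>\<epsilon> > 0\<close> unfolding continuous_on_iff by blast
        then obtain t where t: "t \<in> ?A" "t \<noteq> x" "dist t x < \<delta>" using lim unfolding islimpt_approachable by blast
        then have "t \<in> {r<..<q}" "x \<in> {r..q}" using rpq x by auto
        then have "cis t \<noteq> cis x" using cis_inj_Ioo[of x t] t by metis
        moreover have "cis t \<in> periodic_points unit_circle f"
          using periodic_points_iff[of t] t \<open>t \<in> {r<..<q}\<close> by simp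
        ultimately show "\<exists>z\<in>periodic_points unit_circle f. z \<noteq> cis x \<and> dist z (cis x) < \<epsilon>"
          using \<delta>(2)[OF t(3)] by blast
      qed
      then show False using assms[of "cis x"] xpq fixed_points_eq by auto
    qed
    then show "x \<in> ?A" using x by auto
  qed
  moreover have "bounded ?A" by (rule bounded_subset[of "{p..q}"]) auto
  ultimately show ?thesis by (simp add: compact_eq_bounded_closed)
qed

lemma imp_kinematic_expansive:
  assumes iso: "\<And>z. z \<in> fixed_points unit_circle f \<Longrightarrow> \<not> z islimpt periodic_points unit_circle f"
    and fin: "finite (components (wandering_set unit_circle f))"
  shows "admits_kinematic_expansive_suspension unit_circle f"
proof -
  obtain C where "marked_interval_homeo G Gi p q C" using ex_marking[OF fin] by blast
  then interpret M: marked_interval_homeo G Gi p q C .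
  interpret Mi: marked_interval_homeo Gi G p q C by (rule M.inverse_marked_interval_homeo)
  obtain \<Theta> where \<Theta>: "continuous_on {p..q} \<Theta>" "\<And>x. x \<in> {p..q} \<Longrightarrow> 0 < \<Theta> x"
    and orbit: "\<And>x y. x \<in> {p..q} \<Longrightarrow> y \<in> {p..q} \<Longrightarrow> bdd_diff G \<Theta> x y \<Longrightarrow> bdd_diff Gi \<Theta> x y \<Longrightarrow>
       \<exists>n. y = (G ^^ n) x \<or> x = (G ^^ n) y"
    using M.ex_potential by blast
  define T where "T z = \<Theta> (\<rho> z)" for z
  have cont_T: "continuous_on unit_circle T"
    unfolding T_def by (rule continuous_on_compose2[OF \<Theta>(1) continuous_\<rho>]) (use \<rho>_in in blast)
  have T_pos: "0 < T z" if "z \<in> unit_circle" for z using \<Theta>(2) \<rho>_in[OF that] by (simp add: T_def)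
  interpret suspended_homeo unit_circle f g T
    by unfold_locales (use homeo cont_T T_pos in auto)
  \<comment> \<open>A compact subset of the open right arc that meets every \<open>G\<close>-orbit
    there. Since \<open>f\<close> carries that arc into the left one, compactness provides lower
    bounds \<open>a\<close> and \<open>a'\<close> for the displacement by \<open>f\<close> and by
    \<open>g\<close>.\<close>
  define K where "K = M.core \<union> {t \<in> {p<..<q}. G t = t}"
  have K: "K \<subseteq> {p<..<q}" using M.core_in by (auto simp: K_def)
  have "compact (cis ` K)"
    unfolding K_def by (intro compact_continuous_image continuous_intros compact_Un M.compact_core compact_inner_fixed iso)
  have Kc: "cis ` K \<subseteq> unit_circle" by auto
  have fK: "f z \<noteq> z" if z: "z \<in> cis ` K" for z
  proof -
    obtain t where t: "t \<in> {p<..<q}" "z = cis t" using z K by blast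
    have "F t \<in> {r<..<p}" using F_Ioo(2) t by blast
    then have "cis (F t) \<noteq> cis t" using cis_inj_Ioo[of "F t" t] t rpq by auto
    then show ?thesis by (simp add: t lift)
  qed
  have "continuous_on (cis ` K) (\<lambda>z. dist z (f z))"
    by (intro continuous_intros continuous_on_subset[OF cont_f Kc])
  moreover have "0 < dist z (f z)" if "z \<in> cis ` K" for z using fK[OF that] by simp
  ultimately obtain a where a: "a > 0" "\<And>z. z \<in> cis ` K \<Longrightarrow> a \<le> dist z (f z)"
    using compact_pos_lower_bound[OF \<open>compact (cis ` K)\<close>, of "\<lambda>z. dist z (f z)"] by blast
  have gK: "g z \<noteq> z" if "z \<in> cis ` K" for z
    using fK[OF that] f_g[of z] Kc that by fastforce
  have "continuous_on (cis ` K) (\<lambda>z. dist z (g z))"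
    by (intro continuous_intros continuous_on_subset[OF cont_g Kc])
  moreover have "0 < dist z (g z)" if "z \<in> cis ` K" for z using gK[OF that] by simp
  ultimately obtain a' where a': "a' > 0" "\<And>z. z \<in> cis ` K \<Longrightarrow> a' \<le> dist z (g z)"
    using compact_pos_lower_bound[OF \<open>compact (cis ` K)\<close>, of "\<lambda>z. dist z (g z)"] by blast
  obtain b where b: "b > 0" "\<And>t. t \<in> M.core \<Longrightarrow> b \<le> \<bar>G t - t\<bar>"
    by (rule compact_pos_lower_bound[OF M.compact_core, of "\<lambda>t. \<bar>G t - t\<bar>"])
       (use M.core_nonfixed in \<open>auto intro!: continuous_intros continuous_on_subset[OF I.cont_G]\<close>)
  have "uniformly_continuous_on unit_circle \<rho>" by (rule compact_uniformly_continuous[OF continuous_\<rho>]) simp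
  then obtain c where c: "c > 0" "\<And>x y. x \<in> unit_circle \<Longrightarrow> y \<in> unit_circle \<Longrightarrow> dist y x < c \<Longrightarrow> dist (\<rho> y) (\<rho> x) < b"
    unfolding uniformly_continuous_on_def using b(1) by blast
  \<comment> \<open>\<open>a\<close> and \<open>a'\<close> serve to separate a point from its image
    under \<open>f\<close>; \<open>c\<close> serves to separate points whose folded values lie on
    one \<open>G\<close>-orbit.\<close>
  define \<eta> where "\<eta> = min (min a a') c"
  have \<eta>: "\<eta> > 0" "\<eta> \<le> a" "\<eta> \<le> a'" "\<eta> \<le> c" using a a' c by (auto simp: \<eta>_def)

  have \<rho>_bdd: "bdd_diff G \<Theta> (\<rho> x) (\<rho> y)" "bdd_diff Gi \<Theta> (\<rho> x) (\<rho> y)"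
    if xy: "x \<in> unit_circle" "y \<in> unit_circle" and sh: "shadows f T \<eta> x y" "shadows g (T \<circ> g) \<eta> x y" for x y
  proof -
    have f: "bdd_diff G \<Theta> (\<rho> z) (\<rho> z)" "bdd_diff G \<Theta> (\<rho> z) (\<rho> (f z))" if "z \<in> unit_circle" for z
      using M.bdd_diff_iterate(1)[OF \<Theta>(1) \<rho>_in[OF that], of 0]
        M.bdd_diff_iterate(1)[OF \<Theta>(1) \<rho>_in[OF that], of 1] \<rho>_f(1)[OF that] by auto
    have g: "bdd_diff Gi \<Theta> (\<rho> z) (\<rho> (g z))" "bdd_diff Gi \<Theta> (\<rho> z) (\<rho> (g (g z)))" if "z \<in> unit_circle" for z
      using Mi.bdd_diff_iterate(1)[OF \<Theta>(1) \<rho>_in[OF that], of 0]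
        Mi.bdd_diff_iterate(1)[OF \<Theta>(1) \<rho>_in[OF that], of 1] \<rho>_g[OF that] by auto
    show "bdd_diff G \<Theta> (\<rho> x) (\<rho> y)"
      by (rule bdd_diff_of_shadows[OF sh(1), where a = "\<rho> x" and b = "\<rho> (f x)" and a' = "\<rho> y" and b' = "\<rho> (f y)"])
         (use f xy \<rho>_iterate(1,2) in \<open>simp_all only: T_def\<close>)
    have it: "(T \<circ> g) ((g ^^ (2 * i)) z) = \<Theta> ((Gi ^^ i) (\<rho> (g z)))"
        "(T \<circ> g) ((g ^^ Suc (2 * i)) z) = \<Theta> ((Gi ^^ i) (\<rho> (g (g z))))" if "z \<in> unit_circle" for z i
      using \<rho>_iterate(4)[OF that, of i] \<rho>_iterate(4)[OF g_in[OF that], of i]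
      by (simp_all add: T_def funpow_swap1)
    show "bdd_diff Gi \<Theta> (\<rho> x) (\<rho> y)"
      by (rule bdd_diff_of_shadows[OF sh(2) it[OF xy(1)] it[OF xy(2)] g[OF xy(1)] g[OF xy(2)]])
  qed

  \<comment> \<open>The potential cannot distinguish points of one \<open>G\<close>-orbit. A common
    iterate brings the first folded point into the core, where any further \<open>n \<ge> 1\<close>
    steps displace it by at least \<open>b\<close>, while shadowing keeps the folded values closer
    than \<open>b\<close>.\<close>
  have \<rho>_eq: "\<rho> x = \<rho> y"
    if xy: "x \<in> unit_circle" "y \<in> unit_circle" and sh: "shadows f T \<eta> x y" "shadows g (T \<circ> g) \<eta> x y"
      and n: "\<rho> y = (G ^^ n) (\<rho> x)" for x y n
  proof (rule ccontr)
    assume ne: "\<rho> x \<noteq> \<rho> y"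
    then have "n \<noteq> 0" using n by (metis funpow_0)
    have "G (\<rho> x) \<noteq> \<rho> x" using ne n I.Gpow_fixed by metis
    then obtain k where k: "(G ^^ k) (\<rho> x) \<in> M.core \<or> (Gi ^^ k) (\<rho> x) \<in> M.core"
      using M.ex_core[OF \<rho>_in[OF xy(1)]] by blast
    have far: "b \<le> \<bar>(G ^^ n) u - u\<bar>" if u: "u \<in> M.core" for u
    proof (cases "u \<le> G u")
      case True
      then have "G u \<le> (G ^^ n) u" using incseqD[OF I.Gpow_incseq, of u 1 n] \<open>n \<noteq> 0\<close> by simp
      then show ?thesis using b(2)[OF u] True by linarith
    next
      case False
      then have "(G ^^ n) u \<le> G u" using decseqD[OF I.Gpow_decseq, of u 1 n] \<open>n \<noteq> 0\<close> by simp
      then show ?thesis using b(2)[OF u] False by linarith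
    qed
    have near: "dist (\<rho> ((f ^^ m) y)) (\<rho> ((f ^^ m) x)) < b" "dist (\<rho> ((g ^^ m) y)) (\<rho> ((g ^^ m) x)) < b" for m
      using c(2)[OF fpow_in[OF xy(1), of m] fpow_in[OF xy(2), of m]]
        c(2)[OF gpow_in[OF xy(1), of m] gpow_in[OF xy(2), of m]] sh \<eta>(4)
      unfolding shadows_def by (metis dist_commute less_le_trans)+
    from k show False
    proof
      assume u: "(G ^^ k) (\<rho> x) \<in> M.core"
      have "(G ^^ k) (\<rho> y) = (G ^^ n) ((G ^^ k) (\<rho> x))" unfolding n by (metis funpow_funpow add.commute)
      then show False using far[OF u] near(1)[of "2 * k"] \<rho>_iterate(1) xy by (simp add: dist_real_def)
    next
      assume u: "(Gi ^^ k) (\<rho> x) \<in> M.core"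
      have "(G ^^ k) ((G ^^ n) ((Gi ^^ k) (\<rho> x))) = (G ^^ n) ((G ^^ k) ((Gi ^^ k) (\<rho> x)))"
        by (metis funpow_funpow add.commute)
      also have "\<dots> = (G ^^ k) ((Gi ^^ k) (\<rho> y))" by (simp add: n)
      finally have "(Gi ^^ k) (\<rho> y) = (G ^^ n) ((Gi ^^ k) (\<rho> x))" by (metis I.Gpow_eq)
      then show False using far[OF u] near(2)[of "2 * k"] \<rho>_iterate(3) xy by (simp add: dist_real_def)
    qed
  qed

  \<comment> \<open>The folding does not distinguish \<open>y\<close> from \<open>f y\<close>.
    Moving \<open>cis t = f y\<close> into the image of \<open>K\<close> contradicts the
    displacement bounds; forwards the comparison is made at time \<open>Suc (2 * n)\<close>, because
    \<open>y\<close> lags one step behind.\<close>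
  have not_image: False
    if xy: "y \<in> unit_circle" and t: "t \<in> {p..q}" "cis t = f y" "cis t \<noteq> y"
      and sh: "shadows f T \<eta> (cis t) y" "shadows g (T \<circ> g) \<eta> (cis t) y" for y t
  proof -
    have y: "y = g (cis t)" using g_f[OF xy] t by simp
    have tpq: "t \<in> {p<..<q}"
    proof -
      have "t \<noteq> p" "t \<noteq> q" using t(3) g_lift(1)[of t] g_lift(1)[of p] g_lift(1)[of q] y cis_r Fq' by auto
      then show ?thesis using t(1) by auto
    qed
    obtain n where n: "(G ^^ n) t \<in> K \<or> (Gi ^^ n) t \<in> K"
    proof (cases "G t = t")
      case True
      then have "(G ^^ 0) t \<in> K" using tpq by (simp add: K_def)
      then show ?thesis using that by blast
    next
      case False
      then show ?thesis using that M.ex_core[OF t(1)] unfolding K_def by blast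
    qed
    from n show False
    proof
      assume u: "(G ^^ n) t \<in> K"
      define w where "w = (f ^^ (2 * n)) (cis t)"
      have "w \<in> cis ` K" using u by (simp add: w_def fpow_double)
      moreover have "(f ^^ Suc (2 * n)) y = w" using t by (simp add: w_def funpow_swap1)
      moreover have "(f ^^ Suc (2 * n)) (cis t) = f w" by (simp add: w_def)
      moreover have "dist ((f ^^ Suc (2 * n)) (cis t)) ((f ^^ Suc (2 * n)) y) < \<eta>"
        using sh(1) unfolding shadows_def by blast
      ultimately show False using a(2)[of w] \<eta>(2) by (simp add: dist_commute)
    next
      assume u: "(Gi ^^ n) t \<in> K"
      define w where "w = (g ^^ (2 * n)) (cis t)"
      have gg: "g (g (cis s)) = cis (Gi s)" for s
        using g_lift(2)[of s] g_lift(1)[of "Gi s"] by simp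
      have "(g ^^ (2 * n)) (cis t) = cis ((Gi ^^ n) t)" for n
        by (induction n) (simp_all add: gg)
      then have "w \<in> cis ` K" using u by (simp add: w_def)
      moreover have "(g ^^ (2 * n)) y = g w" by (simp add: w_def y funpow_swap1)
      moreover have "dist ((g ^^ (2 * n)) (cis t)) ((g ^^ (2 * n)) y) < \<eta>"
        using sh(2) unfolding shadows_def by blast
      ultimately show False using a'(2)[of w] \<eta>(3) by (simp add: w_def)
    qed
  qed

  have "x = y"
    if xy: "x \<in> unit_circle" "y \<in> unit_circle" and sh: "shadows f T \<eta> x y" "shadows g (T \<circ> g) \<eta> x y" for x y
  proof (rule ccontr)
    assume ne: "x \<noteq> y"
    obtain n where "\<rho> y = (G ^^ n) (\<rho> x) \<or> \<rho> x = (G ^^ n) (\<rho> y)"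
      using orbit[OF \<rho>_in[OF xy(1)] \<rho>_in[OF xy(2)] \<rho>_bdd[OF xy sh]] by blast
    then have \<rho>: "\<rho> x = \<rho> y"
      using \<rho>_eq[OF xy sh, of n] \<rho>_eq[OF xy(2,1) sh[THEN shadows_sym], of n] by auto
    obtain s where s: "s \<in> {r..q}" "x = cis s" using circle_cis[OF xy(1)] by blast
    obtain t where t: "t \<in> {r..q}" "y = cis t" using circle_cis[OF xy(2)] by blast
    have eq: "(if s \<le> p then F s else s) = (if t \<le> p then F t else t)"
      using \<rho> \<rho>_cis s t by simp
    have "s \<noteq> t" using ne s t by auto
    \<comment> \<open>Folding is injective on each arc, so distinct angles with the same folded
      value lie on different arcs, and one is the image of the other.\<close>
    have "(s \<le> p \<and> t = F s) \<or> (t \<le> p \<and> s = F t)"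
    proof (cases "s \<le> p")
      case True
      then show ?thesis using eq \<open>s \<noteq> t\<close> F_eq[of s t] by presburger
    next
      case False
      then show ?thesis using eq \<open>s \<noteq> t\<close> by presburger
    qed
    then show False
    proof
      assume "s \<le> p \<and> t = F s"
      then have "t \<in> {p..q}" "cis t = f x" using s F_Icc(1)[of s] lift[of s] by auto
      then show False
        using not_image[OF xy(1)] ne sh[THEN shadows_sym] unfolding t(2) by metis
    next
      assume "t \<le> p \<and> s = F t"
      then have "s \<in> {p..q}" "cis s = f y" using t F_Icc(1)[of t] lift[of t] by auto
      then show False
        using not_image[OF xy(2)] ne sh unfolding s(2) by metis
    qed
  qed
  then have "\<exists>\<phi>. suspension_flow unit_circle f T \<phi> \<and> kinematic_expansive (suspension_space unit_circle f T) \<phi>"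
    unfolding kinematic_expansive_suspension_iff using \<eta>(1) by blast
  then show ?thesis
    unfolding admits_kinematic_expansive_suspension_def using cont_T T_pos by blast
qed

end

theorem theorem4p10:
  fixes f :: "complex \<Rightarrow> complex"
  assumes "orientation_reversing_homeo f"
  shows "admits_kinematic_expansive_suspension unit_circle f \<longleftrightarrow>
           wandering_set unit_circle f \<noteq> {} \<and>
           (\<forall>p \<in> fixed_points unit_circle f. \<not> p islimpt periodic_points unit_circle f) \<and>
           finite (components (wandering_set unit_circle f))"
proof -
  obtain g F p q where "circle_reversal f g F p q" using circle_reversalI[OF assms] by blast
  then interpret circle_reversal f g F p q .
  show ?thesis using kinematic_expansive_imp imp_kinematic_expansive by blast
qed

end
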